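(* Let $n,p\ge 1$ be integers, let $m_1,\dots,m_p$ and $l_1,\dots,l_n$ be non-negative integers with $|m|=m_1+\dots+m_p$, $|l|=l_1+\dots+l_n$, and let $b$, $d$, $c_1,\dots,c_p$, $z_1,\dots,z_n$ be complex parameters such that no denominators in the identity below vanish. Then $$\sum_{y_1,\dots,y_n=0}^{l_1,\dots,l_n}\Bigg(\frac{W(zq^y)}{W(z)} \prod_{\substack{1\leq k\leq n\\1\leq j\leq p}} \frac{(q^{m_j}c_jz_k,\,qz_k/c_j)_{y_k}}{(c_jz_k,\,q^{1-m_j}z_k/c_j)_{y_k}} \prod_{j,k=1}^n \frac{(z_jz_k,\,q^{-l_j}z_k/z_j)_{y_k}}{(qz_k/z_j,\,q^{1+l_j}z_jz_k)_{y_k}} \prod_{k=1}^n\frac{(bz_k,\,dz_k)_{y_k}}{(qz_k/b,\,qz_k/d)_{y_k}} \left(\frac{q^{1-|m|+|l|}}{bd}\right)^{|y|}\Bigg)$$ $$=\frac{(q/bd)_{|l|}}{(q^{-|l|}bd)_{|m|}}\cdot \frac{\prod_{j=1}^p(c_jb,\,c_jd)_{m_j}}{\prod_{k=1}^n(qz_k/b,\,qz_k/d)_{l_k}}\cdot \frac{\prod_{j,k=1}^n(qz_jz_k)_{l_k}} {\prod_{1\leq j<k\leq n}(qz_jz_k)_{l_j+l_k}}\cdot \frac{\prod_{1\leq j<k\leq p}(c_jc_k)_{m_j+m_k}} {\prod_{j,k=1}^p(c_jc_k)_{m_j}} \prod_{\substack{1\leq k\leq n\\1\leq j\leq p}}\frac{(q^{-l_k}c_j/z_k)_{m_j}}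 {(c_j/z_k)_{m_j}}$$ $$\times\sum_{x_1,\dots,x_p=0}^{m_1,\dots,m_p}\Bigg( \frac{W(q^{-1/2}cq^x)}{W(q^{-1/2}c)} \prod_{\substack {1\leq k\leq n\\1\leq j\leq p}} \frac{(q^{l_k}c_jz_k,\,c_j/z_k)_{x_j}} {(c_jz_k,\,q^{-l_k}c_j/z_k)_{x_j}} \prod_{j,k=1}^p\frac{(q^{-1}c_jc_k,\,q^{-m_k}c_j/c_k)_{x_j}} {(qc_j/c_k,\,q^{m_k}c_jc_k)_{x_j}}\prod_{j=1}^p \frac{(c_j/b,\,c_j/d)_{x_j}}{(c_jb,\,c_jd)_{x_j}} \left(q^{|m|-|l|}bd\right)^{|x|}\Bigg).$$
   Context: Throughout, $q$ is a fixed complex number with $0<|q|<1$. For an integer $k\ge0$, $(a)_k=(1-a)(1-aq)\cdots(1-aq^{k-1})$ (so $(a)_0=1$), and $(a_1,\dots,a_r)_k=(a_1)_k\cdots(a_r)_k$. An expression such as $q/bd$ means $q/(bd)$. For a tuple $y$ (or $x$), $|y|$ denotes the sum of its coordinates. A tuple $zq^y$ means $(z_1q^{y_1},\dots,z_nq^{y_n})$, and $q^{-1/2}cq^x=(q^{-1/2}c_1q^{x_1},\dots,q^{-1/2}c_pq^{x_p})$. For an $N$-tuple $u=(u_1,\dots,u_N)$, $W(u)=\prod_{1\le j\le k\le N}(1-u_ju_k)\prod_{1\le j<k\le N}(u_j-u_k)$. Hence $$\frac{W(zq^y)}{W(z)}=\prod_{1\le j\le k\le n}\frac{1-z_jz_kq^{y_j+y_k}}{1-z_jz_k}\prod_{1\le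 j<k\le n}\frac{q^{y_j}z_j-q^{y_k}z_k}{z_j-z_k},$$ $$\frac{W(q^{-1/2}cq^x)}{W(q^{-1/2}c)}=\prod_{1\le j\le k\le p}\frac{1-q^{-1}c_jc_kq^{x_j+x_k}}{1-q^{-1}c_jc_k}\prod_{1\le j<k\le p}\frac{q^{x_j}c_j-q^{x_k}c_k}{c_j-c_k},$$ the latter not depending on the choice of $q^{1/2}$. The sum $\sum_{y_1,\dots,y_n=0}^{l_1,\dots,l_n}$ is over all integers $0\le y_i\le l_i$, and similarly for $x$ and $m$. The assumption that no denominators vanish includes that parameters by which one divides are non-zero. *)

theory Defs
  imports Complex_Main "HOL-Library.FuncSet"
begin

(* An N-tuple is a function on nat of which only the values at 1, ..., N are used. *)

definition qpoch :: "complex \<Rightarrow> complex \<Rightarrow> nat \<Rightarrow> complex" where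
  "qpoch q a k = (\<Prod>i<k. 1 - a * q ^ i)"

definition W :: "nat \<Rightarrow> (nat \<Rightarrow> complex) \<Rightarrow> complex" where
  "W N u = (\<Prod>j\<in>{1..N}. \<Prod>k\<in>{j..N}. 1 - u j * u k) * (\<Prod>j\<in>{1..N}. \<Prod>k\<in>{j<..N}. u j - u k)"

abbreviation tsum :: "nat \<Rightarrow> (nat \<Rightarrow> nat) \<Rightarrow> nat" where
  "tsum N u \<equiv> (\<Sum>i\<in>{1..N}. u i)"

(* The multi-indices of length N with 0 \<le> y i \<le> l i, extended by undefined outside {1..N}
   so that each multi-index is represented by exactly one function. *)
definition index_box :: "nat \<Rightarrow> (nat \<Rightarrow> nat) \<Rightarrow> (nat \<Rightarrow> nat) set" where
  "index_box N l = PiE {1..N} (\<lambda>i. {0..l i})"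

end

theory Submission
  imports Defs "HOL-Computational_Algebra.Polynomial" "HOL-Library.Product_Lexorder"
    "HOL-Analysis.Continuum_Not_Denumerable"
begin

text \<open>
  If all \<open>l k\<close> and \<open>m j\<close> equal 1, put \<open>a = s z\<close>. Up to a factor independent of the signs, the left-hand
  side is a sum over all choices \<open>A i\<close> of \<open>a i\<close> or its inverse, invariant under permutations and
  inversions of the \<open>a i\<close>, and the right-hand side is the same sum with the roles of \<open>a\<close> and \<open>c\<close>
  exchanged. As a function of one \<open>a i\<close> either sum is a Laurent polynomial of the same bounded degree: for
  the sum over \<open>A\<close> the apparent poles cancel by symmetry, for the dual sum this is visible. Letting \<open>a i\<close> tend
  to infinity, or taking \<open>a i = s c k\<close>, reduces both sums to fewer variables, so the
  identity follows by induction.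

  The general case is the specialisation of the variables to geometric progressions
  \<open>z k, q z k, \<dots>, q ^ (l k - 1) z k\<close> and \<open>c j, \<dots>, q ^ (m j - 1) c j\<close>: sign choices that are not
  constant on an initial segment of each progression and its complement contribute zero, and the length of
  the segment is the summation index. This requires generic parameters; the general case follows by
  continuity along a curve of parameters that is generic outside a countable set.
\<close>

text \<open>With general exponents \<open>l\<close> and \<open>m\<close> neither series is symmetric
  enough for interpolation. With all exponents 1 both are, and the number of variables is arbitrary;
  that is why progressions can stand in for exponents. After multiplication by a power of
  \<open>a i\<close>, both sums have degree in \<open>a i\<close> at most twice the number of the
  \<open>c k\<close>. The nodes \<open>s * c k\<close> and their inverses are one point short of
  determining such a polynomial; the limit at infinity supplies the missing datum. The limit removes
  \<open>a i\<close> alone, a node removes \<open>a i\<close> together with \<open>c k\<close>, so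
  the induction runs on the \<open>a i\<close> for all sets of \<open>c k\<close> at once. The
  square root \<open>s\<close> of \<open>q\<close> centres the variables so that the hidden symmetry
  becomes plain inversion. With \<open>\<beta> = b / s\<close> and \<open>\<delta> = d / s\<close>,
  comparison at a node forces the dual values \<open>1 / (s * \<beta>)\<close> and
  \<open>1 / (s * \<delta>)\<close>. In the original parameters the exchange sends \<open>z\<close>,
  \<open>c\<close>, \<open>b\<close>, \<open>d\<close> to \<open>c / s\<close>,
  \<open>s * z\<close>, \<open>s / b\<close>, \<open>s / d\<close>, so one computation on
  progressions serves both sides. Generic parameters keep numerators as well as denominators from
  vanishing, because terms are compared through quotients of neighbours.\<close>

definition pairprod :: "'a::linorder set \<Rightarrow> ('a \<Rightarrow> 'a \<Rightarrow> complex) \<Rightarrow> complex" where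
  "pairprod I f = (\<Prod>i\<in>I. \<Prod>j\<in>{j\<in>I. i < j}. f i j)"

lemma pairprod_empty [simp]: "pairprod {} f = 1"
  by (simp add: pairprod_def)

lemma pairprod_cong:
  assumes "\<And>i j. i \<in> I \<Longrightarrow> j \<in> I \<Longrightarrow> i < j \<Longrightarrow> f i j = g i j"
  shows "pairprod I f = pairprod I g"
  unfolding pairprod_def using assms by (intro prod.cong) auto

lemma pairprod_mult: "pairprod I (\<lambda>i j. f i j * g i j) = pairprod I f * pairprod I g"
  by (simp add: pairprod_def prod.distrib)

text \<open>The new index may lie anywhere in the order, so the pairs in which it comes second have
  to be turned round; this is where symmetry in the new index enters. Each factor
  \<open>f k i\<close> is credited to one of the two orders while the other contributes 1.\<close>

lemma pairprod_insert:
  assumes "finite I" "k \<notin> I" and sym: "\<And>i. i \<in> I \<Longrightarrow> f i k = f k i"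
  shows "pairprod (insert k I) f = (\<Prod>i\<in>I. f k i) * pairprod I f"
proof -
  have split: "(\<Prod>j\<in>{j\<in>insert k I. i < j}. f i j)
      = (if i < k then f k i else 1) * (\<Prod>j\<in>{j\<in>I. i < j}. f i j)" if "i \<in> I" for i
  proof (cases "i < k")
    case True
    then have "{j\<in>insert k I. i < j} = insert k {j\<in>I. i < j}" by auto
    with True that assms show ?thesis by simp
  next
    case False
    then have "{j\<in>insert k I. i < j} = {j\<in>I. i < j}" by auto
    with False show ?thesis by simp
  qed
  have eq: "{j\<in>insert k I. k < j} = {j\<in>I. k < j}" by auto
  have neg: "{j\<in>I. \<not> k < j} = {j\<in>I. j < k}"
    using assms(2) by (auto simp: not_less order.order_iff_strict)
  have "(\<Prod>i\<in>I. f k i) = (\<Prod>i\<in>I. (if k < i then f k i else 1) * (if i < k then f k i else 1))"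
    using assms(2) by (intro prod.cong refl) (metis linorder_neqE mult.left_neutral mult.right_neutral order.asym)
  also have "\<dots> = (\<Prod>j\<in>{j\<in>I. k < j}. f k j) * (\<Prod>i\<in>I. if i < k then f k i else 1)"
    using assms(1) by (simp add: prod.distrib prod.inter_filter)
  finally have key: "(\<Prod>i\<in>I. f k i)
      = (\<Prod>j\<in>{j\<in>I. k < j}. f k j) * (\<Prod>i\<in>I. if i < k then f k i else 1)" .
  have "pairprod (insert k I) f = (\<Prod>j\<in>{j\<in>insert k I. k < j}. f k j)
      * (\<Prod>i\<in>I. \<Prod>j\<in>{j\<in>insert k I. i < j}. f i j)"
    unfolding pairprod_def using assms(1,2) by (rule prod.insert)
  also have "\<dots> = (\<Prod>j\<in>{j\<in>I. k < j}. f k j)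
      * (\<Prod>i\<in>I. (if i < k then f k i else 1) * (\<Prod>j\<in>{j\<in>I. i < j}. f i j))"
    unfolding eq by (intro arg_cong2[where f = times] prod.cong refl split)
  finally have "pairprod (insert k I) f = \<dots>" .
  then show ?thesis
    by (simp add: key prod.distrib pairprod_def)
qed

lemma sum_Pow_insert:
  fixes g :: "'a set \<Rightarrow> complex"
  assumes "finite I" "i \<notin> I"
  shows "(\<Sum>S\<in>Pow (insert i I). g S) = (\<Sum>S\<in>Pow I. g (insert i S) + g S)"
proof -
  have "inj_on (insert i) (Pow I)"
    using assms(2) by (auto simp: inj_on_def)
  moreover have "Pow I \<inter> insert i ` Pow I = {}"
    using assms(2) by auto
  ultimately show ?thesis
    using assms(1) by (simp add: Pow_insert sum.union_disjoint sum.reindex sum.distrib add.commute)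
qed

section \<open>Polynomial functions with prescribed leading coefficient\<close>

text \<open>The number \<open>c\<close> is the coefficient of \<open>x ^ d\<close>; it may vanish, so \<open>d\<close> only bounds the degree.\<close>

definition polyfun :: "(complex \<Rightarrow> complex) \<Rightarrow> nat \<Rightarrow> complex \<Rightarrow> bool" where
  "polyfun f d c \<longleftrightarrow> (\<exists>Q. degree Q \<le> d \<and> coeff Q d = c \<and> (\<forall>x. poly Q x = f x))"

lemma polyfun_const: "polyfun (\<lambda>x. c) 0 c"
  unfolding polyfun_def by (intro exI[of _ "[:c:]"]) auto

lemma polyfun_linear: "polyfun (\<lambda>x. u + v * x) 1 v"
  unfolding polyfun_def by (intro exI[of _ "[:u, v:]"]) (auto simp: mult.commute)

lemma polyfun_add:
  assumes "polyfun f d c" "polyfun g d c'"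
  shows "polyfun (\<lambda>x. f x + g x) d (c + c')"
proof -
  from assms obtain P Q where "degree P \<le> d" "coeff P d = c" "\<forall>x. poly P x = f x"
    "degree Q \<le> d" "coeff Q d = c'" "\<forall>x. poly Q x = g x"
    unfolding polyfun_def by blast
  then show ?thesis
    unfolding polyfun_def by (intro exI[of _ "P + Q"]) (auto intro: degree_add_le)
qed

lemma polyfun_mult:
  assumes "polyfun f d c" "polyfun g e c'"
  shows "polyfun (\<lambda>x. f x * g x) (d + e) (c * c')"
proof -
  from assms obtain P Q where P: "degree P \<le> d" "coeff P d = c" "\<forall>x. poly P x = f x"
    and Q: "degree Q \<le> e" "coeff Q e = c'" "\<forall>x. poly Q x = g x"
    unfolding polyfun_def by blast
  have "coeff (P * Q) (d + e) = c * c'"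
  proof (cases "degree P = d \<and> degree Q = e")
    case True
    then show ?thesis using P(2) Q(2) coeff_mult_degree_sum[of P Q] by auto
  next
    case False
    then have "degree P < d \<or> degree Q < e" using P Q by auto
    then have "c * c' = 0" using P(2) Q(2) coeff_eq_0 by (metis mult_eq_0_iff)
    moreover have "degree (P * Q) < d + e"
      using False P(1) Q(1) degree_mult_le[of P Q] by linarith
    ultimately show ?thesis by (simp add: coeff_eq_0)
  qed
  moreover have "degree (P * Q) \<le> d + e"
    using P(1) Q(1) degree_mult_le[of P Q] by linarith
  ultimately show ?thesis
    unfolding polyfun_def using P(3) Q(3) by (intro exI[of _ "P * Q"]) auto
qed

lemma polyfun_cmult: "polyfun f d c \<Longrightarrow> polyfun (\<lambda>x. u * f x) d (u * c)"
  using polyfun_mult[OF polyfun_const[of u]] by simp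

lemma polyfun_prod:
  assumes "finite I" "\<And>i. i \<in> I \<Longrightarrow> polyfun (f i) d (c i)"
  shows "polyfun (\<lambda>x. \<Prod>i\<in>I. f i x) (d * card I) (\<Prod>i\<in>I. c i)"
  using assms
proof (induction I rule: finite_induct)
  case empty
  then show ?case by (simp add: polyfun_const)
next
  case (insert i I)
  then show ?case using polyfun_mult[of "f i" d "c i" "\<lambda>x. \<Prod>i\<in>I. f i x" "d * card I"]
    by (simp add: add.commute)
qed

lemma polyfun_sum:
  assumes "finite I" "\<And>i. i \<in> I \<Longrightarrow> polyfun (f i) d (c i)"
  shows "polyfun (\<lambda>x. \<Sum>i\<in>I. f i x) d (\<Sum>i\<in>I. c i)"
  using assms
proof (induction I rule: finite_induct)
  case empty
  then show ?case unfolding polyfun_def by (intro exI[of _ 0]) auto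
next
  case (insert i I)
  then show ?case using polyfun_add by simp
qed

lemma polyfun_quadratic:
  "polyfun (\<lambda>x. (u + v * x) * (u' + v' * x)) 2 (v * v')"
  using polyfun_mult[OF polyfun_linear[of u v] polyfun_linear[of u' v']]
  by (simp add: numeral_2_eq_2)

lemma prod_roots_dvd:
  fixes Q :: "complex poly"
  assumes "finite Z" "\<And>z. z \<in> Z \<Longrightarrow> poly Q z = 0"
  shows "(\<Prod>z\<in>Z. [:-z, 1:]) dvd Q"
  using assms
proof (induction Z arbitrary: Q rule: finite_induct)
  case empty
  then show ?case by simp
next
  case (insert w Z)
  then obtain Q' where Q': "Q = [:-w, 1:] * Q'"
    by (metis dvdE insertI1 poly_eq_0_iff_dvd)
  have "poly Q' z = 0" if "z \<in> Z" for z
    using insert.prems[of z] insert.hyps(2) that unfolding Q' by auto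
  then have "(\<Prod>z\<in>Z. [:-z, 1:]) dvd Q'" by (rule insert.IH)
  then show ?case
    unfolding Q' prod.insert[OF insert.hyps] by (rule mult_dvd_mono[OF dvd_refl])
qed

text \<open>The divisor is monic of degree \<open>card Z\<close>, so the coefficient at the bound
  passes unchanged to the quotient, even when it is 0 and the bound is not attained.\<close>

lemma polyfun_divide_roots:
  assumes f: "polyfun f (card Z + d) c" and Z: "finite Z" "\<And>z. z \<in> Z \<Longrightarrow> f z = 0"
  obtains g where "polyfun g d c" "\<And>x. f x = (\<Prod>z\<in>Z. x - z) * g x"
proof -
  obtain Q where Q: "degree Q \<le> card Z + d" "coeff Q (card Z + d) = c" "\<And>x. poly Q x = f x"
    using f unfolding polyfun_def by blast
  let ?V = "\<Prod>z\<in>Z. [:-z, 1:]"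
  obtain R where R: "Q = ?V * R"
    using prod_roots_dvd[of Z Q] Z Q(3) by auto
  have dV: "degree ?V = card Z"
    by (subst degree_prod_eq_sum_degree) auto
  have lV: "coeff ?V (card Z) = 1"
    using lead_coeff_prod[of "\<lambda>z. [:-z, 1:]" Z] dV by simp
  have V0: "?V \<noteq> 0" using lV by auto
  have deg: "degree R \<le> d"
  proof (cases "R = 0")
    case False
    then have "degree Q = card Z + degree R"
      unfolding R using degree_mult_eq[OF V0 False] dV by simp
    then show ?thesis using Q(1) by simp
  qed simp
  have "coeff R d = c"
  proof (cases "degree R = d")
    case True
    then show ?thesis using Q(2) coeff_mult_degree_sum[of ?V R] lV dV unfolding R by simp
  next
    case False
    then have "degree R < d" using deg by simp
    moreover have "degree Q < card Z + d"
      using degree_mult_le[of ?V R] dV \<open>degree R < d\<close> unfolding R by simp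
    ultimately show ?thesis using Q(2) by (simp add: coeff_eq_0)
  qed
  moreover have "f x = (\<Prod>z\<in>Z. x - z) * poly R x" for x
    using Q(3)[of x] unfolding R by (simp add: poly_prod)
  ultimately show ?thesis
    using that[of "poly R"] deg unfolding polyfun_def by blast
qed

text \<open>In the difference the coefficients of order \<open>d\<close> cancel, so \<open>d\<close>
  zeros already force it to vanish; agreement at one point less than usual suffices.\<close>

lemma polyfun_eq:
  assumes "polyfun f d c" "polyfun g d c" "finite Z" "card Z = d" "\<And>z. z \<in> Z \<Longrightarrow> f z = g z"
  shows "f x = g x"
proof -
  obtain P Q where P: "degree P \<le> d" "coeff P d = c" "\<And>x. poly P x = f x"
    and Q: "degree Q \<le> d" "coeff Q d = c" "\<And>x. poly Q x = g x"
    using assms(1,2) unfolding polyfun_def by metis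
  have "P - Q = 0"
  proof (rule ccontr)
    assume nz: "P - Q \<noteq> 0"
    have "Z \<subseteq> {x. poly (P - Q) x = 0}" using assms(5) P(3) Q(3) by auto
    then have "d \<le> card {x. poly (P - Q) x = 0}"
      using card_mono[OF poly_roots_finite[OF nz]] assms(4) by blast
    also have "\<dots> \<le> degree (P - Q)" using card_poly_roots_bound[OF nz] .
    finally have "degree (P - Q) = d"
      using degree_diff_le[OF P(1) Q(1)] by simp
    then have "coeff (P - Q) d \<noteq> 0" using nz leading_coeff_0_iff by metis
    then show False using P(2) Q(2) by simp
  qed
  then show ?thesis using P(3)[of x] Q(3)[of x] by simp
qed

section \<open>A duality for sums over sign choices\<close>

text \<open>The zero at \<open>t = q\<close> is what truncates the sum on progressions of ratio
  \<open>q\<close>; the pole at \<open>t = 1\<close> is the source of the apparent poles.\<close>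

definition hfac :: "complex \<Rightarrow> complex \<Rightarrow> complex" where
  "hfac q t = (1 - t / q) / (1 - t)"

text \<open>For non-zero \<open>x\<close> and \<open>C k\<close> the factor of \<open>k\<close>
  equals \<open>1 / x - s * (C k + 1 / C k) + s\<^sup>2 * x\<close>. Hence it is invariant under
  inversion of \<open>C k\<close>, though not of \<open>x\<close>.\<close>

definition weight :: "complex \<Rightarrow> complex \<Rightarrow> complex \<Rightarrow> 'b set \<Rightarrow> ('b \<Rightarrow> complex) \<Rightarrow> complex \<Rightarrow> complex" where
  "weight s \<beta> \<delta> J C x = (1 - \<beta> * x) * (1 - \<delta> * x) / (1 - x\<^sup>2)
     * (\<Prod>k\<in>J. (1 - s * C k * x) * (1 - s * x / C k) / x)"

definition summand :: "complex \<Rightarrow> complex \<Rightarrow> complex \<Rightarrow> 'a::linorder set \<Rightarrow> 'b set \<Rightarrow> ('b \<Rightarrow> complex)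
    \<Rightarrow> ('a \<Rightarrow> complex) \<Rightarrow> complex" where
  "summand s \<beta> \<delta> I J C A = (\<Prod>i\<in>I. weight s \<beta> \<delta> J C (A i)) * pairprod I (\<lambda>i j. hfac (s\<^sup>2) (A i * A j))"

definition flip :: "('a \<Rightarrow> complex) \<Rightarrow> 'a set \<Rightarrow> 'a \<Rightarrow> complex" where
  "flip a S i = (if i \<in> S then a i else inverse (a i))"

text \<open>Each coordinate \<open>A i\<close> ranges independently over \<open>a i\<close> and \<open>inverse (a i)\<close>; the subset \<open>S\<close>
  records where \<open>a i\<close> is chosen.\<close>

definition signsum :: "complex \<Rightarrow> complex \<Rightarrow> complex \<Rightarrow> 'a::linorder set \<Rightarrow> ('a \<Rightarrow> complex) \<Rightarrow> 'b set
    \<Rightarrow> ('b \<Rightarrow> complex) \<Rightarrow> complex" where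
  "signsum s \<beta> \<delta> I a J C = (\<Sum>S\<in>Pow I. summand s \<beta> \<delta> I J C (flip a S))"

text \<open>For non-zero \<open>a i\<close> this says that the numbers 1, -1, all \<open>a i\<close>
  and all \<open>inverse (a i)\<close> are pairwise different.\<close>

definition generic_points :: "'a set \<Rightarrow> ('a \<Rightarrow> complex) \<Rightarrow> bool" where
  "generic_points I a \<longleftrightarrow> (\<forall>i\<in>I. a i \<noteq> 0 \<and> (a i)\<^sup>2 \<noteq> 1)
     \<and> (\<forall>i\<in>I. \<forall>j\<in>I. i \<noteq> j \<longrightarrow> a i \<noteq> a j \<and> a i * a j \<noteq> 1)"

section \<open>Splitting off one variable from a sum over sign choices\<close>

lemma summand_cong:
  assumes "\<And>i. i \<in> I \<Longrightarrow> A i = B i"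
  shows "summand s \<beta> \<delta> I J C A = summand s \<beta> \<delta> I J C B"
  unfolding summand_def using assms
  by (intro arg_cong2[where f = times] prod.cong pairprod_cong) auto

lemma summand_insert:
  assumes "finite I" "i \<notin> I"
  shows "summand s \<beta> \<delta> (insert i I) J C A = weight s \<beta> \<delta> J C (A i)
     * (\<Prod>j\<in>I. hfac (s\<^sup>2) (A i * A j)) * summand s \<beta> \<delta> I J C A"
  unfolding summand_def
  by (subst pairprod_insert) (use assms in \<open>auto simp: mult.commute\<close>)

lemma summand_fun_upd:
  assumes "finite I" "i \<notin> I"
  shows "summand s \<beta> \<delta> (insert i I) J C (A(i := x)) = weight s \<beta> \<delta> J C x
     * (\<Prod>j\<in>I. hfac (s\<^sup>2) (x * A j)) * summand s \<beta> \<delta> I J C A"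
proof -
  have "summand s \<beta> \<delta> I J C (A(i := x)) = summand s \<beta> \<delta> I J C A"
    using assms by (intro summand_cong) auto
  moreover have "(\<Prod>j\<in>I. hfac (s\<^sup>2) (x * (A(i := x)) j)) = (\<Prod>j\<in>I. hfac (s\<^sup>2) (x * A j))"
    using assms by (intro prod.cong) auto
  ultimately show ?thesis using assms by (simp add: summand_insert)
qed

lemma sum_flip_insert:
  fixes F :: "('a \<Rightarrow> complex) \<Rightarrow> complex"
  assumes "finite I" "i \<notin> I"
  shows "(\<Sum>S\<in>Pow (insert i I). F (flip a S))
    = (\<Sum>S\<in>Pow I. F ((flip a S)(i := a i)) + F ((flip a S)(i := inverse (a i))))"
proof -
  have "flip a (insert i S) = (flip a S)(i := a i)" for S
    by (auto simp: flip_def)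
  moreover have "(flip a S)(i := inverse (a i)) = flip a S" if "S \<in> Pow I" for S
    using that assms(2) by (auto simp: flip_def fun_eq_iff)
  ultimately show ?thesis
    using sum_Pow_insert[OF assms, of "\<lambda>S. F (flip a S)"] by (auto intro!: sum.cong)
qed

text \<open>Isolates the dependence on one variable: \<open>x\<close> occurs only in the bracket,
  and the bracket does not change when \<open>x\<close> and \<open>inverse x\<close> are
  exchanged.\<close>

lemma signsum_insert:
  assumes "finite I" "i \<notin> I"
  shows "signsum s \<beta> \<delta> (insert i I) (a(i := x)) J C
    = (\<Sum>S\<in>Pow I. summand s \<beta> \<delta> I J C (flip a S)
        * (weight s \<beta> \<delta> J C x * (\<Prod>j\<in>I. hfac (s\<^sup>2) (x * flip a S j))
         + weight s \<beta> \<delta> J C (inverse x) * (\<Prod>j\<in>I. hfac (s\<^sup>2) (inverse x * flip a S j))))"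
proof -
  have *: "(flip (a(i := x)) S)(i := v) = (flip a S)(i := v)" for S v
    by (auto simp: flip_def)
  show ?thesis
    unfolding signsum_def sum_flip_insert[OF assms]
    by (simp add: * summand_fun_upd[OF assms] algebra_simps)
qed

lemma signsum_inverse:
  assumes "finite I" "i \<notin> I"
  shows "signsum s \<beta> \<delta> (insert i I) (a(i := inverse x)) J C
    = signsum s \<beta> \<delta> (insert i I) (a(i := x)) J C"
  unfolding signsum_insert[OF assms] by (simp add: add.commute)

lemma weight_eq:
  "weight s \<beta> \<delta> J C x
    = (1 - \<beta> * x) * (1 - \<delta> * x) * (\<Prod>k\<in>J. (1 - s * C k * x) * (1 - s / C k * x)) / ((1 - x\<^sup>2) * x ^ card J)"
  by (simp add: weight_def prod_dividef)

lemma weight_inverse: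
  assumes "x \<noteq> 0" "x\<^sup>2 \<noteq> 1"
  shows "weight s \<beta> \<delta> J C (inverse x)
    = (x - \<beta>) * (x - \<delta>) * (\<Prod>k\<in>J. (x - s * C k) * (x - s / C k)) / ((x\<^sup>2 - 1) * x ^ card J)"
proof -
  have "(1 - s * C k * inverse x) * (1 - s * inverse x / C k) / inverse x = (x - s * C k) * (x - s / C k) / x" for k
    using assms by (cases "C k = 0") (simp_all add: field_simps)
  then have "(\<Prod>k\<in>J. (1 - s * C k * inverse x) * (1 - s * inverse x / C k) / inverse x)
     = (\<Prod>k\<in>J. (x - s * C k) * (x - s / C k)) / x ^ card J"
    by (simp add: prod_dividef)
  moreover have "(1 - \<beta> * inverse x) * (1 - \<delta> * inverse x) / (1 - (inverse x)\<^sup>2) = (x - \<beta>) * (x - \<delta>) / (x\<^sup>2 - 1)"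
    using assms by (simp add: field_simps power2_eq_square)
  ultimately show ?thesis
    by (simp add: weight_def)
qed

text \<open>Up to the factor \<open>summand\<close> of the remaining variables, the two contributions \<open>x\<close> and \<open>inverse x\<close>
  of one variable after multiplication by the product of the apparent poles: \<open>1\<close>, \<open>-1\<close> and
  all \<open>a j\<close>, \<open>inverse (a j)\<close>. The linear factors are kept in the shape \<open>u + v * x\<close>, from which leading coefficients are read off.\<close>

definition cleared :: "complex \<Rightarrow> complex \<Rightarrow> complex \<Rightarrow> 'a set \<Rightarrow> 'b set \<Rightarrow> ('b \<Rightarrow> complex)
    \<Rightarrow> ('a \<Rightarrow> complex) \<Rightarrow> complex \<Rightarrow> complex" where
  "cleared s \<beta> \<delta> I J C A x =
     - 1 * ((1 + (- \<beta>) * x) * (1 + (- \<delta>) * x) * (\<Prod>k\<in>J. (1 + (- (s * C k)) * x) * (1 + (- (s / C k)) * x))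
        * (\<Prod>j\<in>I. (- A j + 1 * x) * (- inverse (A j) + (1 / s\<^sup>2) * x)))
     + (- \<beta> + 1 * x) * (- \<delta> + 1 * x) * (\<Prod>k\<in>J. (- (s * C k) + 1 * x) * (- (s / C k) + 1 * x))
        * (\<Prod>j\<in>I. (- (A j / s\<^sup>2) + 1 * x) * (- inverse (A j) + 1 * x))"

text \<open>The second product is monic. In the first, each \<open>k\<close> contributes
  \<open>s\<^sup>2\<close>, because \<open>C k\<close> cancels, and each \<open>j\<close>
  contributes \<open>1 / s\<^sup>2\<close>. The coefficient therefore does not depend on
  \<open>A\<close>, that is, on the sign choice.\<close>

lemma polyfun_cleared:
  assumes "finite I" "finite J" "s \<noteq> 0" "\<And>k. k \<in> J \<Longrightarrow> C k \<noteq> 0"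
  shows "polyfun (cleared s \<beta> \<delta> I J C A) (2 + 2 * card I + 2 * card J)
    (1 - \<beta> * \<delta> * s\<^sup>2 ^ card J / s\<^sup>2 ^ card I)"
proof -
  have P: "polyfun (\<lambda>x. (1 + (- \<beta>) * x) * (1 + (- \<delta>) * x) * (\<Prod>k\<in>J. (1 + (- (s * C k)) * x) * (1 + (- (s / C k)) * x))
        * (\<Prod>j\<in>I. (- A j + 1 * x) * (- inverse (A j) + (1 / s\<^sup>2) * x)))
      (2 + 2 * card J + 2 * card I)
      ((- \<beta>) * (- \<delta>) * (\<Prod>k\<in>J. (- (s * C k)) * (- (s / C k))) * (\<Prod>j\<in>I. 1 * (1 / s\<^sup>2)))"
    by (intro polyfun_mult polyfun_quadratic polyfun_prod assms)
  have M: "polyfun (\<lambda>x. (- \<beta> + 1 * x) * (- \<delta> + 1 * x) * (\<Prod>k\<in>J. (- (s * C k) + 1 * x) * (- (s / C k) + 1 * x))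
        * (\<Prod>j\<in>I. (- (A j / s\<^sup>2) + 1 * x) * (- inverse (A j) + 1 * x)))
      (2 + 2 * card J + 2 * card I)
      (1 * 1 * (\<Prod>k\<in>J. 1 * 1) * (\<Prod>j\<in>I. 1 * 1))"
    by (intro polyfun_mult polyfun_quadratic polyfun_prod assms)
  have "(\<Prod>k\<in>J. (- (s * C k)) * (- (s / C k))) = s\<^sup>2 ^ card J"
    using assms(4) by (simp add: power2_eq_square)
  then show ?thesis
    using polyfun_add[OF polyfun_cmult[OF P, of "- 1"] M]
    by (simp add: cleared_def[abs_def] ac_simps power_one_over prod_dividef)
qed

lemma cleared_eq:
  assumes "finite I" "s \<noteq> 0" "x \<noteq> 0" "x\<^sup>2 \<noteq> 1"
    and A: "\<And>j. j \<in> I \<Longrightarrow> A j \<noteq> 0 \<and> x \<noteq> A j \<and> x * A j \<noteq> 1"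
  shows "x ^ card J * ((x\<^sup>2 - 1) * (\<Prod>j\<in>I. (x - A j) * (x - inverse (A j))))
       * (weight s \<beta> \<delta> J C x * (\<Prod>j\<in>I. hfac (s\<^sup>2) (x * A j))
         + weight s \<beta> \<delta> J C (inverse x) * (\<Prod>j\<in>I. hfac (s\<^sup>2) (inverse x * A j)))
     = cleared s \<beta> \<delta> I J C A x"
proof -
  let ?V = "\<Prod>j\<in>I. (x - A j) * (x - inverse (A j))"
  have P: "?V * (\<Prod>j\<in>I. hfac (s\<^sup>2) (x * A j)) = (\<Prod>j\<in>I. (- A j + 1 * x) * (- inverse (A j) + (1 / s\<^sup>2) * x))"
    unfolding prod.distrib[symmetric]
  proof (intro prod.cong refl)
    fix j assume "j \<in> I"
    from A[OF this] have "A j \<noteq> 0" "1 - x * A j \<noteq> 0" by auto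
    then have "(x - inverse (A j)) * hfac (s\<^sup>2) (x * A j) = - inverse (A j) + (1 / s\<^sup>2) * x"
      using assms(2) unfolding hfac_def by (simp add: field_simps)
    then show "(x - A j) * (x - inverse (A j)) * hfac (s\<^sup>2) (x * A j)
        = (- A j + 1 * x) * (- inverse (A j) + (1 / s\<^sup>2) * x)"
      by (simp add: mult.assoc)
  qed
  have M: "?V * (\<Prod>j\<in>I. hfac (s\<^sup>2) (inverse x * A j)) = (\<Prod>j\<in>I. (- (A j / s\<^sup>2) + 1 * x) * (- inverse (A j) + 1 * x))"
    unfolding prod.distrib[symmetric]
  proof (intro prod.cong refl)
    fix j assume "j \<in> I"
    from A[OF this] have "A j \<noteq> 0" "1 - inverse x * A j \<noteq> 0" using assms(3) by (auto simp: field_simps)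
    then have "(x - A j) * hfac (s\<^sup>2) (inverse x * A j) = - (A j / s\<^sup>2) + 1 * x"
      using assms(2,3) unfolding hfac_def by (simp add: field_simps)
    then show "(x - A j) * (x - inverse (A j)) * hfac (s\<^sup>2) (inverse x * A j)
        = (- (A j / s\<^sup>2) + 1 * x) * (- inverse (A j) + 1 * x)"
      by (simp add: mult.assoc mult.left_commute mult.commute)
  qed
  have nz: "x\<^sup>2 - 1 \<noteq> 0" "1 - x\<^sup>2 \<noteq> 0" using assms by auto
  have wP: "x ^ card J * (x\<^sup>2 - 1) * weight s \<beta> \<delta> J C x
     = - 1 * ((1 - \<beta> * x) * (1 - \<delta> * x) * (\<Prod>k\<in>J. (1 - s * C k * x) * (1 - s / C k * x)))"
  proof -
    have "y * (x\<^sup>2 - 1) * (w / ((1 - x\<^sup>2) * y)) = - 1 * w" if "y \<noteq> 0" for y w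
      using nz that by (simp add: field_simps)
    then show ?thesis unfolding weight_eq using assms(3) by simp
  qed
  have wM: "x ^ card J * (x\<^sup>2 - 1) * weight s \<beta> \<delta> J C (inverse x)
     = (x - \<beta>) * (x - \<delta>) * (\<Prod>k\<in>J. (x - s * C k) * (x - s / C k))"
    unfolding weight_inverse[OF assms(3,4)] using nz assms(3) by (simp add: divide_simps)
  have "x ^ card J * ((x\<^sup>2 - 1) * ?V)
       * (weight s \<beta> \<delta> J C x * (\<Prod>j\<in>I. hfac (s\<^sup>2) (x * A j))
         + weight s \<beta> \<delta> J C (inverse x) * (\<Prod>j\<in>I. hfac (s\<^sup>2) (inverse x * A j)))
    = (x ^ card J * (x\<^sup>2 - 1) * weight s \<beta> \<delta> J C x) * (?V * (\<Prod>j\<in>I. hfac (s\<^sup>2) (x * A j)))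
      + (x ^ card J * (x\<^sup>2 - 1) * weight s \<beta> \<delta> J C (inverse x)) * (?V * (\<Prod>j\<in>I. hfac (s\<^sup>2) (inverse x * A j)))"
    by (simp add: algebra_simps)
  then show ?thesis
    unfolding P M wP wM cleared_def by simp
qed

text \<open>At a fixed point of inversion the two contributions have equal numerators, and their
  signs differ because one of them carries \<open>1 - x\<^sup>2\<close> and the other
  \<open>x\<^sup>2 - 1\<close>.\<close>

lemma cleared_pm1:
  assumes "s \<noteq> 0" "x = 1 \<or> x = - 1" "\<And>j. j \<in> I \<Longrightarrow> A j \<noteq> 0"
  shows "cleared s \<beta> \<delta> I J C A x = 0"
proof -
  have "(\<Prod>j\<in>I. (- A j + 1 * x) * (- inverse (A j) + (1 / s\<^sup>2) * x))
      = (\<Prod>j\<in>I. (- (A j / s\<^sup>2) + 1 * x) * (- inverse (A j) + 1 * x))"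
    using assms by (intro prod.cong) (auto simp: field_simps)
  moreover have "(1 + (- \<beta>) * x) * (1 + (- \<delta>) * x) = (- \<beta> + 1 * x) * (- \<delta> + 1 * x)"
    using assms(2) by (auto simp: algebra_simps)
  moreover have "(\<Prod>k\<in>J. (1 + (- (s * C k)) * x) * (1 + (- (s / C k)) * x))
      = (\<Prod>k\<in>J. (- (s * C k) + 1 * x) * (- (s / C k) + 1 * x))"
    using assms(2) by (intro prod.cong) (auto simp: algebra_simps)
  ultimately show ?thesis unfolding cleared_def by simp
qed

text \<open>At \<open>x = A j\<close> two of the four sign choices for the pair of coinciding variables vanish and the
  other two cancel.\<close>

lemma cleared_pair:
  assumes "finite I" "j \<notin> I" "s \<noteq> 0" "x \<noteq> 0" "x\<^sup>2 \<noteq> 1"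
    and A: "\<And>i. i \<in> I \<Longrightarrow> A i \<noteq> 0 \<and> x \<noteq> A i \<and> x * A i \<noteq> 1"
  shows "summand s \<beta> \<delta> (insert j I) J C (A(j := x)) * cleared s \<beta> \<delta> (insert j I) J C (A(j := x)) x
    + summand s \<beta> \<delta> (insert j I) J C (A(j := inverse x)) * cleared s \<beta> \<delta> (insert j I) J C (A(j := inverse x)) x = 0"
proof -
  \<comment> \<open>With \<open>A j = x\<close> the first product of \<open>cleared\<close> contains
    \<open>x - x\<close>; with \<open>A j = inverse x\<close> in \<open>c2\<close> it is the second
    product that vanishes. One contribution is left in each case.\<close>
  have c1: "cleared s \<beta> \<delta> (insert j I) J C (A(j := x)) x
     = (x - \<beta>) * (x - \<delta>) * (\<Prod>k\<in>J. (x - s * C k) * (x - s / C k))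
        * ((x - x / s\<^sup>2) * (x - inverse x) * (\<Prod>j\<in>I. (x - A j / s\<^sup>2) * (x - inverse (A j))))"
  proof -
    have "(\<Prod>i\<in>I. (x - (if i = j then x else A i) / s\<^sup>2) * (x - inverse (if i = j then x else A i)))
      = (\<Prod>j\<in>I. (x - A j / s\<^sup>2) * (x - inverse (A j)))"
      using assms(2) by (intro prod.cong) auto
    then show ?thesis using assms(1,2) by (simp add: cleared_def)
  qed
  have c2: "cleared s \<beta> \<delta> (insert j I) J C (A(j := inverse x)) x
     = - ((1 - \<beta> * x) * (1 - \<delta> * x) * (\<Prod>k\<in>J. (1 - s * C k * x) * (1 - s / C k * x))
        * ((x - inverse x) * (x / s\<^sup>2 - x) * (\<Prod>j\<in>I. (x - A j) * (x / s\<^sup>2 - inverse (A j)))))"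
  proof -
    have "(\<Prod>i\<in>I. (x - (if i = j then inverse x else A i)) * (x / s\<^sup>2 - inverse (if i = j then inverse x else A i)))
      = (\<Prod>j\<in>I. (x - A j) * (x / s\<^sup>2 - inverse (A j)))"
      using assms(2) by (intro prod.cong) auto
    then show ?thesis using assms(1,2) by (simp add: cleared_def)
  qed
  have h: "(\<Prod>j\<in>I. (x - A j / s\<^sup>2) * (x - inverse (A j))) * (\<Prod>j\<in>I. hfac (s\<^sup>2) (x * A j))
    = (\<Prod>j\<in>I. (x - A j) * (x / s\<^sup>2 - inverse (A j))) * (\<Prod>j\<in>I. hfac (s\<^sup>2) (inverse x * A j))"
    unfolding prod.distrib[symmetric]
  proof (intro prod.cong refl)
    fix i assume "i \<in> I"
    from A[OF this] have n: "A i \<noteq> 0" "1 - x * A i \<noteq> 0" "1 - inverse x * A i \<noteq> 0" "x - A i \<noteq> 0"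
      using assms(4) by (auto simp: field_simps)
    have "(x - inverse (A i)) * hfac (s\<^sup>2) (x * A i) = x / s\<^sup>2 - inverse (A i)"
      using n assms(3) unfolding hfac_def by (simp add: field_simps)
    moreover have "(x - A i) * hfac (s\<^sup>2) (inverse x * A i) = x - A i / s\<^sup>2"
      using n assms(3,4) unfolding hfac_def by (simp add: field_simps)
    ultimately show "(x - A i / s\<^sup>2) * (x - inverse (A i)) * hfac (s\<^sup>2) (x * A i)
       = (x - A i) * (x / s\<^sup>2 - inverse (A i)) * hfac (s\<^sup>2) (inverse x * A i)"
      by (metis mult.assoc mult.commute)
  qed
  have nz: "x\<^sup>2 - 1 \<noteq> 0" "1 - x\<^sup>2 \<noteq> 0" using assms by auto
  define G where "G = (1 - \<beta> * x) * (1 - \<delta> * x) * (\<Prod>k\<in>J. (1 - s * C k * x) * (1 - s / C k * x))"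
  define G' where "G' = (x - \<beta>) * (x - \<delta>) * (\<Prod>k\<in>J. (x - s * C k) * (x - s / C k))"
  have w: "weight s \<beta> \<delta> J C x = G / ((1 - x\<^sup>2) * x ^ card J)"
    "weight s \<beta> \<delta> J C (inverse x) = G' / ((x\<^sup>2 - 1) * x ^ card J)"
    unfolding G_def G'_def weight_eq[of s \<beta> \<delta> J C x] weight_inverse[OF assms(4,5)] by simp_all
  \<comment> \<open>Both sides are \<open>G * G'\<close> times the same factor: the sign between
    \<open>1 - x\<^sup>2\<close> and \<open>x\<^sup>2 - 1\<close> is matched by the one between
    \<open>x - x / s\<^sup>2\<close> and \<open>x / s\<^sup>2 - x\<close>.\<close>
  have "weight s \<beta> \<delta> J C x * (G' * (x - x / s\<^sup>2)) = weight s \<beta> \<delta> J C (inverse x) * (G * (x / s\<^sup>2 - x))"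
    unfolding w using nz assms(3,4) by (simp add: divide_simps) (simp add: algebra_simps)
  moreover have "w * p * S * (g * (u * v * a)) + w' * p' * S * (- (g' * (v * u' * a'))) = 0"
    if "w * (g * u) = w' * (g' * u')" "a * p = a' * p'" for w p S g u v a w' p' g' u' a' :: complex
  proof -
    have "w * p * S * (g * (u * v * a)) = (w * (g * u)) * (a * p) * (v * S)"
      by (simp add: ac_simps)
    also have "\<dots> = w' * p' * S * (g' * (v * u' * a'))"
      unfolding that by (simp add: ac_simps)
    finally show ?thesis by simp
  qed
  ultimately show ?thesis
    unfolding summand_fun_upd[OF assms(1,2)] c1 c2 G_def[symmetric] G'_def[symmetric]
    using h by blast
qed

section \<open>Cancellation of the apparent poles\<close>

lemma generic_pointsD:
  assumes "generic_points I a" "i \<in> I"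
  shows "a i \<noteq> 0" "(a i)\<^sup>2 \<noteq> 1" "j \<in> I \<Longrightarrow> i \<noteq> j \<Longrightarrow> a i \<noteq> a j" "j \<in> I \<Longrightarrow> i \<noteq> j \<Longrightarrow> a i * a j \<noteq> 1"
  using assms by (auto simp: generic_points_def)

lemma generic_points_subset: "generic_points I a \<Longrightarrow> I' \<subseteq> I \<Longrightarrow> generic_points I' a"
  unfolding generic_points_def by blast

text \<open>The pole at 0 is left out; it comes from the kernel factors and is removed by the power
  \<open>x ^ card J\<close>.\<close>

definition pole_set :: "'a set \<Rightarrow> ('a \<Rightarrow> complex) \<Rightarrow> complex set" where
  "pole_set I a = {1, - 1} \<union> (a ` I \<union> (\<lambda>i. inverse (a i)) ` I)"

lemma generic_points_reciprocals:
  assumes "finite I" "generic_points I a"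
  shows "card (a ` I \<union> (\<lambda>i. inverse (a i)) ` I) = 2 * card I"
    and "(\<Prod>z\<in>a ` I \<union> (\<lambda>i. inverse (a i)) ` I. x - z) = (\<Prod>j\<in>I. (x - a j) * (x - inverse (a j)))"
proof -
  have i1: "inj_on a I" and i2: "inj_on (\<lambda>i. inverse (a i)) I"
    using assms(2) by (auto simp: inj_on_def generic_points_def)
  have d: "a ` I \<inter> (\<lambda>i. inverse (a i)) ` I = {}"
  proof -
    have "a i \<noteq> inverse (a j)" if "i \<in> I" "j \<in> I" for i j
      using assms(2) that unfolding generic_points_def
      by (cases "i = j") (force simp: field_simps power2_eq_square)+
    then show ?thesis by auto
  qed
  show "card (a ` I \<union> (\<lambda>i. inverse (a i)) ` I) = 2 * card I"
    using assms(1) i1 i2 d by (simp add: card_Un_disjoint card_image)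
  show "(\<Prod>z\<in>a ` I \<union> (\<lambda>i. inverse (a i)) ` I. x - z) = (\<Prod>j\<in>I. (x - a j) * (x - inverse (a j)))"
    using assms(1) i1 i2 d by (simp add: prod.union_disjoint prod.reindex prod.distrib)
qed

lemma pole_set:
  assumes "finite I" "generic_points I a"
  shows "finite (pole_set I a)" "card (pole_set I a) = 2 + 2 * card I"
    and "(\<Prod>z\<in>pole_set I a. x - z) = (x\<^sup>2 - 1) * (\<Prod>j\<in>I. (x - a j) * (x - inverse (a j)))"
proof -
  have d: "{1, - 1} \<inter> (a ` I \<union> (\<lambda>i. inverse (a i)) ` I) = {}"
    using generic_pointsD(1,2)[OF assms(2)] by (auto simp: power2_eq_1_iff) (metis inverse_1 inverse_inverse_eq inverse_minus_eq)+
  show "finite (pole_set I a)" using assms(1) by (simp add: pole_set_def)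
  show "card (pole_set I a) = 2 + 2 * card I"
    unfolding pole_set_def using assms(1) d
    by (subst card_Un_disjoint) (simp_all add: generic_points_reciprocals[OF assms])
  have "(x - 1) * (x - (- 1)) = x\<^sup>2 - 1"
    by (simp add: algebra_simps power2_eq_square)
  then show "(\<Prod>z\<in>pole_set I a. x - z) = (x\<^sup>2 - 1) * (\<Prod>j\<in>I. (x - a j) * (x - inverse (a j)))"
    unfolding pole_set_def using assms(1) d
    by (subst prod.union_disjoint) (simp_all add: generic_points_reciprocals[OF assms])
qed

lemma flip_factor: "(x - flip a S j) * (x - inverse (flip a S j)) = (x - a j) * (x - inverse (a j))"
  by (simp add: flip_def mult.commute)

text \<open>The cleared sum has degree at most \<open>2 + 2 * card I + 2 * card J\<close> and
  vanishes at all \<open>2 + 2 * card I\<close> apparent poles, which leaves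
  \<open>2 * card J\<close>. Since the coefficient in \<open>polyfun_cleared\<close> is the same for
  every sign choice, the leading coefficient is a multiple of the sum over \<open>I\<close>: this is
  the limit at infinity.\<close>

lemma signsum_polyfun:
  assumes fin: "finite I" "finite J" and i: "i \<notin> I" and s: "s \<noteq> 0"
    and C: "\<And>k. k \<in> J \<Longrightarrow> C k \<noteq> 0" and a: "generic_points I a"
  obtains g where "polyfun g (2 * card J) ((1 - \<beta> * \<delta> * s\<^sup>2 ^ card J / s\<^sup>2 ^ card I) * signsum s \<beta> \<delta> I a J C)"
    and "\<And>x. x \<noteq> 0 \<Longrightarrow> x \<notin> pole_set I a \<Longrightarrow> g x = x ^ card J * signsum s \<beta> \<delta> (insert i I) (a(i := x)) J C"
proof -
  let ?F = "\<lambda>x A. summand s \<beta> \<delta> I J C A * cleared s \<beta> \<delta> I J C A x"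
  define T where "T = (\<lambda>x. \<Sum>S\<in>Pow I. ?F x (flip a S))"
  let ?c = "1 - \<beta> * \<delta> * s\<^sup>2 ^ card J / s\<^sup>2 ^ card I"
  have "polyfun T (2 + 2 * card I + 2 * card J) (\<Sum>S\<in>Pow I. summand s \<beta> \<delta> I J C (flip a S) * ?c)"
    unfolding T_def using fin s C by (intro polyfun_sum polyfun_cmult polyfun_cleared) auto
  then have T: "polyfun T (card (pole_set I a) + 2 * card J) (?c * signsum s \<beta> \<delta> I a J C)"
    unfolding signsum_def by (simp add: pole_set[OF fin(1) a] sum_distrib_right mult.commute)
  have flip0: "flip a S j \<noteq> 0" if "j \<in> I" for S j
    using generic_pointsD(1)[OF a that] by (simp add: flip_def)
  have "T x = 0" if "x \<in> pole_set I a" for x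
  proof -
    consider "x = 1 \<or> x = - 1" | j where "j \<in> I" "x = a j \<or> x = inverse (a j)"
      using \<open>x \<in> pole_set I a\<close> unfolding pole_set_def by auto
    then show ?thesis
    proof cases
      case 1
      then show ?thesis unfolding T_def using s flip0 by (simp add: cleared_pm1)
    next
      case (2 j)
      define I' where "I' = I - {j}"
      have I': "I = insert j I'" "finite I'" "j \<notin> I'" using 2(1) fin(1) unfolding I'_def by auto
      have pair: "?F x (A(j := x)) + ?F x (A(j := inverse x)) = 0"
        if A: "A = flip a S" for A S
      proof -
        have x: "x \<noteq> 0" "x\<^sup>2 \<noteq> 1"
          using 2 generic_pointsD(1,2)[OF a 2(1)] by (auto simp: power_inverse)
        have "A i \<noteq> 0 \<and> x \<noteq> A i \<and> x * A i \<noteq> 1" if "i \<in> I'" for i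
        proof -
          have ij: "i \<in> I" "j \<noteq> i" using that unfolding I'_def by auto
          have "a i \<noteq> 0" "a j \<noteq> 0" "a j \<noteq> a i" "a j * a i \<noteq> 1"
            using generic_pointsD[OF a 2(1)] generic_pointsD(1)[OF a] ij by auto
          moreover have "x * a j \<noteq> 1 \<or> x * a i \<noteq> 1"
            using x(1) \<open>a j \<noteq> a i\<close> by (metis mult_left_cancel)
          ultimately show ?thesis
            unfolding A using 2(2) by (auto simp: flip_def field_simps)
        qed
        then show ?thesis
          unfolding I'(1) by (intro cleared_pair I' s x) auto
      qed
      \<comment> \<open>The sign choices are grouped into pairs that differ only at
        \<open>j\<close>, the index responsible for the pole \<open>x\<close>.\<close>
      have "T x = (\<Sum>S\<in>Pow I'. ?F x ((flip a S)(j := a j)) + ?F x ((flip a S)(j := inverse (a j))))"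
        unfolding T_def I'(1) by (rule sum_flip_insert[OF I'(2,3)])
      also have "\<dots> = 0"
        using pair 2(2) by (intro sum.neutral) (metis add.commute inverse_inverse_eq)
      finally show ?thesis .
    qed
  qed
  from polyfun_divide_roots[OF T pole_set(1)[OF fin(1) a] this]
  obtain g where g: "polyfun g (2 * card J) (?c * signsum s \<beta> \<delta> I a J C)"
    "\<And>x. T x = (\<Prod>z\<in>pole_set I a. x - z) * g x" by blast
  have "g x = x ^ card J * signsum s \<beta> \<delta> (insert i I) (a(i := x)) J C"
    if x: "x \<noteq> 0" "x \<notin> pole_set I a" for x
  proof -
    let ?V = "(x\<^sup>2 - 1) * (\<Prod>j\<in>I. (x - a j) * (x - inverse (a j)))"
    have V: "?V \<noteq> 0"
      using x(2) pole_set(1)[OF fin(1) a] by (simp flip: pole_set(3)[OF fin(1) a])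
    have x2: "x\<^sup>2 \<noteq> 1" using V by auto
    have "T x = (\<Sum>S\<in>Pow I. summand s \<beta> \<delta> I J C (flip a S) * (x ^ card J * ?V *
        (weight s \<beta> \<delta> J C x * (\<Prod>j\<in>I. hfac (s\<^sup>2) (x * flip a S j))
         + weight s \<beta> \<delta> J C (inverse x) * (\<Prod>j\<in>I. hfac (s\<^sup>2) (inverse x * flip a S j)))))"
      unfolding T_def
    proof (intro sum.cong refl arg_cong2[where f = times])
      fix S assume "S \<in> Pow I"
      have "flip a S j \<noteq> 0 \<and> x \<noteq> flip a S j \<and> x * flip a S j \<noteq> 1" if "j \<in> I" for j
      proof -
        have "x \<noteq> a j" "x \<noteq> inverse (a j)" "a j \<noteq> 0"
          using x that generic_pointsD(1)[OF a that] unfolding pole_set_def by auto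
        then show ?thesis using x(1) by (auto simp: flip_def field_simps)
      qed
      from cleared_eq[where A = "flip a S" and J = J and C = C and \<beta> = \<beta> and \<delta> = \<delta>, OF fin(1) s x(1) x2 this]
      show "cleared s \<beta> \<delta> I J C (flip a S) x = x ^ card J * ?V *
        (weight s \<beta> \<delta> J C x * (\<Prod>j\<in>I. hfac (s\<^sup>2) (x * flip a S j))
         + weight s \<beta> \<delta> J C (inverse x) * (\<Prod>j\<in>I. hfac (s\<^sup>2) (inverse x * flip a S j)))"
        unfolding flip_factor by simp
    qed
    also have "\<dots> = ?V * (x ^ card J * signsum s \<beta> \<delta> (insert i I) (a(i := x)) J C)"
      unfolding signsum_insert[OF fin(1) i] sum_distrib_left by (intro sum.cong) (simp_all add: ac_simps)
    finally show ?thesis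
      using V unfolding g(2) pole_set(3)[OF fin(1) a] by simp
  qed
  with g(1) that show ?thesis by blast
qed

text \<open>In the dual sum \<open>x\<close> occurs only in kernel factors, and \<open>x\<close>
  times such a factor is a quadratic polynomial. Its leading coefficient is \<open>- s\<close> for
  either sign of \<open>C k\<close>, so the power \<open>(- s) ^ card J\<close> comes out of the
  sum.\<close>

lemma signsum_dual_polyfun:
  assumes "finite I" "finite J" "i \<notin> I" "s \<noteq> 0" and C: "\<And>k. k \<in> J \<Longrightarrow> C k \<noteq> 0"
  obtains g where "polyfun g (2 * card J) ((- s) ^ card J * signsum s \<beta> \<delta> J C I a)"
    and "\<And>x. x \<noteq> 0 \<Longrightarrow> g x = x ^ card J * signsum s \<beta> \<delta> J C (insert i I) (a(i := x))"
proof -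
  let ?p = "\<lambda>B k x. (1 + (- (s * B k)) * x) * (- s + inverse (B k) * x)"
  let ?g = "\<lambda>x. \<Sum>S\<in>Pow J. summand s \<beta> \<delta> J I a (flip C S) * (\<Prod>k\<in>J. ?p (flip C S) k x)"
  have flip0: "flip C S k \<noteq> 0" if "k \<in> J" for S k
    using C[OF that] by (simp add: flip_def)
  have "polyfun ?g (2 * card J) (\<Sum>S\<in>Pow J. summand s \<beta> \<delta> J I a (flip C S) *
      (\<Prod>k\<in>J. (- (s * flip C S k)) * inverse (flip C S k)))"
    using assms(2) by (intro polyfun_sum polyfun_cmult polyfun_prod polyfun_quadratic) auto
  moreover have "(\<Prod>k\<in>J. (- (s * flip C S k)) * inverse (flip C S k)) = (- s) ^ card J" for S
    using flip0[of _ S] by (simp add: mult.assoc)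
  ultimately have "polyfun ?g (2 * card J) ((- s) ^ card J * signsum s \<beta> \<delta> J C I a)"
    unfolding signsum_def by (simp add: sum_distrib_left mult.commute)
  moreover have "?g x = x ^ card J * signsum s \<beta> \<delta> J C (insert i I) (a(i := x))" if "x \<noteq> 0" for x
  proof -
    have w: "weight s \<beta> \<delta> (insert i I) (a(i := x)) y
       = (1 - s * x * y) * (1 - s * y / x) / y * weight s \<beta> \<delta> I a y" for y
    proof -
      have "(\<Prod>k\<in>I. (1 - s * (a(i := x)) k * y) * (1 - s * y / (a(i := x)) k) / y)
        = (\<Prod>k\<in>I. (1 - s * a k * y) * (1 - s * y / a k) / y)"
        using assms(3) by (intro prod.cong) auto
      then show ?thesis unfolding weight_def using assms(1,3) by (simp add: mult_ac)
    qed
    have "summand s \<beta> \<delta> J I a (flip C S) * (\<Prod>k\<in>J. ?p (flip C S) k x)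
      = x ^ card J * summand s \<beta> \<delta> J (insert i I) (a(i := x)) (flip C S)" for S
    proof -
      have "?p (flip C S) k x = x * ((1 - s * x * flip C S k) * (1 - s * flip C S k / x) / flip C S k)"
        if "k \<in> J" for k
        using flip0[OF that, of S] \<open>x \<noteq> 0\<close> by (simp add: field_simps)
      then have "(\<Prod>k\<in>J. ?p (flip C S) k x)
        = (\<Prod>k\<in>J. x * ((1 - s * x * flip C S k) * (1 - s * flip C S k / x) / flip C S k))"
        by (intro prod.cong) auto
      then have P: "(\<Prod>k\<in>J. ?p (flip C S) k x)
        = x ^ card J * (\<Prod>k\<in>J. (1 - s * x * flip C S k) * (1 - s * flip C S k / x) / flip C S k)"
        by (simp only: prod.distrib prod_constant)
      have "summand s \<beta> \<delta> J (insert i I) (a(i := x)) (flip C S)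
        = (\<Prod>k\<in>J. (1 - s * x * flip C S k) * (1 - s * flip C S k / x) / flip C S k)
          * summand s \<beta> \<delta> J I a (flip C S)"
        unfolding summand_def w by (simp only: prod.distrib mult.assoc)
      then show ?thesis unfolding P by (simp only: mult_ac)
    qed
    then show ?thesis unfolding signsum_def by (simp add: sum_distrib_left)
  qed
  ultimately show ?thesis using that by blast
qed

text \<open>The shifted factorial to the base \<open>1 / q\<close>, in which the leading
  coefficients accumulate.\<close>

definition descpoch :: "complex \<Rightarrow> complex \<Rightarrow> nat \<Rightarrow> complex" where
  "descpoch q x N = (\<Prod>i<N. 1 - x / q ^ i)"

lemma descpoch_0 [simp]: "descpoch q x 0 = 1"
  by (simp add: descpoch_def)

lemma descpoch_Suc: "descpoch q x (Suc N) = (1 - x / q ^ N) * descpoch q x N"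
  by (simp add: descpoch_def)

lemma descpoch_shift:
  assumes "q \<noteq> 0"
  shows "descpoch q (x * q) (Suc N) = (1 - x * q) * descpoch q x N"
  unfolding descpoch_def prod.lessThan_Suc_shift using assms by simp

lemma signsum_empty [simp]: "signsum s \<beta> \<delta> {} a J C = 1"
  by (simp add: signsum_def summand_def)

lemma generic_points_insertD:
  assumes "generic_points (insert i I) a" "i \<notin> I"
  shows "a i \<noteq> 0" "a i \<notin> pole_set I a"
proof -
  show "a i \<noteq> 0" using assms by (simp add: generic_points_def)
  have "(a i)\<^sup>2 \<noteq> 1" "\<And>j. j \<in> I \<Longrightarrow> a i \<noteq> a j \<and> a i * a j \<noteq> 1 \<and> a j \<noteq> 0"
    using assms by (auto simp: generic_points_def)
  moreover from this have "a i \<noteq> inverse (a j)" if "j \<in> I" for j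
    using that by (metis left_inverse)
  ultimately show "a i \<notin> pole_set I a"
    by (auto simp: pole_set_def)
qed

text \<open>Without kernel factors the degree bound \<open>2 * card J\<close> is 0, so the sum does
  not depend on the added variable and equals its value at infinity. This evaluates the dual sum in
  the initial case of the duality.\<close>

lemma signsum_no_kernel:
  assumes "finite I" "s \<noteq> 0" "generic_points I a"
  shows "signsum s \<beta> \<delta> I a ({} :: 'b set) C = descpoch (s\<^sup>2) (\<beta> * \<delta>) (card I)"
  using assms(1,3)
proof (induction I rule: finite_induct)
  case (insert i I)
  have a: "generic_points I a" using insert.prems generic_points_subset by blast
  obtain g where g: "polyfun g 0 ((1 - \<beta> * \<delta> / s\<^sup>2 ^ card I) * signsum s \<beta> \<delta> I a ({} :: 'b set) C)"
    "\<And>x. x \<noteq> 0 \<Longrightarrow> x \<notin> pole_set I a \<Longrightarrow> g x = signsum s \<beta> \<delta> (insert i I) (a(i := x)) ({} :: 'b set) C"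
    using signsum_polyfun[where J = "{} :: 'b set" and C = C and \<beta> = \<beta> and \<delta> = \<delta>,
        OF insert.hyps(1) _ insert.hyps(2) assms(2) _ a] by auto
  have "g (a i) = (1 - \<beta> * \<delta> / s\<^sup>2 ^ card I) * signsum s \<beta> \<delta> I a ({} :: 'b set) C"
    by (rule polyfun_eq[OF g(1) polyfun_const, of "{}"]) auto
  then show ?case
    using g(2)[of "a i"] generic_points_insertD[OF insert.prems insert.hyps(2)] insert a
    by (simp add: descpoch_Suc)
qed simp

section \<open>Reduction at the nodes\<close>

lemma weight_insert:
  assumes "finite J" "k \<notin> J"
  shows "weight s \<beta> \<delta> (insert k J) C x = (1 - s * C k * x) * (1 - s * x / C k) / x * weight s \<beta> \<delta> J C x"
  using assms by (simp add: weight_def mult_ac)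

lemma prod_flip_invariant:
  assumes "\<And>i. i \<in> I \<Longrightarrow> f (inverse (a i)) = f (a i)"
  shows "(\<Prod>i\<in>I. f (flip a S i)) = (\<Prod>i\<in>I. f (a i))"
  using assms by (intro prod.cong) (auto simp: flip_def)

text \<open>At \<open>x = s * C k\<close> the choice \<open>inverse x\<close> is killed by the kernel factor of \<open>k\<close>; for the choice \<open>x\<close> the
  kernel factors of \<open>k\<close> combine with the pair factors into an expression invariant under inversion,
  so one variable disappears from either side.\<close>

lemma signsum_at_node:
  assumes "finite I" "i \<notin> I" "finite J" "k \<notin> J" "s \<noteq> 0" "C k \<noteq> 0"
    and a: "\<And>j. j \<in> I \<Longrightarrow> a j \<noteq> 0 \<and> s * C k \<noteq> a j \<and> s * C k * a j \<noteq> 1"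
  shows "signsum s \<beta> \<delta> (insert i I) (a(i := s * C k)) (insert k J) C
    = weight s \<beta> \<delta> (insert k J) C (s * C k)
      * (\<Prod>j\<in>I. (1 - C k * a j / s) * (1 - s * a j / C k) / a j) * signsum s \<beta> \<delta> I a J C"
proof -
  let ?x = "s * C k"
  let ?D = "\<lambda>y. (1 - C k * y / s) * (1 - s * y / C k) / y"
  have w0: "weight s \<beta> \<delta> (insert k J) C (inverse ?x) = 0"
    using assms by (simp add: weight_insert del: inverse_mult_distrib)
  have D: "(\<Prod>j\<in>I. ?D (flip a S j)) = (\<Prod>j\<in>I. ?D (a j))" for S
  proof (rule prod_flip_invariant)
    fix j assume "j \<in> I"
    with a assms(5,6) show "?D (inverse (a j)) = ?D (a j)" by (simp add: field_simps)
  qed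
  have "summand s \<beta> \<delta> I (insert k J) C (flip a S) * (\<Prod>j\<in>I. hfac (s\<^sup>2) (?x * flip a S j))
      = (\<Prod>j\<in>I. ?D (a j)) * summand s \<beta> \<delta> I J C (flip a S)" for S
  proof -
    have "(1 - s * C k * y) * (1 - s * y / C k) / y * hfac (s\<^sup>2) (?x * y) = ?D y"
      if "y = flip a S j" "j \<in> I" for y j
    proof -
      have "1 - ?x * y \<noteq> 0"
        using a[OF that(2)] unfolding that(1) by (auto simp: flip_def field_simps)
      moreover have "?x * y / s\<^sup>2 = C k * y / s"
        using assms(5) by (simp add: power2_eq_square)
      ultimately show ?thesis
        unfolding hfac_def by simp
    qed
    then have "(\<Prod>j\<in>I. (1 - s * C k * flip a S j) * (1 - s * flip a S j / C k) / flip a S j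
        * hfac (s\<^sup>2) (?x * flip a S j)) = (\<Prod>j\<in>I. ?D (flip a S j))"
      by (intro prod.cong) auto
    then have "(\<Prod>j\<in>I. (1 - s * C k * flip a S j) * (1 - s * flip a S j / C k) / flip a S j)
        * (\<Prod>j\<in>I. hfac (s\<^sup>2) (?x * flip a S j)) = (\<Prod>j\<in>I. ?D (a j))"
      by (simp only: D prod.distrib)
    moreover have "summand s \<beta> \<delta> I (insert k J) C (flip a S)
      = (\<Prod>j\<in>I. (1 - s * C k * flip a S j) * (1 - s * flip a S j / C k) / flip a S j)
        * summand s \<beta> \<delta> I J C (flip a S)"
      unfolding summand_def weight_insert[OF assms(3,4)] prod.distrib by (simp only: mult.assoc)
    moreover have "u * h = d * v" if "p * h = d" "u = p * v" for u h d v p :: complex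
      using that by auto
    ultimately show ?thesis by blast
  qed
  note summand_eq = this
  have "signsum s \<beta> \<delta> (insert i I) (a(i := ?x)) (insert k J) C
    = (\<Sum>S\<in>Pow I. weight s \<beta> \<delta> (insert k J) C ?x *
      (summand s \<beta> \<delta> I (insert k J) C (flip a S) * (\<Prod>j\<in>I. hfac (s\<^sup>2) (?x * flip a S j))))"
    unfolding signsum_insert[OF assms(1,2)] w0 mult_zero_left add_0_right
      mult.left_commute[of "summand _ _ _ _ _ _ _"] by (rule refl)
  then show ?thesis
    unfolding summand_eq signsum_def[of _ _ _ I] by (simp only: sum_distrib_left mult.assoc)
qed

text \<open>Here the choice \<open>C k\<close> is killed, by the kernel factor of the new variable
  \<open>s * C k\<close>. For the surviving \<open>inverse (C k)\<close>, the denominator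
  \<open>1 - y / C k\<close> of each pair factor cancels against one of the two factors that the new
  variable brings in.\<close>

lemma signsum_dual_at_node:
  assumes "finite I" "i \<notin> I" "finite J" "k \<notin> J" "s \<noteq> 0" "C k \<noteq> 0" "(C k)\<^sup>2 \<noteq> 1"
    and C: "\<And>l. l \<in> J \<Longrightarrow> C l \<noteq> 0 \<and> C k \<noteq> C l \<and> C k * C l \<noteq> 1"
  shows "signsum s \<beta> \<delta> (insert k J) C (insert i I) (a(i := s * C k))
    = weight s \<beta> \<delta> (insert i I) (a(i := s * C k)) (inverse (C k))
      * (\<Prod>l\<in>J. (1 - C l / (s\<^sup>2 * C k)) * (1 - s\<^sup>2 * C k * C l) / C l) * signsum s \<beta> \<delta> J C I a"
proof -
  let ?a = "a(i := s * C k)"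
  let ?D = "\<lambda>y. (1 - y / (s\<^sup>2 * C k)) * (1 - s\<^sup>2 * C k * y) / y"
  have w: "weight s \<beta> \<delta> (insert i I) ?a y
     = (1 - s * (s * C k) * y) * (1 - s * y / (s * C k)) / y * weight s \<beta> \<delta> I a y" for y
  proof -
    have "weight s \<beta> \<delta> I ?a y = weight s \<beta> \<delta> I a y"
      unfolding weight_def using assms(2) by (intro arg_cong2[where f = times] prod.cong) auto
    then show ?thesis using weight_insert[OF assms(1,2), of s \<beta> \<delta> ?a y] by simp
  qed
  have w0: "weight s \<beta> \<delta> (insert i I) ?a (C k) = 0"
    using assms by (simp add: w)
  have D: "(\<Prod>l\<in>J. ?D (flip C S l)) = (\<Prod>l\<in>J. ?D (C l))" for S
  proof (rule prod_flip_invariant)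
    fix j assume "j \<in> J"
    with C assms(5,6) show "?D (inverse (C j)) = ?D (C j)" by (simp add: field_simps)
  qed
  have summand_eq: "summand s \<beta> \<delta> J (insert i I) ?a (flip C S) * (\<Prod>l\<in>J. hfac (s\<^sup>2) (inverse (C k) * flip C S l))
      = (\<Prod>l\<in>J. ?D (C l)) * summand s \<beta> \<delta> J I a (flip C S)" for S
  proof -
    have "(1 - s * (s * C k) * y) * (1 - s * y / (s * C k)) / y * hfac (s\<^sup>2) (inverse (C k) * y) = ?D y"
      if "y = flip C S l" "l \<in> J" for y l
    proof -
      have "1 - y / C k \<noteq> 0"
        using C[OF that(2)] assms(6) unfolding that(1) by (auto simp: flip_def field_simps)
      moreover have "s * y / (s * C k) = y / C k" "inverse (C k) * y = y / C k"
        "y / C k / s\<^sup>2 = y / (s\<^sup>2 * C k)" "s * (s * C k) = s\<^sup>2 * C k"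
        using assms(5) by (simp_all add: field_simps power2_eq_square)
      moreover have "u * v / y * (w / v) = w * u / y" if "v \<noteq> 0" for u v w :: complex
        using that by simp
      ultimately show ?thesis
        unfolding hfac_def by (simp only: not_False_eq_True)
    qed
    then have "(\<Prod>l\<in>J. (1 - s * (s * C k) * flip C S l) * (1 - s * flip C S l / (s * C k)) / flip C S l
        * hfac (s\<^sup>2) (inverse (C k) * flip C S l)) = (\<Prod>l\<in>J. ?D (flip C S l))"
      by (intro prod.cong) auto
    then have "(\<Prod>l\<in>J. (1 - s * (s * C k) * flip C S l) * (1 - s * flip C S l / (s * C k)) / flip C S l)
        * (\<Prod>l\<in>J. hfac (s\<^sup>2) (inverse (C k) * flip C S l)) = (\<Prod>l\<in>J. ?D (C l))"
      by (simp only: D prod.distrib)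
    moreover have "summand s \<beta> \<delta> J (insert i I) ?a (flip C S)
      = (\<Prod>l\<in>J. (1 - s * (s * C k) * flip C S l) * (1 - s * flip C S l / (s * C k)) / flip C S l)
        * summand s \<beta> \<delta> J I a (flip C S)"
      unfolding summand_def w prod.distrib by (simp only: mult.assoc)
    moreover have "u * h = d * v" if "p * h = d" "u = p * v" for u h d v p :: complex
      using that by auto
    ultimately show ?thesis by blast
  qed
  have "signsum s \<beta> \<delta> (insert k J) C (insert i I) ?a
    = signsum s \<beta> \<delta> (insert k J) (C(k := C k)) (insert i I) ?a" by simp
  also have "\<dots> = (\<Sum>S\<in>Pow J. weight s \<beta> \<delta> (insert i I) ?a (inverse (C k)) *
      (summand s \<beta> \<delta> J (insert i I) ?a (flip C S) * (\<Prod>l\<in>J. hfac (s\<^sup>2) (inverse (C k) * flip C S l))))"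
    unfolding signsum_insert[OF assms(3,4)] w0 mult_zero_left add_0_left
      mult.left_commute[of "summand _ _ _ _ _ _ _"] by (rule refl)
  finally show ?thesis
    unfolding summand_eq signsum_def[of _ _ _ J] by (simp only: sum_distrib_left mult.assoc)
qed

lemma weight_upd_insert:
  assumes "finite I" "i \<notin> I"
  shows "weight s \<beta> \<delta> (insert i I) (a(i := x)) y
     = (1 - s * x * y) * (1 - s * y / x) / y * weight s \<beta> \<delta> I a y"
proof -
  have "weight s \<beta> \<delta> I (a(i := x)) y = weight s \<beta> \<delta> I a y"
    unfolding weight_def using assms(2) by (intro arg_cong2[where f = times] prod.cong) auto
  then show ?thesis using weight_insert[OF assms, of s \<beta> \<delta> "a(i := x)" y] by simp
qed

lemma signsum_dual_inverse:
  assumes "finite I" "i \<notin> I"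
  shows "signsum s \<beta> \<delta> J C (insert i I) (a(i := inverse x)) = signsum s \<beta> \<delta> J C (insert i I) (a(i := x))"
proof -
  have "weight s \<beta> \<delta> (insert i I) (a(i := inverse x)) y = weight s \<beta> \<delta> (insert i I) (a(i := x)) y" for y
    unfolding weight_upd_insert[OF assms] by (simp add: divide_inverse mult_ac)
  then show ?thesis unfolding signsum_def summand_def by simp
qed

text \<open>The factors split off at a node on the two sides are proportional piece by piece:
  \<open>- s\<close> for each \<open>l\<close> in \<open>J\<close>, \<open>- 1 / s\<close> for each
  \<open>j\<close> in \<open>I\<close>, and \<open>s * \<beta> * \<delta>\<close> from the heads.
  The last comparison is what dictates the dual parameters \<open>1 / (s * \<beta>)\<close> and
  \<open>1 / (s * \<delta>)\<close>.\<close>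

lemma node_weights:
  assumes "finite I" "i \<notin> I" "finite J" "k \<notin> J" "s \<noteq> 0" "\<beta> \<noteq> 0" "\<delta> \<noteq> 0" "C k \<noteq> 0" "(C k)\<^sup>2 \<noteq> 1" "(s * C k)\<^sup>2 \<noteq> 1"
    and C: "\<And>l. l \<in> J \<Longrightarrow> C l \<noteq> 0" and a: "\<And>j. j \<in> I \<Longrightarrow> a j \<noteq> 0"
  shows "weight s \<beta> \<delta> (insert k J) C (s * C k) * (\<Prod>j\<in>I. (1 - C k * a j / s) * (1 - s * a j / C k) / a j)
    = s * \<beta> * \<delta> * (- s) ^ card J * (- 1 / s) ^ card I
      * (weight s (1 / (s * \<beta>)) (1 / (s * \<delta>)) (insert i I) (a(i := s * C k)) (inverse (C k))
        * (\<Prod>l\<in>J. (1 - C l / (s\<^sup>2 * C k)) * (1 - s\<^sup>2 * C k * C l) / C l))"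
proof -
  let ?c = "C k"
  let ?v = "s * C k"
  define E where "E = (\<Prod>l\<in>J. (1 - C l / (s\<^sup>2 * ?c)) * (1 - s\<^sup>2 * ?c * C l) / C l)"
  define D where "D = (\<Prod>j\<in>I. (1 - s * a j * inverse ?c) * (1 - s * inverse ?c / a j) / inverse ?c)"
  define B where "B = ?c * (1 - 1 / (s * \<beta>) * inverse ?c) * (1 - 1 / (s * \<delta>) * inverse ?c)"
  have c: "?c \<noteq> 0" "?c\<^sup>2 \<noteq> 1" "?v\<^sup>2 \<noteq> 1" using assms by auto
  have "(\<Prod>l\<in>J. (1 - s * C l * ?v) * (1 - s * ?v / C l) / ?v)
    = (\<Prod>l\<in>J. (- s) * ((1 - C l / (s\<^sup>2 * ?c)) * (1 - s\<^sup>2 * ?c * C l) / C l))"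
  proof (intro prod.cong refl)
    fix l assume "l \<in> J"
    from C[OF this] c(1) \<open>s \<noteq> 0\<close>
    show "(1 - s * C l * ?v) * (1 - s * ?v / C l) / ?v
      = (- s) * ((1 - C l / (s\<^sup>2 * ?c)) * (1 - s\<^sup>2 * ?c * C l) / C l)"
      by (simp add: field_simps power2_eq_square)
  qed
  then have pE: "(\<Prod>l\<in>J. (1 - s * C l * ?v) * (1 - s * ?v / C l) / ?v) = (- s) ^ card J * E"
    unfolding E_def by (simp only: prod.distrib prod_constant)
  have "(\<Prod>j\<in>I. (1 - ?c * a j / s) * (1 - s * a j / ?c) / a j)
    = (\<Prod>j\<in>I. (- 1 / s) * ((1 - s * a j * inverse ?c) * (1 - s * inverse ?c / a j) / inverse ?c))"
  proof (intro prod.cong refl)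
    fix j assume "j \<in> I"
    from a[OF this] c(1) \<open>s \<noteq> 0\<close>
    show "(1 - ?c * a j / s) * (1 - s * a j / ?c) / a j
      = (- 1 / s) * ((1 - s * a j * inverse ?c) * (1 - s * inverse ?c / a j) / inverse ?c)"
      by (simp add: field_simps power2_eq_square)
  qed
  then have pD: "(\<Prod>j\<in>I. (1 - ?c * a j / s) * (1 - s * a j / ?c) / a j) = (- 1 / s) ^ card I * D"
    unfolding D_def by (simp only: prod.distrib prod_constant)
  have "(1 - s * ?c * ?v) * (1 - s * ?v / ?c) / ?v * ((1 - \<beta> * ?v) * (1 - \<delta> * ?v) / (1 - ?v\<^sup>2))
    = (1 - s\<^sup>2) * ((1 - \<beta> * ?v) * (1 - \<delta> * ?v) / ?v)"
    using c \<open>s \<noteq> 0\<close> by (simp add: field_simps power2_eq_square)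
  also have "(1 - \<beta> * ?v) * (1 - \<delta> * ?v) / ?v = s * \<beta> * \<delta> * B"
    unfolding B_def using c(1) assms(5-7) by (simp add: field_simps power2_eq_square)
  finally have w1: "weight s \<beta> \<delta> (insert k J) C ?v = (1 - s\<^sup>2) * (s * \<beta> * \<delta> * B) * ((- s) ^ card J * E)"
    unfolding weight_insert[OF assms(3,4)] weight_def[of s \<beta> \<delta> J] pE by (simp only: mult.assoc[symmetric])
  have "(1 - s * ?v * inverse ?c) * (1 - s * inverse ?c / ?v) / inverse ?c
      * ((1 - 1 / (s * \<beta>) * inverse ?c) * (1 - 1 / (s * \<delta>) * inverse ?c) / (1 - (inverse ?c)\<^sup>2))
    = (1 - s\<^sup>2) * B"
  proof -
    have e: "s * ?v * inverse ?c = s\<^sup>2" "s * inverse ?c / ?v = (inverse ?c)\<^sup>2"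
      using c(1) \<open>s \<noteq> 0\<close> by (simp_all add: field_simps power2_eq_square)
    have n: "1 - (inverse ?c)\<^sup>2 \<noteq> 0" using c(2) by (simp add: power_inverse)
    have "(1 - s\<^sup>2) * u / inverse ?c * (x * y / u) = (1 - s\<^sup>2) * (?c * x * y)" if "u \<noteq> 0" for u x y
      using that c(1) by (simp add: field_simps)
    from this[OF n] show ?thesis unfolding e B_def .
  qed
  then have w2: "weight s (1 / (s * \<beta>)) (1 / (s * \<delta>)) (insert i I) (a(i := ?v)) (inverse ?c) = (1 - s\<^sup>2) * B * D"
    unfolding weight_upd_insert[OF assms(1,2)] weight_def[of s _ _ I] D_def by (simp only: mult.assoc[symmetric])
  show ?thesis
    unfolding w1 w2 pD E_def[symmetric] by (simp only: mult_ac)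
qed

text \<open>The constants are forced: with \<open>I\<close> or \<open>J\<close> empty, one side is
  the value in \<open>signsum_no_kernel\<close> and the other sum is 1, while the power of
  \<open>- s\<close> balances the leading coefficients. Genericity of \<open>s * C k\<close> makes
  the nodes and their inverses \<open>2 * card J\<close> different points; the last hypothesis keeps
  them away from the apparent poles, where the polynomial is not given by the sum.\<close>

theorem signsum_duality:
  fixes a :: "'a::linorder \<Rightarrow> complex" and C :: "'b::linorder \<Rightarrow> complex"
  assumes "finite I" "finite J" and nz: "s \<noteq> 0" "\<beta> \<noteq> 0" "\<delta> \<noteq> 0"
    and "generic_points I a" "generic_points J C" "generic_points J (\<lambda>k. s * C k)"
    and "\<And>i k. i \<in> I \<Longrightarrow> k \<in> J \<Longrightarrow> s * C k \<noteq> a i \<and> s * C k * a i \<noteq> 1"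
  shows "descpoch (s\<^sup>2) (1 / (s\<^sup>2 * \<beta> * \<delta>)) (card J) * (- s) ^ (card J * card I) * signsum s \<beta> \<delta> I a J C
    = descpoch (s\<^sup>2) (\<beta> * \<delta> * s\<^sup>2 ^ card J) (card I) * signsum s (1 / (s * \<beta>)) (1 / (s * \<delta>)) J C I a"
  using assms(1,2,6-9)
proof (induction I arbitrary: J rule: finite_induct)
  case empty
  have e: "1 / (s\<^sup>2 * \<beta> * \<delta>) = 1 / (s * \<beta>) * (1 / (s * \<delta>))"
    by (simp add: power2_eq_square)
  show ?case
    unfolding e by (simp add: signsum_no_kernel[OF empty(1) nz(1) empty(3)])
next
  case (insert i I J)
  let ?\<beta> = "1 / (s * \<beta>)" and ?\<delta> = "1 / (s * \<delta>)"
  let ?P = "descpoch (s\<^sup>2) (1 / (s\<^sup>2 * \<beta> * \<delta>))" and ?M = "card J"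
  let ?Q = "\<lambda>M. descpoch (s\<^sup>2) (\<beta> * \<delta> * s\<^sup>2 ^ M)"
  have a: "generic_points I a" using insert.prems(2) generic_points_subset by blast
  have C0: "C k \<noteq> 0" if "k \<in> J" for k using generic_pointsD(1)[OF insert.prems(3) that] .
  obtain g where g: "polyfun g (2 * ?M) ((1 - \<beta> * \<delta> * s\<^sup>2 ^ ?M / s\<^sup>2 ^ card I) * signsum s \<beta> \<delta> I a J C)"
    "\<And>x. x \<noteq> 0 \<Longrightarrow> x \<notin> pole_set I a \<Longrightarrow> g x = x ^ ?M * signsum s \<beta> \<delta> (insert i I) (a(i := x)) J C"
    using signsum_polyfun[where C = C and \<beta> = \<beta> and \<delta> = \<delta>,
        OF insert.hyps(1) insert.prems(1) insert.hyps(2) nz(1) _ a] C0 by blast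
  obtain g' where g': "polyfun g' (2 * ?M) ((- s) ^ ?M * signsum s ?\<beta> ?\<delta> J C I a)"
    "\<And>x. x \<noteq> 0 \<Longrightarrow> g' x = x ^ ?M * signsum s ?\<beta> ?\<delta> J C (insert i I) (a(i := x))"
    using signsum_dual_polyfun[where C = C and \<beta> = ?\<beta> and \<delta> = ?\<delta> and a = a,
        OF insert.hyps(1) insert.prems(1) insert.hyps(2) nz(1)] C0 by blast
  let ?K = "?P ?M * (- s) ^ (?M * Suc (card I))" and ?K' = "?Q ?M (Suc (card I))"
  have IH: "?P ?M * (- s) ^ (?M * card I) * signsum s \<beta> \<delta> I a J C
      = ?Q ?M (card I) * signsum s ?\<beta> ?\<delta> J C I a"
    using insert.prems by (intro insert.IH a) auto
  \<comment> \<open>The additional factor of the leading coefficient on the left is the last factor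
    of \<open>?K'\<close>, and \<open>(- s) ^ ?M\<close> on the right is the surplus power in
    \<open>?K\<close>.\<close>
  have lead: "?K * ((1 - \<beta> * \<delta> * s\<^sup>2 ^ ?M / s\<^sup>2 ^ card I) * signsum s \<beta> \<delta> I a J C)
      = ?K' * ((- s) ^ ?M * signsum s ?\<beta> ?\<delta> J C I a)"
  proof -
    have "?K * ((1 - \<beta> * \<delta> * s\<^sup>2 ^ ?M / s\<^sup>2 ^ card I) * signsum s \<beta> \<delta> I a J C)
      = (1 - \<beta> * \<delta> * s\<^sup>2 ^ ?M / s\<^sup>2 ^ card I) * (- s) ^ ?M
        * (?P ?M * (- s) ^ (?M * card I) * signsum s \<beta> \<delta> I a J C)"
      unfolding mult_Suc_right power_add by (simp only: mult_ac)
    then show ?thesis unfolding IH descpoch_Suc by (simp only: mult_ac)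
  qed
  have at_node: "?K * signsum s \<beta> \<delta> (insert i I) (a(i := s * C k)) J C
      = ?K' * signsum s ?\<beta> ?\<delta> J C (insert i I) (a(i := s * C k))" if k: "k \<in> J" for k
  proof -
    define J' where "J' = J - {k}"
    have J: "J = insert k J'" "finite J'" "k \<notin> J'" using k insert.prems(1) unfolding J'_def by auto
    define M where "M = card J'"
    have M: "?M = Suc M" using J by (simp add: M_def)
    have "J' \<subseteq> J" unfolding J'_def by auto
    note sub = generic_points_subset[OF _ this]
    have IH': "?P M * (- s) ^ (M * card I) * signsum s \<beta> \<delta> I a J' C
        = ?Q M (card I) * signsum s ?\<beta> ?\<delta> J' C I a"
      unfolding M_def using insert.prems J'_def
      by (intro insert.IH a sub[OF insert.prems(3)] sub[OF insert.prems(4)]) auto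
    have "s * C k \<noteq> 0" "(s * C k)\<^sup>2 \<noteq> 1" "(C k)\<^sup>2 \<noteq> 1"
      using generic_pointsD[OF insert.prems(3) k] generic_pointsD[OF insert.prems(4) k] by auto
    note ck = C0[OF k] this
    have Cl: "C l \<noteq> 0 \<and> C k \<noteq> C l \<and> C k * C l \<noteq> 1" if "l \<in> J'" for l
      using that generic_pointsD(3,4)[OF insert.prems(3) k, of l] C0[of l] unfolding J'_def by auto
    have aj: "a j \<noteq> 0 \<and> s * C k \<noteq> a j \<and> s * C k * a j \<noteq> 1" if "j \<in> I" for j
      using that insert.prems(5)[of j k] k generic_pointsD(1)[OF a that] by auto
    define w where "w = weight s ?\<beta> ?\<delta> (insert i I) (a(i := s * C k)) (inverse (C k))
        * (\<Prod>l\<in>J'. (1 - C l / (s\<^sup>2 * C k)) * (1 - s\<^sup>2 * C k * C l) / C l)"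
    have L: "signsum s \<beta> \<delta> (insert i I) (a(i := s * C k)) J C
        = s * \<beta> * \<delta> * (- s) ^ M * (- 1 / s) ^ card I * w * signsum s \<beta> \<delta> I a J' C"
    proof -
      have "signsum s \<beta> \<delta> (insert i I) (a(i := s * C k)) (insert k J') C
        = weight s \<beta> \<delta> (insert k J') C (s * C k)
          * (\<Prod>j\<in>I. (1 - C k * a j / s) * (1 - s * a j / C k) / a j) * signsum s \<beta> \<delta> I a J' C"
        by (rule signsum_at_node) (use insert.hyps J nz ck aj in auto)
      also have "weight s \<beta> \<delta> (insert k J') C (s * C k)
          * (\<Prod>j\<in>I. (1 - C k * a j / s) * (1 - s * a j / C k) / a j)
        = s * \<beta> * \<delta> * (- s) ^ M * (- 1 / s) ^ card I * w"
        unfolding w_def M_def by (rule node_weights) (use insert.hyps J nz ck Cl aj in auto)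
      finally show ?thesis unfolding J(1) .
    qed
    have R: "signsum s ?\<beta> ?\<delta> J C (insert i I) (a(i := s * C k)) = w * signsum s ?\<beta> ?\<delta> J' C I a"
      unfolding J(1) w_def
      by (rule signsum_dual_at_node) (use insert.hyps J nz ck Cl in auto)
    have pw: "(- s) ^ (Suc M * Suc (card I)) * (s * \<beta> * \<delta> * (- s) ^ M * (- 1 / s) ^ card I)
        = - (\<beta> * \<delta> * s\<^sup>2 ^ Suc M) * (- s) ^ (M * card I)"
    proof -
      have "(- s) ^ card I * (- 1 / s) ^ card I = 1"
        using nz(1) by (simp flip: power_mult_distrib)
      moreover have "(- s) ^ M * (- s) ^ M = s\<^sup>2 ^ M"
        by (simp flip: power_mult_distrib add: power2_eq_square)
      moreover have "(- s) ^ (Suc M * Suc (card I)) * (s * \<beta> * \<delta> * (- s) ^ M * (- 1 / s) ^ card I)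
        = - (\<beta> * \<delta> * s\<^sup>2 * ((- s) ^ M * (- s) ^ M)) * (- s) ^ (M * card I) * ((- s) ^ card I * (- 1 / s) ^ card I)"
        by (simp add: power_add power2_eq_square mult_ac)
      ultimately show ?thesis by simp
    qed
    \<comment> \<open>\<open>X\<close> links the two scalar products: \<open>1 - X\<close> is split
      off at the front of \<open>?K'\<close>, and \<open>1 - 1 / X\<close> is the last factor of
      \<open>?P (Suc M)\<close>.\<close>
    define X where "X = \<beta> * \<delta> * s\<^sup>2 ^ Suc M"
    have PX: "?P (Suc M) * X = - (1 - X) * ?P M"
    proof -
      have "1 - 1 / (s\<^sup>2 * \<beta> * \<delta>) / s\<^sup>2 ^ M = 1 - 1 / X" "X \<noteq> 0"
        unfolding X_def using nz by (simp_all add: mult_ac)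
      then show ?thesis unfolding descpoch_Suc by (simp add: field_simps)
    qed
    have K': "?K' = (1 - X) * ?Q M (card I)"
      unfolding M X_def using descpoch_shift[of "s\<^sup>2" "\<beta> * \<delta> * s\<^sup>2 ^ M"] nz(1) by (simp add: mult_ac)
    have "?K * signsum s \<beta> \<delta> (insert i I) (a(i := s * C k)) J C
      = ?P (Suc M) * ((- s) ^ (Suc M * Suc (card I)) * (s * \<beta> * \<delta> * (- s) ^ M * (- 1 / s) ^ card I))
        * (w * signsum s \<beta> \<delta> I a J' C)"
      unfolding L M by (simp only: mult_ac)
    also have "\<dots> = - (?P (Suc M) * X) * ((- s) ^ (M * card I) * (w * signsum s \<beta> \<delta> I a J' C))"
      unfolding pw X_def[symmetric] by simp
    also have "\<dots> = (1 - X) * w * (?P M * (- s) ^ (M * card I) * signsum s \<beta> \<delta> I a J' C)"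
      unfolding PX by (simp add: algebra_simps)
    also have "\<dots> = ?K' * (w * signsum s ?\<beta> ?\<delta> J' C I a)"
      unfolding IH' K' by (simp only: mult_ac)
    finally show ?thesis unfolding R .
  qed
  let ?Z = "(\<lambda>k. s * C k) ` J \<union> (\<lambda>k. inverse (s * C k)) ` J"
  have "?K * g (a i) = ?K' * g' (a i)"
  proof (rule polyfun_eq[where f = "\<lambda>x. ?K * g x" and g = "\<lambda>x. ?K' * g' x" and x = "a i" and Z = ?Z])
    show "polyfun (\<lambda>x. ?K * g x) (2 * ?M) (?K * ((1 - \<beta> * \<delta> * s\<^sup>2 ^ ?M / s\<^sup>2 ^ card I) * signsum s \<beta> \<delta> I a J C))"
      by (rule polyfun_cmult[OF g(1)])
    show "polyfun (\<lambda>x. ?K' * g' x) (2 * ?M) (?K * ((1 - \<beta> * \<delta> * s\<^sup>2 ^ ?M / s\<^sup>2 ^ card I) * signsum s \<beta> \<delta> I a J C))"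
      unfolding lead by (rule polyfun_cmult[OF g'(1)])
    show "finite ?Z" using insert.prems(1) by simp
    show "card ?Z = 2 * ?M"
      by (rule generic_points_reciprocals(1)[OF insert.prems(1,4)])
    fix z assume "z \<in> ?Z"
    then obtain k where k: "k \<in> J" and z: "z = s * C k \<or> z = inverse (s * C k)" by auto
    have z0: "z \<noteq> 0" using z C0[OF k] nz(1) by auto
    have v: "(s * C k)\<^sup>2 \<noteq> 1" using generic_pointsD(2)[OF insert.prems(4) k] .
    have "z \<notin> pole_set I a"
    proof
      assume "z \<in> pole_set I a"
      then consider "z\<^sup>2 = 1" | j where "j \<in> I" "z = a j \<or> z = inverse (a j)"
        unfolding pole_set_def by auto
      then show False
      proof cases
        case 1
        then show ?thesis using z v by (metis inverse_1 inverse_inverse_eq power_inverse)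
      next
        case 2
        then have "s * C k = a j \<or> s * C k * a j = 1"
          using z generic_pointsD(1)[OF a 2(1)] C0[OF k] nz(1)
          by (cases "z = s * C k"; cases "z = a j") (auto simp del: inverse_mult_distrib)
        then show ?thesis using insert.prems(5)[of j k] 2(1) k by auto
      qed
    qed
    \<comment> \<open>Both sums are invariant under inversion of the variable, so the evaluation at
      \<open>s * C k\<close> also serves at its inverse.\<close>
    moreover have "signsum s \<beta> \<delta> (insert i I) (a(i := z)) J C = signsum s \<beta> \<delta> (insert i I) (a(i := s * C k)) J C"
      using z signsum_inverse[OF insert.hyps, of s \<beta> \<delta> a "s * C k" J C] by auto
    moreover have "signsum s ?\<beta> ?\<delta> J C (insert i I) (a(i := z))
        = signsum s ?\<beta> ?\<delta> J C (insert i I) (a(i := s * C k))"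
      using z signsum_dual_inverse[OF insert.hyps, of s ?\<beta> ?\<delta> J C a "s * C k"] by auto
    ultimately have gz: "g z = z ^ ?M * signsum s \<beta> \<delta> (insert i I) (a(i := s * C k)) J C"
      "g' z = z ^ ?M * signsum s ?\<beta> ?\<delta> J C (insert i I) (a(i := s * C k))"
      using g(2)[OF z0] g'(2)[OF z0] by auto
    have swap: "u * (v * w) = v * (u * w)" for u v w :: complex by (rule mult.left_commute)
    show "?K * g z = ?K' * g' z"
      unfolding gz swap[of _ "z ^ ?M"] at_node[OF k] by (rule refl)
  qed
  moreover have "a i \<noteq> 0" "a i \<notin> pole_set I a"
    using generic_points_insertD[OF insert.prems(2) insert.hyps(2)] by auto
  ultimately have "a i ^ ?M * (?K * signsum s \<beta> \<delta> (insert i I) a J C)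
      = a i ^ ?M * (?K' * signsum s ?\<beta> ?\<delta> J C (insert i I) a)"
    using g(2)[of "a i"] g'(2)[of "a i"] by (simp add: mult_ac)
  then show ?case
    using \<open>a i \<noteq> 0\<close> insert.hyps by simp
qed

section \<open>Parameters that avoid the powers of \<open>q\<close>\<close>

definition q_free :: "complex \<Rightarrow> complex \<Rightarrow> bool" where
  "q_free q x \<longleftrightarrow> x \<noteq> 0 \<and> (\<forall>e::int. x \<noteq> q powi e)"

lemma q_free_nz: "q_free q x \<Longrightarrow> x \<noteq> 0"
  by (simp add: q_free_def)

text \<open>Excluding all integer powers at once makes the condition stable under inversion and
  under shifts by powers of \<open>q\<close>. A single condition on a product or quotient of two
  parameters then covers every factor arising from it.\<close>

lemma q_free_ne1:
  assumes "q \<noteq> 0" "q_free q x"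
  shows "x * q ^ i / q ^ j \<noteq> 1"
proof
  assume "x * q ^ i / q ^ j = 1"
  then have "x = q ^ j / q ^ i" using assms(1) by (simp add: field_simps)
  also have "\<dots> = q powi (int j - int i)" using assms(1) by (simp add: power_int_diff)
  finally show False using assms(2) unfolding q_free_def by metis
qed

lemma q_free_ne1':
  assumes "q \<noteq> 0" "q_free q x"
  shows "x \<noteq> 1" "x * q ^ i \<noteq> 1" "x / q ^ j \<noteq> 1" "x * q \<noteq> 1" "x / q \<noteq> 1"
  using q_free_ne1[OF assms, of 0 0] q_free_ne1[OF assms, of i 0] q_free_ne1[OF assms, of 0 j]
    q_free_ne1[OF assms, of 1 0] q_free_ne1[OF assms, of 0 1] by auto

lemma q_free_mult_powi:
  assumes "q \<noteq> 0" "q_free q x"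
  shows "q_free q (x * q powi e)"
proof -
  have "x \<noteq> q powi f" if "x * q powi e = q powi g" "f = g - e" for f g
    using assms by (auto simp: q_free_def)
  then show ?thesis
    using assms unfolding q_free_def by (metis divide_eq_eq mult_eq_0_iff nonzero_mult_div_cancel_right power_int_diff power_int_eq_0_iff)
qed

lemma q_free_mult_q: "q \<noteq> 0 \<Longrightarrow> q_free q x \<Longrightarrow> q_free q (x * q)"
  using q_free_mult_powi[of q x 1] by simp

lemma q_free_div_q: "q \<noteq> 0 \<Longrightarrow> q_free q x \<Longrightarrow> q_free q (x / q)"
  using q_free_mult_powi[of q x "- 1"] by (simp add: divide_inverse)

lemma q_free_inverse:
  assumes "q_free q x"
  shows "q_free q (inverse x)"
  using assms unfolding q_free_def by (metis inverse_inverse_eq inverse_zero power_int_minus)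

lemma qpoch_0 [simp]: "qpoch q a 0 = 1"
  by (simp add: qpoch_def)

lemma qpoch_Suc: "qpoch q a (Suc k) = qpoch q a k * (1 - a * q ^ k)"
  by (simp add: qpoch_def)

section \<open>Telescoping of the pair factors along a progression\<close>

lemma prod_telescope_ge:
  fixes f :: "nat \<Rightarrow> complex"
  assumes "Y \<le> L" "\<And>t. Y \<le> t \<Longrightarrow> t \<le> L \<Longrightarrow> f t \<noteq> 0"
  shows "(\<Prod>t\<in>{Y..<L}. f (Suc t) / f t) = f L / f Y"
  using assms
proof (induction L rule: dec_induct)
  case base
  then show ?case by simp
next
  case (step L)
  then show ?case by (simp add: prod.atLeastLessThan_Suc)
qed

lemma prod_telescope_ge':
  fixes f :: "nat \<Rightarrow> complex"
  assumes "Y \<le> L" "\<And>t. Y \<le> t \<Longrightarrow> t \<le> L \<Longrightarrow> f t \<noteq> 0"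
  shows "(\<Prod>t\<in>{Y..<L}. f t / f (Suc t)) = f Y / f L"
proof -
  have "(\<Prod>t\<in>{Y..<L}. f t / f (Suc t)) = inverse (\<Prod>t\<in>{Y..<L}. f (Suc t) / f t)"
    by (simp add: prod_inversef[symmetric] del: prod_dividef)
  then show ?thesis by (simp add: prod_telescope_ge assms del: prod_dividef)
qed

text \<open>The quotient between the two signs of \<open>s * z * q ^ y\<close>, against one node of
  a progression. Expressed by \<open>U\<close> and \<open>F\<close> it involves only the arguments
  \<open>t\<close> and \<open>Suc t\<close>, which makes the product over a progression telescope.
  The factor \<open>q\<close> arises when \<open>hfac q (inverse u)\<close> is rewritten in
  \<open>u\<close>.\<close>

lemma hfac_ratio_plus:
  fixes q s z w :: complex and y :: nat
  assumes "s\<^sup>2 = q" "s \<noteq> 0" "z \<noteq> 0" "w \<noteq> 0"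
  defines "U \<equiv> \<lambda>t. 1 - z * w * q ^ (y + t)" and "F \<equiv> \<lambda>t. 1 - z / w * q ^ Suc y / q ^ t"
  assumes nz: "F t \<noteq> 0" "F (Suc t) \<noteq> 0" "U t \<noteq> 0" "U (Suc t) \<noteq> 0"
  shows "hfac q (s * z * q ^ y * (s * w * q ^ t)) / hfac q (inverse (s * z * q ^ y) * (s * w * q ^ t))
    = q * (U t / U (Suc t)) * (F (Suc t) / F t)"
proof -
  have q: "q \<noteq> 0" using assms by auto
  define u where "u = z / w * q ^ y / q ^ t"
  have u0: "u \<noteq> 0" using assms(3,4) q by (simp add: u_def)
  have e1: "s * z * q ^ y * (s * w * q ^ t) = z * w * q ^ (y + Suc t)"
    using assms(1) by (simp add: power_add power2_eq_square mult_ac)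
  have e2: "inverse (s * z * q ^ y) * (s * w * q ^ t) = inverse u"
    using assms(2-4) q by (simp add: u_def field_simps)
  have e3: "z * w * q ^ (y + Suc t) / q = z * w * q ^ (y + t)" using q by simp
  have F: "F t = 1 - u * q" "F (Suc t) = 1 - u"
    using q by (simp_all add: F_def u_def field_simps)
  have "hfac q (z * w * q ^ (y + Suc t)) = U t / U (Suc t)"
    unfolding hfac_def e3 U_def by simp
  moreover have "hfac q (inverse u) = (1 - u * q) / (q * (1 - u))"
  proof -
    have "1 - u \<noteq> 0" "1 - inverse u \<noteq> 0" using nz F u0 by (auto simp: field_simps)
    then show ?thesis
      unfolding hfac_def using u0 q by (simp add: divide_simps) (simp add: algebra_simps)
  qed
  ultimately show ?thesis unfolding e1 e2 F by simp
qed

text \<open>For inverted nodes the same \<open>U\<close> and \<open>F\<close> occur with arguments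
  one larger, so both parts of a progression can be handled with one pair of functions.\<close>

lemma hfac_ratio_minus:
  fixes q s z w :: complex and y :: nat
  assumes "s\<^sup>2 = q" "s \<noteq> 0" "z \<noteq> 0" "w \<noteq> 0"
  defines "U \<equiv> \<lambda>t. 1 - z * w * q ^ (y + t)" and "F \<equiv> \<lambda>t. 1 - z / w * q ^ Suc y / q ^ t"
  assumes nz: "F (Suc t) \<noteq> 0" "F (Suc (Suc t)) \<noteq> 0" "U (Suc t) \<noteq> 0" "U (Suc (Suc t)) \<noteq> 0"
  shows "hfac q (s * z * q ^ y * inverse (s * w * q ^ t)) / hfac q (inverse (s * z * q ^ y) * inverse (s * w * q ^ t))
    = q * (U (Suc t) / U (Suc (Suc t))) * (F (Suc (Suc t)) / F (Suc t))"
proof -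
  have q: "q \<noteq> 0" using assms by auto
  define v where "v = z * w * q ^ (y + Suc t)"
  have v0: "v \<noteq> 0" using assms(3,4) q by (simp add: v_def)
  have e1: "s * z * q ^ y * inverse (s * w * q ^ t) = z / w * q ^ Suc y / q ^ Suc t"
    using assms(2-4) q by (simp add: field_simps)
  have e2: "inverse (s * z * q ^ y) * inverse (s * w * q ^ t) = inverse v"
  proof -
    have "s * z * q ^ y * (s * w * q ^ t) = v"
      using assms(1) by (simp add: v_def power_add power2_eq_square mult_ac)
    then show ?thesis by (simp flip: inverse_mult_distrib)
  qed
  have U: "U (Suc t) = 1 - v" "U (Suc (Suc t)) = 1 - v * q"
    by (simp_all add: U_def v_def mult_ac)
  have "hfac q (z / w * q ^ Suc y / q ^ Suc t) = F (Suc (Suc t)) / F (Suc t)"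
    unfolding hfac_def F_def by (simp add: mult_ac)
  moreover have "hfac q (inverse v) = (1 - v * q) / (q * (1 - v))"
  proof -
    have "1 - v \<noteq> 0" "1 - inverse v \<noteq> 0" using nz U v0 by (auto simp: field_simps)
    then show ?thesis
      unfolding hfac_def using v0 q by (simp add: divide_simps) (simp add: algebra_simps)
  qed
  ultimately show ?thesis unfolding e1 e2 U by (simp add: mult_ac)
qed

text \<open>Nodes below \<open>Y\<close> are not inverted, those from \<open>Y'\<close> on are. The
  gap between is empty for a foreign progression; for the own one, with \<open>w = z\<close> and
  \<open>Y = y\<close>, it is the flipped node itself and \<open>Y' = Suc Y\<close>. In that case
  \<open>F (Suc y) = 0\<close>, which is why \<open>F\<close> is required to be non-zero only
  outside the gap.\<close>

lemma hfac_ratio_chain: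
  fixes q s z w :: complex and y :: nat
  assumes "s\<^sup>2 = q" "s \<noteq> 0" "z \<noteq> 0" "w \<noteq> 0"
  defines "U \<equiv> \<lambda>t. 1 - z * w * q ^ (y + t)" and "F \<equiv> \<lambda>t. 1 - z / w * q ^ Suc y / q ^ t"
  assumes A: "\<And>t. t < Y \<Longrightarrow> A t = s * w * q ^ t" "\<And>t. Y' \<le> t \<Longrightarrow> t < L \<Longrightarrow> A t = inverse (s * w * q ^ t)"
    and le: "Y \<le> Y'" "Y' \<le> L"
    and nz: "\<And>t. t \<le> Suc L \<Longrightarrow> U t \<noteq> 0" "\<And>t. t \<le> Y \<or> Suc Y' \<le> t \<Longrightarrow> t \<le> Suc L \<Longrightarrow> F t \<noteq> 0"
  shows "(\<Prod>t\<in>{..<Y} \<union> {Y'..<L}. hfac q (s * z * q ^ y * A t) / hfac q (inverse (s * z * q ^ y) * A t))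
    = q ^ (L - (Y' - Y)) * (U 0 * U (Suc Y') * (F Y * F (Suc L)))
       / (U Y * U (Suc L) * (F 0 * F (Suc Y')))"
proof -
  let ?R = "\<lambda>t. hfac q (s * z * q ^ y * A t) / hfac q (inverse (s * z * q ^ y) * A t)"
  have "(\<Prod>t\<in>{0..<Y}. ?R t) = (\<Prod>t\<in>{0..<Y}. q * (U t / U (Suc t)) * (F (Suc t) / F t))"
  proof (intro prod.cong refl)
    fix t assume t: "t \<in> {0..<Y}"
    then have A1: "A t = s * w * q ^ t" using A(1) by simp
    show "?R t = q * (U t / U (Suc t)) * (F (Suc t) / F t)"
    proof -
      have n: "F t \<noteq> 0" "F (Suc t) \<noteq> 0" "U t \<noteq> 0" "U (Suc t) \<noteq> 0"
        using t le nz by auto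
      show ?thesis
        unfolding A1 U_def F_def by (rule hfac_ratio_plus[OF assms(1-4) n[unfolded U_def F_def]])
    qed
  qed
  also have "\<dots> = q ^ Y * (U 0 / U Y) * (F Y / F 0)"
  proof -
    have "(\<Prod>t\<in>{0..<Y}. U t / U (Suc t)) = U 0 / U Y" "(\<Prod>t\<in>{0..<Y}. F (Suc t) / F t) = F Y / F 0"
      using le nz by (intro prod_telescope_ge' prod_telescope_ge; force)+
    then show ?thesis by (simp only: prod.distrib prod_constant card_atLeastLessThan diff_zero)
  qed
  finally have P1: "(\<Prod>t\<in>{0..<Y}. ?R t) = \<dots>" .
  have "(\<Prod>t\<in>{Y'..<L}. ?R t) = (\<Prod>t\<in>{Y'..<L}. q * (U (Suc t) / U (Suc (Suc t))) * (F (Suc (Suc t)) / F (Suc t)))"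
  proof (intro prod.cong refl)
    fix t assume t: "t \<in> {Y'..<L}"
    then have A2: "A t = inverse (s * w * q ^ t)" using A(2) by simp
    show "?R t = q * (U (Suc t) / U (Suc (Suc t))) * (F (Suc (Suc t)) / F (Suc t))"
    proof -
      have n: "F (Suc t) \<noteq> 0" "F (Suc (Suc t)) \<noteq> 0" "U (Suc t) \<noteq> 0" "U (Suc (Suc t)) \<noteq> 0"
        using t le nz by auto
      show ?thesis
        unfolding A2 U_def F_def by (rule hfac_ratio_minus[OF assms(1-4) n[unfolded U_def F_def]])
    qed
  qed
  also have "\<dots> = q ^ (L - Y') * (U (Suc Y') / U (Suc L)) * (F (Suc L) / F (Suc Y'))"
  proof -
    have "(\<Prod>t\<in>{Y'..<L}. U (Suc t) / U (Suc (Suc t))) = U (Suc Y') / U (Suc L)"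
      using le nz by (intro prod_telescope_ge'[where f = "\<lambda>t. U (Suc t)"]) auto
    moreover have "(\<Prod>t\<in>{Y'..<L}. F (Suc (Suc t)) / F (Suc t)) = F (Suc L) / F (Suc Y')"
      using le nz by (intro prod_telescope_ge[where f = "\<lambda>t. F (Suc t)"]) auto
    ultimately show ?thesis by (simp only: prod.distrib prod_constant card_atLeastLessThan)
  qed
  finally have P2: "(\<Prod>t\<in>{Y'..<L}. ?R t) = \<dots>" .
  have "(\<Prod>t\<in>{..<Y} \<union> {Y'..<L}. ?R t) = (\<Prod>t\<in>{0..<Y}. ?R t) * (\<Prod>t\<in>{Y'..<L}. ?R t)"
    using le by (subst prod.union_disjoint) (auto simp: lessThan_atLeast0)
  moreover have "q ^ (L - (Y' - Y)) = q ^ Y * q ^ (L - Y')"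
    using le by (simp flip: power_add add: add.commute)
  ultimately show ?thesis unfolding P1 P2 by (simp add: mult_ac)
qed

section \<open>Specialisation to geometric progressions\<close>

text \<open>The conditions also keep numerators from vanishing, as the quotients of neighbouring
  terms require, and the list as a whole is preserved by the exchange of the two sides.\<close>

definition generic_params :: "complex \<Rightarrow> nat \<Rightarrow> nat \<Rightarrow> (nat \<Rightarrow> complex) \<Rightarrow> (nat \<Rightarrow> complex) \<Rightarrow> complex \<Rightarrow> complex \<Rightarrow> bool" where
  "generic_params q n p z c b d \<longleftrightarrow>
     q \<noteq> 0 \<and> (\<forall>i>0. q ^ i \<noteq> 1) \<and> b \<noteq> 0 \<and> d \<noteq> 0 \<and> q_free q (b * d)
     \<and> (\<forall>k\<in>{1..n}. z k \<noteq> 0) \<and> (\<forall>j\<in>{1..p}. c j \<noteq> 0)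
     \<and> (\<forall>j\<in>{1..n}. \<forall>k\<in>{1..n}. q_free q (z j * z k) \<and> (j \<noteq> k \<longrightarrow> q_free q (z j / z k)))
     \<and> (\<forall>j\<in>{1..p}. \<forall>k\<in>{1..p}. q_free q (c j * c k) \<and> (j \<noteq> k \<longrightarrow> q_free q (c j / c k)))
     \<and> (\<forall>k\<in>{1..n}. \<forall>j\<in>{1..p}. q_free q (c j * z k) \<and> q_free q (c j / z k))
     \<and> (\<forall>k\<in>{1..n}. q_free q (b * z k) \<and> q_free q (z k / b) \<and> q_free q (d * z k) \<and> q_free q (z k / d))
     \<and> (\<forall>j\<in>{1..p}. q_free q (c j * b) \<and> q_free q (c j / b) \<and> q_free q (c j * d) \<and> q_free q (c j / d))"

lemma generic_paramsD:
  assumes "generic_params q n p z c b d"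
  shows "q \<noteq> 0" "i > 0 \<Longrightarrow> q ^ i \<noteq> 1" "b \<noteq> 0" "d \<noteq> 0" "q_free q (b * d)"
    and "k \<in> {1..n} \<Longrightarrow> z k \<noteq> 0" "j \<in> {1..p} \<Longrightarrow> c j \<noteq> 0"
    and "i \<in> {1..n} \<Longrightarrow> k \<in> {1..n} \<Longrightarrow> q_free q (z i * z k)"
    and "i \<in> {1..n} \<Longrightarrow> k \<in> {1..n} \<Longrightarrow> i \<noteq> k \<Longrightarrow> q_free q (z i / z k)"
    and "i \<in> {1..p} \<Longrightarrow> j \<in> {1..p} \<Longrightarrow> q_free q (c i * c j)"
    and "i \<in> {1..p} \<Longrightarrow> j \<in> {1..p} \<Longrightarrow> i \<noteq> j \<Longrightarrow> q_free q (c i / c j)"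
    and "k \<in> {1..n} \<Longrightarrow> j \<in> {1..p} \<Longrightarrow> q_free q (c j * z k)"
    and "k \<in> {1..n} \<Longrightarrow> j \<in> {1..p} \<Longrightarrow> q_free q (c j / z k)"
    and "k \<in> {1..n} \<Longrightarrow> q_free q (b * z k)" "k \<in> {1..n} \<Longrightarrow> q_free q (z k / b)"
    and "k \<in> {1..n} \<Longrightarrow> q_free q (d * z k)" "k \<in> {1..n} \<Longrightarrow> q_free q (z k / d)"
    and "j \<in> {1..p} \<Longrightarrow> q_free q (c j * b)" "j \<in> {1..p} \<Longrightarrow> q_free q (c j / b)"
    and "j \<in> {1..p} \<Longrightarrow> q_free q (c j * d)" "j \<in> {1..p} \<Longrightarrow> q_free q (c j / d)"
  using assms by (auto simp: generic_params_def)

text \<open>This is the substitution that turns the left-hand series into the right-hand one. Each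
  condition goes over into another one of the list up to inversion and a shift by \<open>q\<close>,
  both of which \<open>q_free\<close> tolerates.\<close>

lemma generic_params_dual:
  assumes g: "generic_params q n p z c b d" and s: "s\<^sup>2 = q"
  shows "generic_params q p n (\<lambda>j. c j / s) (\<lambda>k. s * z k) (s / b) (s / d)"
proof -
  have q: "q \<noteq> 0" and s0: "s \<noteq> 0" using g s by (auto simp: generic_params_def)
  have ss: "s * s = q" using s by (simp add: power2_eq_square)
  have 1: "q_free q (s / b * (s / d))" if "q_free q (b * d)"
  proof -
    have e: "s / b * (s / d) = inverse (b * d) * q" by (simp add: divide_inverse mult_ac ss[symmetric])
    show ?thesis unfolding e by (rule q_free_mult_q[OF q q_free_inverse[OF that]])
  qed
  have 2: "q_free q (x / s * (y / s))" if "q_free q (x * y)" for x y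
    using q_free_div_q[OF q that] ss by simp
  have 3: "q_free q (s * x * (s * y))" if "q_free q (x * y)" for x y
    using q_free_mult_q[OF q that] ss[symmetric] by (simp add: mult_ac)
  have 4: "q_free q (s * x / (y / s))" if "q_free q (y / x)" for x y
  proof -
    have e: "s * x / (y / s) = inverse (y / x) * q" by (simp add: divide_inverse mult_ac ss[symmetric])
    show ?thesis unfolding e by (rule q_free_mult_q[OF q q_free_inverse[OF that]])
  qed
  have 5: "q_free q (x / s / (s / y))" if "q_free q (x * y)" for x y
    using q_free_div_q[OF q that] ss by simp
  have 6: "q_free q (s * x / (s / y))" if "q_free q (y * x)" for x y
    using that s0 by (simp add: mult_ac)
  have 7: "q_free q (s * x * (s / y))" if "q_free q (x / y)" for x y
  proof -
    have e: "s * x * (s / y) = x / y * q" by (simp add: ss[symmetric] mult_ac)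
    show ?thesis unfolding e by (rule q_free_mult_q[OF q that])
  qed
  have 8: "q_free q (s / x * (y / s))" if "q_free q (y / x)" for x y
    using that s0 by simp
  have 9: "q_free q (s * x * (y / s))" if "q_free q (y * x)" for x y
    using that s0 by (simp add: mult_ac)
  have 10: "q_free q (x / s / (y / s))" "q_free q (s * x / (s * y))" if "q_free q (x / y)" for x y
    using that s0 by simp_all
  note D = generic_paramsD[OF g]
  show ?thesis
    unfolding generic_params_def
    by (intro conjI ballI allI impI; (rule 1 2 3 4 5 6 7 8 9 10)?; (blast intro: D | simp add: D s0))
qed

section \<open>Quotients of neighbouring terms of the left-hand series\<close>

lemma pairprod_atLeastAtMost: "pairprod {1..n} f = (\<Prod>j\<in>{1..n}. \<Prod>k\<in>{j<..n}. f j k)"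
proof -
  have "{k\<in>{1..n}. j < k} = {j<..n}" if "j \<in> {1..n}" for j
    using that by auto
  then show ?thesis
    unfolding pairprod_def by (intro prod.cong) auto
qed

lemma W_eq_pairprod:
  "W n u = (\<Prod>j\<in>{1..n}. 1 - (u j)\<^sup>2) * pairprod {1..n} (\<lambda>i j. (1 - u i * u j) * (u i - u j))"
proof -
  have "(\<Prod>k\<in>{j..n}. 1 - u j * u k) = (1 - (u j)\<^sup>2) * (\<Prod>k\<in>{j<..n}. 1 - u j * u k)" if "j \<in> {1..n}" for j
  proof -
    have "{j..n} = insert j {j<..n}" using that by auto
    then show ?thesis by (simp add: power2_eq_square)
  qed
  then have "(\<Prod>j\<in>{1..n}. \<Prod>k\<in>{j..n}. 1 - u j * u k)
      = (\<Prod>j\<in>{1..n}. (1 - (u j)\<^sup>2) * (\<Prod>k\<in>{j<..n}. 1 - u j * u k))"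
    by (intro prod.cong) auto
  then show ?thesis
    unfolding W_def pairprod_atLeastAtMost by (simp only: prod.distrib mult.assoc)
qed

lemma pairprod_divide: "pairprod I f / pairprod I g = pairprod I (\<lambda>i j. f i j / g i j)"
  by (simp add: pairprod_def prod_dividef)

lemma pairprod_ne0:
  assumes "finite I" "\<And>i j. i \<in> I \<Longrightarrow> j \<in> I \<Longrightarrow> i < j \<Longrightarrow> f i j \<noteq> 0"
  shows "pairprod I f \<noteq> 0"
  using assms by (simp add: pairprod_def)

lemma W_fun_upd:
  assumes k: "k \<in> {1..n}"
    and nz: "\<And>i. i \<in> {1..n} \<Longrightarrow> (u i)\<^sup>2 \<noteq> 1"
      "\<And>i j. i \<in> {1..n} \<Longrightarrow> j \<in> {1..n} \<Longrightarrow> i \<noteq> j \<Longrightarrow> u i * u j \<noteq> 1 \<and> u i \<noteq> u j"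
  shows "W n (u(k := v)) = W n u * ((1 - v\<^sup>2) / (1 - (u k)\<^sup>2)
    * (\<Prod>j\<in>{1..n}-{k}. (1 - v * u j) * (v - u j) / ((1 - u k * u j) * (u k - u j))))"
proof -
  let ?u = "u(k := v)" and ?I = "{1..n} - {k}"
  let ?f = "\<lambda>u i j. (1 - u i * u j) * (u i - u j)"
  let ?g = "\<lambda>i j. ?f ?u i j / ?f u i j"
  have W0: "W n u \<noteq> 0"
  proof -
    have "pairprod {1..n} (?f u) \<noteq> 0"
      using nz by (intro pairprod_ne0) (auto dest: less_imp_neq)
    then show ?thesis unfolding W_eq_pairprod using nz(1) by simp
  qed
  have I: "{1..n} = insert k ?I" "finite ?I" "k \<notin> ?I" using k by auto
  \<comment> \<open>Turning a pair round changes the sign of the factor \<open>?f\<close>, hence not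
    of the quotient \<open>?g\<close>; this is the symmetry that \<open>pairprod_insert\<close>
    needs.\<close>
  have f: "?g i k = ?g k i" if "i \<in> ?I" for i
  proof -
    have *: "?f u i k = - ?f u k i" for u :: "nat \<Rightarrow> complex" by (simp add: algebra_simps)
    have "a / b = a' / b'" if "a = - a'" "b = - b'" for a b a' b' :: complex
      using that by simp
    then show ?thesis using *[of ?u] *[of u] by blast
  qed
  have "pairprod ?I ?g = pairprod ?I (\<lambda>i j. 1)"
    by (rule pairprod_cong) (use nz in \<open>simp add: less_imp_neq\<close>)
  also have "\<dots> = 1" by (simp add: pairprod_def)
  finally have P1: "pairprod ?I ?g = 1" .
  have "W n ?u / W n u = (\<Prod>j\<in>{1..n}. (1 - (?u j)\<^sup>2) / (1 - (u j)\<^sup>2)) * pairprod {1..n} ?g"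
    unfolding W_eq_pairprod by (simp add: pairprod_divide[symmetric] prod_dividef)
  also have "(\<Prod>j\<in>{1..n}. (1 - (?u j)\<^sup>2) / (1 - (u j)\<^sup>2)) = (1 - v\<^sup>2) / (1 - (u k)\<^sup>2)"
  proof -
    have "(\<Prod>j\<in>?I. (1 - (?u j)\<^sup>2) / (1 - (u j)\<^sup>2)) = (\<Prod>j\<in>?I. 1)"
      using nz by (intro prod.cong) auto
    then show ?thesis by (subst I(1), subst prod.insert[OF I(2,3)]) simp
  qed
  also have "pairprod {1..n} ?g = (\<Prod>i\<in>?I. ?g k i) * pairprod ?I ?g"
  proof -
    have "pairprod (insert k ?I) ?g = (\<Prod>i\<in>?I. ?g k i) * pairprod ?I ?g"
      by (rule pairprod_insert[OF I(2,3)]) (rule f)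
    then show ?thesis unfolding I(1)[symmetric] .
  qed
  also have "(\<Prod>i\<in>?I. ?g k i) = (\<Prod>j\<in>?I. (1 - v * u j) * (v - u j) / ((1 - u k * u j) * (u k - u j)))"
    by (intro prod.cong) auto
  finally have "W n ?u / W n u = (1 - v\<^sup>2) / (1 - (u k)\<^sup>2)
      * (\<Prod>j\<in>?I. (1 - v * u j) * (v - u j) / ((1 - u k * u j) * (u k - u j)))"
    unfolding P1 mult_1_right .
  moreover have "a = b * c" if "a / b = c" "b \<noteq> 0" for a b c :: complex
    using that by auto
  ultimately show ?thesis using W0 by blast
qed

definition phi_term :: "complex \<Rightarrow> nat \<Rightarrow> nat \<Rightarrow> (nat \<Rightarrow> nat) \<Rightarrow> (nat \<Rightarrow> nat) \<Rightarrow> (nat \<Rightarrow> complex) \<Rightarrow> (nat \<Rightarrow> complex)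
    \<Rightarrow> complex \<Rightarrow> complex \<Rightarrow> (nat \<Rightarrow> nat) \<Rightarrow> complex" where
  "phi_term q n p l m z c b d y =
        (W n (\<lambda>k. z k * q ^ y k) / W n z)
      * (\<Prod>k\<in>{1..n}. \<Prod>j\<in>{1..p}.
           (qpoch q (q ^ m j * c j * z k) (y k) * qpoch q (q * z k / c j) (y k))
         / (qpoch q (c j * z k) (y k) * qpoch q (q powi (1 - int (m j)) * z k / c j) (y k)))
      * (\<Prod>j\<in>{1..n}. \<Prod>k\<in>{1..n}.
           (qpoch q (z j * z k) (y k) * qpoch q (q powi (- int (l j)) * z k / z j) (y k))
         / (qpoch q (q * z k / z j) (y k) * qpoch q (q ^ (1 + l j) * z j * z k) (y k)))
      * (\<Prod>k\<in>{1..n}.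
           (qpoch q (b * z k) (y k) * qpoch q (d * z k) (y k))
         / (qpoch q (q * z k / b) (y k) * qpoch q (q * z k / d) (y k)))
      * (q powi (1 - int (tsum p m) + int (tsum n l)) / (b * d)) ^ tsum n y"

lemma prod_update_factor:
  fixes f :: "'a \<Rightarrow> nat \<Rightarrow> complex"
  assumes "finite I" "k \<in> I" "f k v = f k (y k) * r"
  shows "(\<Prod>i\<in>I. f i ((y(k := v)) i)) = (\<Prod>i\<in>I. f i (y i)) * r"
proof -
  have "(\<Prod>i\<in>I - {k}. f i ((y(k := v)) i)) = (\<Prod>i\<in>I - {k}. f i (y i))"
    by (intro prod.cong) auto
  then show ?thesis
    using assms by (subst (1 2) prod.remove[OF assms(1,2)]) (simp add: mult_ac)
qed

lemma qpoch_quotient_Suc: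
  "(qpoch q u (Suc y) * qpoch q v (Suc y)) / (qpoch q w (Suc y) * qpoch q x (Suc y))
    = (qpoch q u y * qpoch q v y) / (qpoch q w y * qpoch q x y)
      * ((1 - u * q ^ y) * (1 - v * q ^ y) / ((1 - w * q ^ y) * (1 - x * q ^ y)))"
  by (simp add: qpoch_Suc mult_ac)

lemma generic_params_shifted:
  assumes g: "generic_params q n p z c b d"
  shows "i \<in> {1..n} \<Longrightarrow> (z i * q ^ e)\<^sup>2 \<noteq> 1"
    and "i \<in> {1..n} \<Longrightarrow> j \<in> {1..n} \<Longrightarrow> i \<noteq> j \<Longrightarrow> z i * q ^ e * (z j * q ^ f) \<noteq> 1"
    and "i \<in> {1..n} \<Longrightarrow> j \<in> {1..n} \<Longrightarrow> i \<noteq> j \<Longrightarrow> z i * q ^ e \<noteq> z j * q ^ f"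
proof -
  note q = generic_paramsD(1)[OF g]
  show "(z i * q ^ e)\<^sup>2 \<noteq> 1" if "i \<in> {1..n}"
    using q_free_ne1'(2)[OF q generic_paramsD(8)[OF g that that], of "e + e"]
    by (simp add: power_add power2_eq_square mult_ac)
  show "z i * q ^ e * (z j * q ^ f) \<noteq> 1" if "i \<in> {1..n}" "j \<in> {1..n}" "i \<noteq> j"
    using q_free_ne1'(2)[OF q generic_paramsD(8)[OF g that(1,2)], of "e + f"]
    by (simp add: power_add mult_ac)
  show "z i * q ^ e \<noteq> z j * q ^ f" if "i \<in> {1..n}" "j \<in> {1..n}" "i \<noteq> j"
    using q_free_ne1[OF q generic_paramsD(9)[OF g that], of e f] generic_paramsD(6)[OF g that(2)] q
    by (auto simp: field_simps)
qed

text \<open>The quotient is written in exactly the form in which it reappears in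
  \<open>summand_flip_step\<close>; two families with the same quotients are proportional.\<close>

lemma phi_term_step:
  assumes g: "generic_params q n p z c b d" and k: "k \<in> {1..n}"
  shows "phi_term q n p l m z c b d (y(k := Suc (y k))) = phi_term q n p l m z c b d y *
    ((1 - (z k * q ^ Suc (y k))\<^sup>2) / (1 - (z k * q ^ y k)\<^sup>2)
      * (\<Prod>j\<in>{1..n}-{k}. (1 - z k * q ^ Suc (y k) * (z j * q ^ y j)) * (z k * q ^ Suc (y k) - z j * q ^ y j)
          / ((1 - z k * q ^ y k * (z j * q ^ y j)) * (z k * q ^ y k - z j * q ^ y j)))
      * (\<Prod>j\<in>{1..p}. (1 - q ^ m j * c j * z k * q ^ y k) * (1 - q * z k / c j * q ^ y k)
          / ((1 - c j * z k * q ^ y k) * (1 - q powi (1 - int (m j)) * z k / c j * q ^ y k)))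
      * (\<Prod>j\<in>{1..n}. (1 - z j * z k * q ^ y k) * (1 - q powi (- int (l j)) * z k / z j * q ^ y k)
          / ((1 - q * z k / z j * q ^ y k) * (1 - q ^ (1 + l j) * z j * z k * q ^ y k)))
      * ((1 - b * z k * q ^ y k) * (1 - d * z k * q ^ y k)
          / ((1 - q * z k / b * q ^ y k) * (1 - q * z k / d * q ^ y k)))
      * (q powi (1 - int (tsum p m) + int (tsum n l)) / (b * d)))"
proof -
  let ?y = "y(k := Suc (y k))"
  let ?f = "\<lambda>k i. \<Prod>j\<in>{1..p}. (qpoch q (q ^ m j * c j * z k) i * qpoch q (q * z k / c j) i)
         / (qpoch q (c j * z k) i * qpoch q (q powi (1 - int (m j)) * z k / c j) i)"
  let ?g = "\<lambda>k i. \<Prod>j\<in>{1..n}. (qpoch q (z j * z k) i * qpoch q (q powi (- int (l j)) * z k / z j) i)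
         / (qpoch q (q * z k / z j) i * qpoch q (q ^ (1 + l j) * z j * z k) i)"
  let ?h = "\<lambda>k i. (qpoch q (b * z k) i * qpoch q (d * z k) i)
         / (qpoch q (q * z k / b) i * qpoch q (q * z k / d) i)"
  let ?X = "q powi (1 - int (tsum p m) + int (tsum n l)) / (b * d)"
  have phi: "phi_term q n p l m z c b d y = W n (\<lambda>k. z k * q ^ y k) / W n z
     * (\<Prod>k\<in>{1..n}. ?f k (y k)) * (\<Prod>k\<in>{1..n}. ?g k (y k)) * (\<Prod>k\<in>{1..n}. ?h k (y k)) * ?X ^ tsum n y" for y
    unfolding phi_term_def by (subst (3) prod.swap) (rule refl)
  have zy: "(\<lambda>i. z i * q ^ ?y i) = (\<lambda>i. z i * q ^ y i)(k := z k * q ^ Suc (y k))"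
    by auto
  have WW: "W n (\<lambda>i. z i * q ^ ?y i) = W n (\<lambda>k. z k * q ^ y k) *
      ((1 - (z k * q ^ Suc (y k))\<^sup>2) / (1 - (z k * q ^ y k)\<^sup>2)
      * (\<Prod>j\<in>{1..n}-{k}. (1 - z k * q ^ Suc (y k) * (z j * q ^ y j)) * (z k * q ^ Suc (y k) - z j * q ^ y j)
          / ((1 - z k * q ^ y k * (z j * q ^ y j)) * (z k * q ^ y k - z j * q ^ y j))))"
    unfolding zy by (rule W_fun_upd[OF k]) (use generic_params_shifted[OF g] in blast)+
  have F: "(\<Prod>k\<in>{1..n}. ?f k (?y k)) = (\<Prod>k\<in>{1..n}. ?f k (y k))
      * (\<Prod>j\<in>{1..p}. (1 - q ^ m j * c j * z k * q ^ y k) * (1 - q * z k / c j * q ^ y k)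
          / ((1 - c j * z k * q ^ y k) * (1 - q powi (1 - int (m j)) * z k / c j * q ^ y k)))"
    by (rule prod_update_factor[OF _ k]) (simp_all only: qpoch_quotient_Suc prod.distrib finite_atLeastAtMost)
  have G: "(\<Prod>k\<in>{1..n}. ?g k (?y k)) = (\<Prod>k\<in>{1..n}. ?g k (y k))
      * (\<Prod>j\<in>{1..n}. (1 - z j * z k * q ^ y k) * (1 - q powi (- int (l j)) * z k / z j * q ^ y k)
          / ((1 - q * z k / z j * q ^ y k) * (1 - q ^ (1 + l j) * z j * z k * q ^ y k)))"
    by (rule prod_update_factor[OF _ k]) (simp_all only: qpoch_quotient_Suc prod.distrib finite_atLeastAtMost)
  have H: "(\<Prod>k\<in>{1..n}. ?h k (?y k)) = (\<Prod>k\<in>{1..n}. ?h k (y k))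
      * ((1 - b * z k * q ^ y k) * (1 - d * z k * q ^ y k)
          / ((1 - q * z k / b * q ^ y k) * (1 - q * z k / d * q ^ y k)))"
    by (rule prod_update_factor[OF _ k]) (simp_all only: qpoch_quotient_Suc finite_atLeastAtMost)
  have "tsum n ?y = Suc (tsum n y)"
  proof -
    have "sum ?y ({1..n} - {k}) = sum y ({1..n} - {k})" by (intro sum.cong) auto
    then show ?thesis using sum.remove[OF _ k, of ?y] sum.remove[OF _ k, of y] by simp
  qed
  then have X: "?X ^ tsum n ?y = ?X ^ tsum n y * ?X" by simp
  have "(w * t) / w0 * (f * r1) * (g * r2) * (h * r3) * (x * r4) = w / w0 * f * g * h * x * (t * r1 * r2 * r3 * r4)"
    for w t w0 f g h x r1 r2 r3 r4 :: complex
    by (simp only: times_divide_eq_left times_divide_eq_right mult_ac)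
  then show ?thesis
    unfolding phi[of ?y] phi[of y] WW F G H X .
qed

section \<open>Sign choices on geometric progressions\<close>

definition chains :: "nat \<Rightarrow> (nat \<Rightarrow> nat) \<Rightarrow> (nat \<times> nat) set" where
  "chains n l = (SIGMA k:{1..n}. {..<l k})"

definition node :: "complex \<Rightarrow> (nat \<Rightarrow> complex) \<Rightarrow> nat \<times> nat \<Rightarrow> complex" where
  "node q z = (\<lambda>(k, r). z k * q ^ r)"

lemma node_simp [simp]: "node q z (k, r) = z k * q ^ r"
  by (simp add: node_def)

lemma finite_chains [simp]: "finite (chains n l)"
  by (simp add: chains_def)

lemma prod_chains: "(\<Prod>i\<in>chains n l. f i) = (\<Prod>k\<in>{1..n}. \<Prod>r<l k. f (k, r))"
  unfolding chains_def by (simp add: prod.Sigma)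

lemma weight_head_inverse:
  fixes q s v b d :: complex
  assumes "s\<^sup>2 = q" "s \<noteq> 0" "v \<noteq> 0" "b \<noteq> 0" "d \<noteq> 0" "q * v\<^sup>2 \<noteq> 1"
  shows "(1 - b / s * inverse (s * v)) * (1 - d / s * inverse (s * v)) / (1 - (inverse (s * v))\<^sup>2)
   = - (b * d / q) * ((1 - q * v / b) * (1 - q * v / d)) * (1 / (1 - q * v\<^sup>2))"
proof -
  have q: "q \<noteq> 0" using assms by auto
  have ss: "s * s = q" using assms(1) by (simp add: power2_eq_square)
  have e1: "(s * v)\<^sup>2 = q * v\<^sup>2"
    using assms(1) by (simp add: power_mult_distrib)
  have e2: "1 - x / s * inverse (s * v) = - (x / (q * v)) * (1 - q * v / x)" if "x \<noteq> 0" for x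
    using assms(2,3) that q by (simp add: ss[symmetric] field_simps)
  have e3: "1 - (inverse (s * v))\<^sup>2 = - (1 - q * v\<^sup>2) / (q * v\<^sup>2)"
    using assms(2,3) q e1 by (simp add: power_inverse field_simps)
  have "- (b / (q * v)) * f * (- (d / (q * v)) * g) / (- e / (q * v\<^sup>2)) = - (b * d / q) * (f * g) * (1 / e)"
    if "e \<noteq> 0" for e f g
    using that assms(3-5) q by (simp add: field_simps power2_eq_square)
  moreover have "1 - q * v\<^sup>2 \<noteq> 0" using assms(6) by simp
  ultimately show ?thesis
    unfolding e2[OF assms(4)] e2[OF assms(5)] e3 by blast
qed

text \<open>The \<open>s\<close> in \<open>b / s\<close> and \<open>d / s\<close> absorbs the one in
  \<open>s * v\<close>, and \<open>1 - q * v\<^sup>2\<close> is common to both signs. The minus sign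
  that remains is compensated later by the pair factors of the own progression.\<close>

lemma weight_ratio_head:
  fixes q s v b d :: complex
  assumes "s\<^sup>2 = q" "s \<noteq> 0" "v \<noteq> 0" "b \<noteq> 0" "d \<noteq> 0"
    and "q * v\<^sup>2 \<noteq> 1" "q * v / b \<noteq> 1" "q * v / d \<noteq> 1"
  shows "((1 - b / s * (s * v)) * (1 - d / s * (s * v)) / (1 - (s * v)\<^sup>2))
     / ((1 - b / s * inverse (s * v)) * (1 - d / s * inverse (s * v)) / (1 - (inverse (s * v))\<^sup>2))
   = - (q / (b * d)) * ((1 - b * v) * (1 - d * v) / ((1 - q * v / b) * (1 - q * v / d)))"
proof -
  have "q \<noteq> 0" using assms by auto
  moreover have "b / s * (s * v) = b * v" "d / s * (s * v) = d * v" "(s * v)\<^sup>2 = q * v\<^sup>2"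
    using assms(1,2) by (simp_all add: power_mult_distrib)
  moreover have "1 - q * v\<^sup>2 \<noteq> 0" "1 - q * v / b \<noteq> 0" "1 - q * v / d \<noteq> 0" using assms by auto
  moreover have "(x / e) / (- (b * d / q) * (f * g) * (1 / e)) = - (q / (b * d)) * (x / (f * g))"
    if "e \<noteq> 0" "f \<noteq> 0" "g \<noteq> 0" "q \<noteq> 0" for x e f g
    using that assms(4,5) by (simp add: field_simps)
  ultimately show ?thesis
    by (simp only: weight_head_inverse[OF assms(1-6)] not_False_eq_True)
qed

text \<open>Along the progression of \<open>c\<close> the quotients telescope and only the two ends
  remain; this is how the length \<open>m\<close> turns into the exponents in \<open>q ^ m\<close>
  and \<open>q powi (1 - int m)\<close>.\<close>

lemma weight_ratio_kernel:
  fixes q s z c :: complex and y m :: nat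
  assumes "s\<^sup>2 = q" "s \<noteq> 0" "z \<noteq> 0" "c \<noteq> 0"
  defines "a \<equiv> s * z * q ^ y"
  assumes V: "\<And>r. r \<le> m \<Longrightarrow> c * z * q ^ (y + r) \<noteq> 1" and X: "\<And>r. r \<le> m \<Longrightarrow> z / c * q ^ Suc y / q ^ r \<noteq> 1"
  shows "(\<Prod>r<m. ((1 - s * (c * q ^ r) * a) * (1 - s * a / (c * q ^ r)) / a)
        / ((1 - s * (c * q ^ r) * inverse a) * (1 - s * inverse a / (c * q ^ r)) / inverse a))
    = inverse (q ^ m) * ((1 - q ^ m * c * z * q ^ y) * (1 - q * z / c * q ^ y)
          / ((1 - c * z * q ^ y) * (1 - q powi (1 - int m) * z / c * q ^ y)))"
proof -
  let ?f = "\<lambda>r. ((1 - s * (c * q ^ r) * a) * (1 - s * a / (c * q ^ r)) / a)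
        / ((1 - s * (c * q ^ r) * inverse a) * (1 - s * inverse a / (c * q ^ r)) / inverse a)"
  have q: "q \<noteq> 0" using assms by auto
  have ss: "s * s = q" using assms(1) by (simp add: power2_eq_square)
  define V' where "V' = (\<lambda>r. 1 - c * z * q ^ (y + r))"
  define X' where "X' = (\<lambda>r. 1 - z / c * q ^ Suc y / q ^ r)"
  have nz: "V' r \<noteq> 0" "X' r \<noteq> 0" if "r \<le> m" for r
    using V[OF that] X[OF that] by (auto simp: V'_def X'_def)
  have "((1 - s * (c * q ^ r) * a) * (1 - s * a / (c * q ^ r)) / a)
        / ((1 - s * (c * q ^ r) * inverse a) * (1 - s * inverse a / (c * q ^ r)) / inverse a)
      = inverse q * (V' (Suc r) / V' r) * (X' r / X' (Suc r))" if "r < m" for r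
  proof -
    define x where "x = z / c * q ^ y / q ^ r"
    define v where "v = c * z * q ^ (y + r)"
    have xv: "x \<noteq> 0" "v \<noteq> 0" using assms(3,4) q by (auto simp: x_def v_def)
    have a0: "a \<noteq> 0" using assms(2,3) q by (simp add: a_def)
    have a2: "a * a = q * (x * v)"
      using assms(3,4) q by (simp add: a_def x_def v_def ss[symmetric] power_add field_simps)
    have e1: "s * (c * q ^ r) * a = v * q"
      by (simp add: a_def v_def ss[symmetric] power_add mult_ac)
    have e2: "s * a / (c * q ^ r) = x * q"
      by (simp add: a_def x_def ss[symmetric] mult_ac)
    have e3: "s * (c * q ^ r) * inverse a = inverse x"
      using assms(2-4) q by (simp add: a_def x_def field_simps)
    have e4: "s * inverse a / (c * q ^ r) = inverse v"
      using assms(2-4) q by (simp add: a_def v_def field_simps power_add)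
    have V'v: "V' r = 1 - v" "V' (Suc r) = 1 - v * q"
      by (simp_all add: V'_def v_def mult_ac)
    have X'x: "X' r = 1 - x * q" "X' (Suc r) = 1 - x"
      using q by (simp_all add: X'_def x_def field_simps)
    have "1 - v \<noteq> 0" "1 - x \<noteq> 0"
      using nz(1)[of r] nz(2)[of "Suc r"] that V'v X'x by auto
    then have n: "1 - inverse v \<noteq> 0" "1 - inverse x \<noteq> 0"
      using xv by (auto simp: field_simps)
    have i: "(1 - inverse x) * (1 - inverse v) = (1 - x) * (1 - v) / (x * v)"
      using xv by (simp add: field_simps)
    have red: "(g / a) / (h / (x * v) / inverse a) = inverse q * (g / h)" for g h
    proof -
      have "(g / a) / (h / (x * v) / inverse a) = g / h * ((x * v) / (a * a))"
        using a0 by (simp add: field_simps)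
      then show ?thesis unfolding a2 using xv q by (simp add: field_simps)
    qed
    show ?thesis
      unfolding e1 e2 e3 e4 i V'v X'x red by (simp add: mult_ac)
  qed
  then have "(\<Prod>r<m. ?f r)
      = (\<Prod>r\<in>{0..<m}. inverse q * (V' (Suc r) / V' r) * (X' r / X' (Suc r)))"
    by (intro prod.cong) (auto simp: lessThan_atLeast0)
  also have "\<dots> = inverse q ^ m * (V' m / V' 0) * (X' 0 / X' m)"
  proof -
    have "(\<Prod>r\<in>{0..<m}. V' (Suc r) / V' r) = V' m / V' 0" "(\<Prod>r\<in>{0..<m}. X' r / X' (Suc r)) = X' 0 / X' m"
      by (rule prod_telescope_ge prod_telescope_ge'; use nz in simp)+
    then show ?thesis by (simp only: prod.distrib prod_constant card_atLeastLessThan diff_zero)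
  qed
  finally have P: "(\<Prod>r<m. ?f r) = \<dots>" .
  have "V' m = 1 - q ^ m * c * z * q ^ y" "V' 0 = 1 - c * z * q ^ y" "X' 0 = 1 - q * z / c * q ^ y"
    by (simp_all add: V'_def X'_def power_add mult_ac)
  moreover have "X' m = 1 - q powi (1 - int m) * z / c * q ^ y"
    using q by (simp add: X'_def power_int_diff field_simps)
  ultimately show ?thesis unfolding P by (simp add: power_inverse)
qed

lemma weight_ratio:
  fixes y :: nat
  assumes g: "generic_params q n p z c b d" and s: "s\<^sup>2 = q" and k: "k \<in> {1..n}"
  defines "a \<equiv> s * z k * q ^ y"
  shows "weight s (b / s) (d / s) (chains p m) (node q c) a / weight s (b / s) (d / s) (chains p m) (node q c) (inverse a)
    = - (q / (b * d)) * ((1 - b * z k * q ^ y) * (1 - d * z k * q ^ y)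
          / ((1 - q * z k / b * q ^ y) * (1 - q * z k / d * q ^ y)))
      * (inverse (q ^ tsum p m) * (\<Prod>j\<in>{1..p}. (1 - q ^ m j * c j * z k * q ^ y) * (1 - q * z k / c j * q ^ y)
          / ((1 - c j * z k * q ^ y) * (1 - q powi (1 - int (m j)) * z k / c j * q ^ y))))"
proof -
  note D = generic_paramsD[OF g]
  have q: "q \<noteq> 0" by (rule D)
  have s0: "s \<noteq> 0" using s q by auto
  have zk: "z k \<noteq> 0" using k by (rule D)
  have free: "q_free q (z k * z k)" "q_free q (z k / b)" "q_free q (z k / d)" using k by (auto intro: D)
  have head: "((1 - b / s * a) * (1 - d / s * a) / (1 - a\<^sup>2))
     / ((1 - b / s * inverse a) * (1 - d / s * inverse a) / (1 - (inverse a)\<^sup>2))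
   = - (q / (b * d)) * ((1 - b * z k * q ^ y) * (1 - d * z k * q ^ y)
          / ((1 - q * z k / b * q ^ y) * (1 - q * z k / d * q ^ y)))"
  proof -
    have "a = s * (z k * q ^ y)" by (simp add: a_def)
    moreover have "q * (z k * q ^ y)\<^sup>2 \<noteq> 1"
      using q_free_ne1'(2)[OF q free(1), of "Suc (y + y)"] by (simp add: power_add power2_eq_square mult_ac)
    moreover have "q * (z k * q ^ y) / b \<noteq> 1"
      using q_free_ne1'(2)[OF q free(2), of "Suc y"] by (simp add: mult_ac)
    moreover have "q * (z k * q ^ y) / d \<noteq> 1"
      using q_free_ne1'(2)[OF q free(3), of "Suc y"] by (simp add: mult_ac)
    ultimately show ?thesis
      using weight_ratio_head[OF s s0, of "z k * q ^ y" b d] zk q D(3,4) by (simp add: mult.assoc)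
  qed
  have tail: "(\<Prod>r<m j. ((1 - s * node q c (j, r) * a) * (1 - s * a / node q c (j, r)) / a)
        / ((1 - s * node q c (j, r) * inverse a) * (1 - s * inverse a / node q c (j, r)) / inverse a))
    = inverse (q ^ m j) * ((1 - q ^ m j * c j * z k * q ^ y) * (1 - q * z k / c j * q ^ y)
          / ((1 - c j * z k * q ^ y) * (1 - q powi (1 - int (m j)) * z k / c j * q ^ y)))"
    if j: "j \<in> {1..p}" for j
    unfolding node_simp a_def
  proof (rule weight_ratio_kernel[OF s s0 zk])
    show "c j \<noteq> 0" using j by (rule D)
    show "c j * z k * q ^ (y + r) \<noteq> 1" for r
      using q_free_ne1'(2)[OF q D(12)[OF k j]] .
    show "z k / c j * q ^ Suc y / q ^ r \<noteq> 1" for r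
      using q_free_ne1[OF q q_free_inverse[OF D(13)[OF k j]], of "Suc y" r] by simp
  qed
  have "(\<Prod>i\<in>chains p m. ((1 - s * node q c i * a) * (1 - s * a / node q c i) / a)
        / ((1 - s * node q c i * inverse a) * (1 - s * inverse a / node q c i) / inverse a))
    = (\<Prod>j\<in>{1..p}. inverse (q ^ m j) * ((1 - q ^ m j * c j * z k * q ^ y) * (1 - q * z k / c j * q ^ y)
          / ((1 - c j * z k * q ^ y) * (1 - q powi (1 - int (m j)) * z k / c j * q ^ y))))"
    unfolding prod_chains by (intro prod.cong refl tail)
  also have "\<dots> = inverse (q ^ tsum p m) * (\<Prod>j\<in>{1..p}. (1 - q ^ m j * c j * z k * q ^ y) * (1 - q * z k / c j * q ^ y)
          / ((1 - c j * z k * q ^ y) * (1 - q powi (1 - int (m j)) * z k / c j * q ^ y)))"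
  proof -
    have "(\<Prod>j\<in>{1..p}. inverse (q ^ m j)) = inverse (q ^ tsum p m)"
      by (simp add: power_sum prod_inversef[symmetric] comp_def)
    then show ?thesis by (simp only: prod.distrib)
  qed
  finally have T: "(\<Prod>i\<in>chains p m. ((1 - s * node q c i * a) * (1 - s * a / node q c i) / a)
        / ((1 - s * node q c i * inverse a) * (1 - s * inverse a / node q c i) / inverse a)) = \<dots>" .
  have split: "(h * t) / (h' * t') = (h / h') * (t / t')" for h t h' t' :: complex
    by simp
  have "weight s (b / s) (d / s) (chains p m) (node q c) a / weight s (b / s) (d / s) (chains p m) (node q c) (inverse a)
    = ((1 - b / s * a) * (1 - d / s * a) / (1 - a\<^sup>2))
       / ((1 - b / s * inverse a) * (1 - d / s * inverse a) / (1 - (inverse a)\<^sup>2))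
      * (\<Prod>i\<in>chains p m. ((1 - s * node q c i * a) * (1 - s * a / node q c i) / a)
        / ((1 - s * node q c i * inverse a) * (1 - s * inverse a / node q c i) / inverse a))"
    unfolding weight_def prod_dividef[of "\<lambda>i. (1 - s * node q c i * a) * (1 - s * a / node q c i) / a"]
    by (rule split)
  then show ?thesis unfolding head T .
qed

text \<open>Raising \<open>y k\<close> by one changes the sign of a single node. Its weight yields
  the factors with \<open>b\<close>, \<open>d\<close> and \<open>c\<close>; the pair factors along
  each progression yield those of \<open>W\<close> and those with \<open>l\<close>.\<close>

lemma summand_flip_step:
  assumes g: "generic_params q n p z c b d" and s: "s\<^sup>2 = q" and k: "k \<in> {1..n}"
    and y: "y k < l k" "\<And>j. j \<in> {1..n} \<Longrightarrow> y j \<le> l j"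
  defines "a \<equiv> node q (\<lambda>k. s * z k)"
  shows "summand s (b / s) (d / s) (chains n l) (chains p m) (node q c) (flip a (chains n (y(k := Suc (y k)))))
    = summand s (b / s) (d / s) (chains n l) (chains p m) (node q c) (flip a (chains n y)) *
    ((1 - (z k * q ^ Suc (y k))\<^sup>2) / (1 - (z k * q ^ y k)\<^sup>2)
      * (\<Prod>j\<in>{1..n}-{k}. (1 - z k * q ^ Suc (y k) * (z j * q ^ y j)) * (z k * q ^ Suc (y k) - z j * q ^ y j)
          / ((1 - z k * q ^ y k * (z j * q ^ y j)) * (z k * q ^ y k - z j * q ^ y j)))
      * (\<Prod>j\<in>{1..p}. (1 - q ^ m j * c j * z k * q ^ y k) * (1 - q * z k / c j * q ^ y k)
          / ((1 - c j * z k * q ^ y k) * (1 - q powi (1 - int (m j)) * z k / c j * q ^ y k)))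
      * (\<Prod>j\<in>{1..n}. (1 - z j * z k * q ^ y k) * (1 - q powi (- int (l j)) * z k / z j * q ^ y k)
          / ((1 - q * z k / z j * q ^ y k) * (1 - q ^ (1 + l j) * z j * z k * q ^ y k)))
      * ((1 - b * z k * q ^ y k) * (1 - d * z k * q ^ y k)
          / ((1 - q * z k / b * q ^ y k) * (1 - q * z k / d * q ^ y k)))
      * (q powi (1 - int (tsum p m) + int (tsum n l)) / (b * d)))"
    (is "_ = _ * (?Wd * ?WW * ?Cf * ?G * ?B * ?X)")
proof -
  let ?T = "summand s (b / s) (d / s) (chains n l) (chains p m) (node q c)"
  note D = generic_paramsD[OF g]
  have q: "q \<noteq> 0" by (rule D)
  have s0: "s \<noteq> 0" using s q by auto
  have zk: "z k \<noteq> 0" using k by (rule D)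
  have Fnz: "1 - z k / z j * q ^ e / q ^ f \<noteq> 0" if "j \<in> {1..n}" "j \<noteq> k" for j e f
    using q_free_ne1[OF q D(9)[OF k that(1)], of e f] that(2) by auto
  have Unz: "1 - z k * z j * q ^ e \<noteq> 0" if "j \<in> {1..n}" for j e
    using q_free_ne1'(2)[OF q D(8)[OF k that], of e] by auto
  have qnz: "1 - q ^ i / q ^ j \<noteq> 0" if "i \<noteq> j" for i j
  proof (cases "i < j")
    case True
    then have "q ^ j = q ^ i * q ^ (j - i)" by (simp flip: power_add)
    then show ?thesis using D(2)[of "j - i"] True q by simp
  next
    case False
    then have "q ^ i = q ^ j * q ^ (i - j)" by (simp flip: power_add)
    then show ?thesis using D(2)[of "i - j"] False that q by simp
  qed
  define i where "i = (k, y k)"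
  define I where "I = chains n l - {i}"
  have I: "chains n l = insert i I" "finite I" "i \<notin> I"
    using k y(1) by (auto simp: I_def i_def chains_def)
  define A where "A = flip a (chains n y)"
  have ai: "a i = s * z k * q ^ y k" by (simp add: a_def i_def)
  \<comment> \<open>The node \<open>(k, y k)\<close> is the first inverted one of its progression,
    so \<open>A\<close> already carries the inverse there.\<close>
  have Ai: "A = A(i := inverse (a i))"
    by (auto simp: A_def i_def flip_def chains_def)
  have A': "flip a (chains n (y(k := Suc (y k)))) = A(i := a i)"
    using k by (auto simp: A_def i_def flip_def chains_def fun_eq_iff split: if_splits)
  have Alow: "A (j, t) = s * z j * q ^ t" if "j \<in> {1..n}" "t < y j" for j t
    using that by (simp add: A_def flip_def chains_def a_def)
  have Ahigh: "A (j, t) = inverse (s * z j * q ^ t)" if "y j \<le> t" for j t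
    using that by (simp add: A_def flip_def chains_def a_def)
  let ?R = "\<lambda>x. hfac q (s * z k * q ^ y k * x) / hfac q (inverse (s * z k * q ^ y k) * x)"
  let ?WWj = "\<lambda>j. (1 - z k * q ^ Suc (y k) * (z j * q ^ y j)) * (z k * q ^ Suc (y k) - z j * q ^ y j)
          / ((1 - z k * q ^ y k * (z j * q ^ y j)) * (z k * q ^ y k - z j * q ^ y j))"
  let ?Gj = "\<lambda>j. (1 - z j * z k * q ^ y k) * (1 - q powi (- int (l j)) * z k / z j * q ^ y k)
          / ((1 - q * z k / z j * q ^ y k) * (1 - q ^ (1 + l j) * z j * z k * q ^ y k))"
  have F0: "1 - z k / z j * q ^ Suc (y k) / q ^ 0 = 1 - q * z k / z j * q ^ y k" for j
    by simp
  have FL: "1 - z k / z j * q ^ Suc (y k) / q ^ Suc (l j) = 1 - q powi (- int (l j)) * z k / z j * q ^ y k" for j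
    using q by (simp add: power_int_minus field_simps)
  have U0: "1 - z k * z j * q ^ (y k + 0) = 1 - z j * z k * q ^ y k" for j
    by (simp add: mult_ac)
  have UL: "1 - z k * z j * q ^ (y k + Suc (l j)) = 1 - q ^ (1 + l j) * z j * z k * q ^ y k" for j
    by (simp add: power_add mult_ac)
  have other: "(\<Prod>t<l j. ?R (A (j, t))) = q ^ l j * (?WWj j * ?Gj j)" "(\<Prod>t<l j. ?R (A (j, t))) \<noteq> 0"
    if j: "j \<in> {1..n}" "j \<noteq> k" for j
  proof -
    have zj: "z j \<noteq> 0" using j(1) by (rule D)
    let ?U = "\<lambda>t. 1 - z k * z j * q ^ (y k + t)" and ?F = "\<lambda>t. 1 - z k / z j * q ^ Suc (y k) / q ^ t"
    have "{..<l j} = {..<y j} \<union> {y j..<l j}" using y(2)[OF j(1)] by auto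
    then have 1: "(\<Prod>t<l j. ?R (A (j, t))) = q ^ (l j - (y j - y j)) * (?U 0 * ?U (Suc (y j)) * (?F (y j) * ?F (Suc (l j))))
       / (?U (y j) * ?U (Suc (l j)) * (?F 0 * ?F (Suc (y j))))"
      by (simp only:, intro hfac_ratio_chain[OF s s0 zk zj] Alow Ahigh j(1) y(2) order_refl Unz Fnz j) auto
    then show "(\<Prod>t<l j. ?R (A (j, t))) \<noteq> 0"
      by (simp only: divide_eq_0_iff mult_eq_0_iff power_eq_0_iff q Unz[OF j(1)] Fnz[OF j] simp_thms not_False_eq_True)
    have 2: "z k * q ^ Suc (y k) - z j * q ^ y j = - (z j * q ^ y j) * ?F (y j)"
      "z k * q ^ y k - z j * q ^ y j = - (z j * q ^ y j) * ?F (Suc (y j))"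
      using zj q by (simp_all add: field_simps)
    have 3: "1 - z k * q ^ Suc (y k) * (z j * q ^ y j) = ?U (Suc (y j))"
      "1 - z k * q ^ y k * (z j * q ^ y j) = ?U (y j)"
      by (simp_all add: power_add mult_ac)
    have "x * (w * f) / (x' * (w * f')) = x * f / (x' * f')" if "w \<noteq> 0" for x w f x' f' :: complex
      using that by simp
    then have WWj: "?WWj j = ?U (Suc (y j)) * ?F (y j) / (?U (y j) * ?F (Suc (y j)))"
      unfolding 2 3 using zj q by simp
    then show "(\<Prod>t<l j. ?R (A (j, t))) = q ^ l j * (?WWj j * ?Gj j)"
    proof -
      have "p * (u0 * u1 * (f * fL)) / (u * uL * (f0 * f1)) = p * (u1 * f / (u * f1) * (u0 * fL / (f0 * uL)))"
        for p u0 u1 f fL u uL f0 f1 :: complex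
        by (simp add: mult_ac)
      then show ?thesis unfolding 1 WWj F0 FL U0 UL diff_self_eq_0 diff_zero .
    qed
  qed
  have own: "(\<Prod>t\<in>{..<y k} \<union> {Suc (y k)..<l k}. ?R (A (k, t))) = - (q ^ l k) * (?Wd * ?Gj k)"
    "(\<Prod>t\<in>{..<y k} \<union> {Suc (y k)..<l k}. ?R (A (k, t))) \<noteq> 0"
  proof -
    let ?U = "\<lambda>t. 1 - z k * z k * q ^ (y k + t)" and ?F = "\<lambda>t. 1 - z k / z k * q ^ Suc (y k) / q ^ t"
    have Fnz': "?F t \<noteq> 0" if "t \<le> y k \<or> Suc (Suc (y k)) \<le> t" for t
      using qnz[of "Suc (y k)" t] that zk by auto
    have 1: "(\<Prod>t\<in>{..<y k} \<union> {Suc (y k)..<l k}. ?R (A (k, t)))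
      = q ^ (l k - (Suc (y k) - y k)) * (?U 0 * ?U (Suc (Suc (y k))) * (?F (y k) * ?F (Suc (l k))))
       / (?U (y k) * ?U (Suc (l k)) * (?F 0 * ?F (Suc (Suc (y k)))))"
      using y(1) by (intro hfac_ratio_chain[OF s s0 zk zk] Alow Ahigh k Unz Fnz') auto
    then show "(\<Prod>t\<in>{..<y k} \<union> {Suc (y k)..<l k}. ?R (A (k, t))) \<noteq> 0"
    proof -
      have "?F (y k) \<noteq> 0" "?F (Suc (l k)) \<noteq> 0" "?F 0 \<noteq> 0" "?F (Suc (Suc (y k))) \<noteq> 0"
        by (rule Fnz', use y(1) in simp)+
      then show ?thesis
        unfolding 1 by (simp only: divide_eq_0_iff mult_eq_0_iff power_eq_0_iff q Unz[OF k] simp_thms not_False_eq_True)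
    qed
    \<comment> \<open>This is \<open>1 - q = - q * (1 - 1 / q)\<close>. It supplies the minus sign
      and the power of \<open>q\<close> that is missing because only \<open>l k - 1\<close> nodes of
      the own progression take part.\<close>
    have 2: "?F (y k) = - q * ?F (Suc (Suc (y k)))"
      using zk q by (simp add: field_simps)
    have 3: "q ^ l k = q ^ (l k - (Suc (y k) - y k)) * q"
      using y(1) by (cases "l k") (simp_all add: Suc_diff_le mult.commute)
    have 4: "?Wd = ?U (Suc (Suc (y k))) / ?U (y k)"
      by (simp add: power_add power2_eq_square mult_ac)
    have "p * (u * u' * ((- q * f) * h)) / (v * v' * (w * f)) = - (p * q) * (u' / v * (u * h / (w * v')))"
      if "f \<noteq> 0" for p u u' f h v v' w :: complex
      using that by (simp add: mult_ac)
    moreover have "?F (Suc (Suc (y k))) \<noteq> 0" by (rule Fnz') simp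
    ultimately
    show "(\<Prod>t\<in>{..<y k} \<union> {Suc (y k)..<l k}. ?R (A (k, t))) = - (q ^ l k) * (?Wd * ?Gj k)"
      unfolding 1 2 3 4 F0 FL U0 UL by blast
  qed
  have "I = (SIGMA j:{1..n}. if j = k then {..<y k} \<union> {Suc (y k)..<l k} else {..<l j})"
    using y(1) by (auto simp: I_def i_def chains_def split: if_splits)
  then have "(\<Prod>j\<in>I. ?R (A j)) = (\<Prod>j\<in>{1..n}. \<Prod>t\<in>(if j = k then {..<y k} \<union> {Suc (y k)..<l k} else {..<l j}). ?R (A (j, t)))"
    by (simp add: prod.Sigma)
  also have "\<dots> = (\<Prod>t\<in>{..<y k} \<union> {Suc (y k)..<l k}. ?R (A (k, t))) * (\<Prod>j\<in>{1..n}-{k}. \<Prod>t<l j. ?R (A (j, t)))"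
    by (subst prod.remove[OF _ k]) (auto intro!: arg_cong2[where f = times] prod.cong)
  finally have PI: "(\<Prod>j\<in>I. ?R (A j)) = \<dots>" .
  then have "(\<Prod>j\<in>I. ?R (A j)) \<noteq> 0"
    using own(2) other(2) by simp
  \<comment> \<open>Division by 0 yields 0, so a non-zero product of quotients forces its
    denominators to be non-zero.\<close>
  then have hnz: "(\<Prod>j\<in>I. hfac q (inverse (a i) * A j)) \<noteq> 0"
    using I(2) unfolding ai by auto
  have PI': "(\<Prod>j\<in>I. ?R (A j)) = - (q ^ tsum n l) * (?Wd * ?WW * ?G)"
  proof -
    have "(\<Prod>j\<in>{1..n}-{k}. \<Prod>t<l j. ?R (A (j, t))) = (\<Prod>j\<in>{1..n}-{k}. q ^ l j * (?WWj j * ?Gj j))"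
      by (intro prod.cong refl other(1)) auto
    also have "\<dots> = (\<Prod>j\<in>{1..n}-{k}. q ^ l j) * (?WW * (\<Prod>j\<in>{1..n}-{k}. ?Gj j))"
      by (simp only: prod.distrib)
    finally have others: "(\<Prod>j\<in>{1..n}-{k}. \<Prod>t<l j. ?R (A (j, t)))
      = (\<Prod>j\<in>{1..n}-{k}. q ^ l j) * (?WW * (\<Prod>j\<in>{1..n}-{k}. ?Gj j))" .
    have "- u * (wd * g) * (v * (ww * h)) = - (u * v) * (wd * ww * (g * h))" for u wd g v ww h :: complex
      by simp
    then have "(\<Prod>j\<in>I. ?R (A j)) = - (q ^ l k * (\<Prod>j\<in>{1..n}-{k}. q ^ l j)) * (?Wd * ?WW * (?Gj k * (\<Prod>j\<in>{1..n}-{k}. ?Gj j)))"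
      unfolding PI own(1) others .
    also have "q ^ l k * (\<Prod>j\<in>{1..n}-{k}. q ^ l j) = q ^ tsum n l"
      by (subst prod.remove[OF _ k, symmetric]) (simp_all add: power_sum)
    also have "?Gj k * (\<Prod>j\<in>{1..n}-{k}. ?Gj j) = ?G"
      by (subst prod.remove[OF _ k, symmetric]) simp_all
    finally show ?thesis .
  qed
  let ?w = "weight s (b / s) (d / s) (chains p m) (node q c)"
  have w: "?w (a i) / ?w (inverse (a i)) = - (q / (b * d)) * ?B * (inverse (q ^ tsum p m) * ?Cf)"
    unfolding ai by (rule weight_ratio[OF g s k])
  \<comment> \<open>The same device: it is enough that the known value of the quotient of weights is
    not 0.\<close>
  have wnz: "?w (inverse (a i)) \<noteq> 0"
  proof -
    have ne: "1 - x * q ^ e / q ^ f \<noteq> 0" if "q_free q x" for x e f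
      using q_free_ne1[OF q that, of e f] by simp
    have "1 - b * z k * q ^ y k \<noteq> 0" "1 - d * z k * q ^ y k \<noteq> 0"
      using ne[OF D(14)[OF k], of "y k" 0] ne[OF D(16)[OF k], of "y k" 0] by simp_all
    moreover have "1 - q * z k / b * q ^ y k \<noteq> 0" "1 - q * z k / d * q ^ y k \<noteq> 0"
      using ne[OF D(15)[OF k], of "Suc (y k)" 0] ne[OF D(17)[OF k], of "Suc (y k)" 0]
      by (simp_all add: mult_ac)
    ultimately have "?B \<noteq> 0" by simp
    moreover have "?Cf \<noteq> 0"
    proof -
      have "1 - q ^ m j * c j * z k * q ^ y k \<noteq> 0" "1 - c j * z k * q ^ y k \<noteq> 0"
        "1 - q * z k / c j * q ^ y k \<noteq> 0" "1 - q powi (1 - int (m j)) * z k / c j * q ^ y k \<noteq> 0"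
        if j: "j \<in> {1..p}" for j
      proof -
        note free = D(12)[OF k j] q_free_inverse[OF D(13)[OF k j]]
        show "1 - q ^ m j * c j * z k * q ^ y k \<noteq> 0" "1 - c j * z k * q ^ y k \<noteq> 0"
          using ne[OF free(1), of "m j + y k" 0] ne[OF free(1), of "y k" 0] by (simp_all add: power_add mult_ac)
        show "1 - q * z k / c j * q ^ y k \<noteq> 0" "1 - q powi (1 - int (m j)) * z k / c j * q ^ y k \<noteq> 0"
          using ne[OF free(2), of "Suc (y k)" 0] ne[OF free(2), of "Suc (y k)" "m j"] q
          by (simp_all add: power_int_diff mult_ac)
      qed
      then show ?thesis by (simp only: prod_zero_iff finite_atLeastAtMost divide_eq_0_iff mult_eq_0_iff) blast
    qed
    ultimately have "?w (a i) / ?w (inverse (a i)) \<noteq> 0" unfolding w using q D(3,4) by simp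
    then show ?thesis by auto
  qed
  \<comment> \<open>The argument of the power series collects the constants of the heads, of the
    kernel factors and of the pair factors; the two minus signs cancel.\<close>
  have X: "?X = - (q / (b * d)) * inverse (q ^ tsum p m) * (- (q ^ tsum n l))"
  proof -
    have pw: "q powi (1 - int M + int N) = q * q ^ N / q ^ M" for M N
      using q by (simp add: power_int_add power_int_diff)
    show ?thesis unfolding pw by (simp add: divide_inverse mult_ac)
  qed
  let ?S = "summand s (b / s) (d / s) I (chains p m) (node q c) A"
  have "?T (A(i := a i))
     = ?w (a i) * (\<Prod>j\<in>I. hfac q (a i * A j)) * ?S"
    unfolding I(1) by (simp only: summand_fun_upd[OF I(2,3)] s)
  also have "\<dots> = (?w (inverse (a i)) * (\<Prod>j\<in>I. hfac q (inverse (a i) * A j)) * ?S)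
      * ((?w (a i) / ?w (inverse (a i))) * ((\<Prod>j\<in>I. hfac q (a i * A j)) / (\<Prod>j\<in>I. hfac q (inverse (a i) * A j))))"
    using wnz hnz by simp
  also have "?w (inverse (a i)) * (\<Prod>j\<in>I. hfac q (inverse (a i) * A j)) * ?S
      = ?T (A(i := inverse (a i)))"
    unfolding I(1) by (simp only: summand_fun_upd[OF I(2,3)] s)
  also have "(\<Prod>j\<in>I. hfac q (a i * A j)) / (\<Prod>j\<in>I. hfac q (inverse (a i) * A j)) = (\<Prod>j\<in>I. ?R (A j))"
    unfolding ai by (simp add: prod_dividef)
  finally have "?T (A(i := a i))
    = ?T A
      * (- (q / (b * d)) * ?B * (inverse (q ^ tsum p m) * ?Cf) * (- (q ^ tsum n l) * (?Wd * ?WW * ?G)))"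
    unfolding Ai[symmetric] w PI' .
  also have "u * b * (v * cf) * (w * (wd * ww * g)) = wd * ww * cf * g * b * (u * v * w)" for u b v cf w wd ww g :: complex
    by (simp only: mult_ac)
  finally show ?thesis
    unfolding A' A_def[symmetric] X .
qed

lemma generic_W_ne0:
  assumes "generic_params q n p z c b d"
  shows "W n z \<noteq> 0"
proof -
  have "pairprod {1..n} (\<lambda>i j. (1 - z i * z j) * (z i - z j)) \<noteq> 0"
  proof (rule pairprod_ne0)
    fix i j assume ij: "i \<in> {1..n}" "j \<in> {1..n}" "i < j"
    then show "(1 - z i * z j) * (z i - z j) \<noteq> 0"
      using generic_params_shifted(2,3)[OF assms ij(1,2), of 0 0] by simp
  qed simp
  then show ?thesis
    unfolding W_eq_pairprod using generic_params_shifted(1)[OF assms, of _ 0] by simp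
qed

lemma phi_term_zero:
  assumes "W n z \<noteq> 0" "\<And>k. k \<in> {1..n} \<Longrightarrow> y k = 0"
  shows "phi_term q n p l m z c b d y = 1"
proof -
  have "W n (\<lambda>k. z k * q ^ y k) = W n z"
    unfolding W_eq_pairprod using assms(2)
    by (intro arg_cong2[where f = times] prod.cong pairprod_cong) auto
  then show ?thesis
    unfolding phi_term_def using assms by (simp cong: prod.cong_simp)
qed

text \<open>Induction by unit steps from the zero index, where no node is chosen and the term of the
  series is 1; at each step both sides acquire the same quotient.\<close>

lemma summand_flip_chains:
  assumes g: "generic_params q n p z c b d" and s: "s\<^sup>2 = q" and y: "y \<in> index_box n l"
  shows "summand s (b / s) (d / s) (chains n l) (chains p m) (node q c) (flip (node q (\<lambda>k. s * z k)) (chains n y))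
    = summand s (b / s) (d / s) (chains n l) (chains p m) (node q c) (flip (node q (\<lambda>k. s * z k)) {})
      * phi_term q n p l m z c b d y"
  using y
proof (induction "tsum n y" arbitrary: y)
  case 0
  then have "y k = 0" if "k \<in> {1..n}" for k using that by simp
  moreover from this have "chains n y = {}" by (auto simp: chains_def)
  ultimately show ?case using phi_term_zero[OF generic_W_ne0[OF g]] by simp
next
  case (Suc N)
  have "tsum n y \<noteq> 0" using Suc.hyps(2) by linarith
  then obtain k where k: "k \<in> {1..n}" "y k \<noteq> 0" by (auto elim: sum.not_neutral_contains_not_neutral)
  define x where "x = y(k := y k - 1)"
  have y: "y = x(k := Suc (x k))" using k(2) by (auto simp: x_def)
  have yl: "y j \<le> l j" if "j \<in> {1..n}" for j
    using Suc.prems that by (auto simp: index_box_def PiE_def Pi_def)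
  have box: "x \<in> index_box n l"
    using Suc.prems k yl[OF k(1)] unfolding index_box_def x_def by (auto simp: PiE_def Pi_def extensional_def)
  have "tsum n y = Suc (tsum n x)"
  proof -
    have "sum y ({1..n} - {k}) = sum x ({1..n} - {k})" unfolding x_def by (intro sum.cong) auto
    then show ?thesis using sum.remove[OF _ k(1), of x] sum.remove[OF _ k(1), of y] k(2) by (simp add: x_def)
  qed
  then have IH: "summand s (b / s) (d / s) (chains n l) (chains p m) (node q c) (flip (node q (\<lambda>k. s * z k)) (chains n x))
    = summand s (b / s) (d / s) (chains n l) (chains p m) (node q c) (flip (node q (\<lambda>k. s * z k)) {})
      * phi_term q n p l m z c b d x"
    using Suc.hyps box by simp
  have xl: "x k < l k" "x j \<le> l j" if "j \<in> {1..n}" for j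
    using yl[OF that] yl[OF k(1)] k(2) by (auto simp: x_def)
  show ?case
    unfolding y
    by (subst summand_flip_step[where y = x and l = l, OF g s k(1) xl(1)[OF k(1)]], rule xl(2), assumption,
        unfold phi_term_step[OF g k(1)] IH, simp only: mult.assoc)
qed

text \<open>Two adjacent nodes of a chain with these signs have product \<open>q\<close>, where the pair factor vanishes.
  The surviving sign choices are the initial segments of the chains, that is, the multi-indices.\<close>

lemma summand_not_initial:
  assumes s: "s\<^sup>2 = q" "s \<noteq> 0" and z: "z k \<noteq> 0"
    and "(k, r) \<in> chains n l" "(k, Suc r) \<in> chains n l" "(k, r) \<notin> S" "(k, Suc r) \<in> S"
  shows "summand s \<beta> \<delta> (chains n l) J C (flip (node q (\<lambda>k. s * z k)) S) = 0"
proof -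
  let ?A = "flip (node q (\<lambda>k. s * z k)) S"
  have q: "q \<noteq> 0" using s by auto
  have "?A (k, r) * ?A (k, Suc r) = q"
    using assms(2,3,6,7) q by (simp add: flip_def field_simps)
  then have "hfac (s\<^sup>2) (?A (k, r) * ?A (k, Suc r)) = 0"
    using q s by (simp add: hfac_def)
  then have "(\<Prod>j\<in>{j\<in>chains n l. (k, r) < j}. hfac (s\<^sup>2) (?A (k, r) * ?A j)) = 0"
    using assms(5) by (intro prod_zero bexI[of _ "(k, Suc r)"]) auto
  then have "pairprod (chains n l) (\<lambda>i j. hfac (s\<^sup>2) (?A i * ?A j)) = 0"
    unfolding pairprod_def by (intro prod_zero[OF finite_chains] bexI[OF _ assms(4)])
  then show ?thesis by (simp add: summand_def)
qed

theorem signsum_chains: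
  assumes g: "generic_params q n p z c b d" and s: "s\<^sup>2 = q"
  shows "signsum s (b / s) (d / s) (chains n l) (node q (\<lambda>k. s * z k)) (chains p m) (node q c)
    = summand s (b / s) (d / s) (chains n l) (chains p m) (node q c) (flip (node q (\<lambda>k. s * z k)) {})
      * (\<Sum>y\<in>index_box n l. phi_term q n p l m z c b d y)"
proof -
  let ?f = "\<lambda>S. summand s (b / s) (d / s) (chains n l) (chains p m) (node q c) (flip (node q (\<lambda>k. s * z k)) S)"
  note D = generic_paramsD[OF g]
  have s0: "s \<noteq> 0" using D(1) s by auto
  have box: "y j \<le> l j" if "y \<in> index_box n l" "j \<in> {1..n}" for y j
    using that by (auto simp: index_box_def PiE_def Pi_def)
  have sub: "chains n ` index_box n l \<subseteq> Pow (chains n l)"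
  proof (intro image_subsetI PowI subsetI)
    fix y x assume "y \<in> index_box n l" "x \<in> chains n y"
    then show "x \<in> chains n l"
      using box[of y "fst x"] by (auto simp: chains_def)
  qed
  have "?f S = 0" if S: "S \<in> Pow (chains n l) - chains n ` index_box n l" for S
  proof (rule ccontr)
    assume nz: "?f S \<noteq> 0"
    have "S \<subseteq> chains n l" using S by blast
    then have Sub: "k \<in> {1..n}" "r < l k" if "(k, r) \<in> S" for k r
      using subsetD[OF _ that] unfolding chains_def by blast+
    have down: "(k, r) \<in> S" if "(k, Suc r) \<in> S" for k r
    proof (rule ccontr)
      assume "(k, r) \<notin> S"
      then have "?f S = 0"
        using Sub[OF that] that by (intro summand_not_initial[OF s s0 D(6)]) (auto simp: chains_def)
      then show False using nz by simp
    qed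
    have down': "(k, r) \<in> S" if "(k, r + e) \<in> S" for k r e
      using that by (induction e) (auto dest: down)
    \<comment> \<open>A missing position exists, since \<open>(k, l k)\<close> is never in
      \<open>S\<close>, and by downward closure the least one is the length of the segment. Outside
      \<open>{1..n}\<close> the restriction supplies the value \<open>undefined\<close> that
      \<open>index_box\<close> demands.\<close>
    define y where "y = restrict (\<lambda>k. LEAST r. (k, r) \<notin> S) {1..n}"
    have yS: "(k, r) \<in> S \<longleftrightarrow> r < y k" if k: "k \<in> {1..n}" for k r
    proof -
      have ex: "(k, l k) \<notin> S" using Sub(2)[of k "l k"] by auto
      have yk: "y k = (LEAST r. (k, r) \<notin> S)" using k by (simp add: y_def)
      have "(k, y k) \<notin> S" unfolding yk by (rule LeastI, rule ex)
      moreover have "(k, r) \<in> S" if "r < y k" using not_less_Least that unfolding yk by blast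
      moreover have "(k, r) \<notin> S" if "\<not> r < y k"
        using down'[of k "y k" "r - y k"] that \<open>(k, y k) \<notin> S\<close> by auto
      ultimately show ?thesis by blast
    qed
    have "x \<in> S \<longleftrightarrow> x \<in> chains n y" for x
    proof (cases x)
      case (Pair k r)
      show ?thesis
        unfolding Pair chains_def mem_Sigma_iff lessThan_iff using yS Sub(1) by blast
    qed
    then have "S = chains n y" by blast
    moreover have "y \<in> index_box n l"
    proof -
      have "y k \<le> l k" if "k \<in> {1..n}" for k
        using yS[OF that, of "l k"] Sub(2)[of k "l k"] by auto
      moreover have "y k = undefined" if "k \<notin> {1..n}" for k
        unfolding y_def using that by (rule restrict_apply[THEN trans, OF if_not_P])
      ultimately show ?thesis unfolding index_box_def by (intro PiE_I) simp_all
    qed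
    ultimately show False using S by blast
  qed
  then have "(\<Sum>S\<in>chains n ` index_box n l. ?f S) = (\<Sum>S\<in>Pow (chains n l). ?f S)"
    by (intro sum.mono_neutral_left[OF _ sub] ballI) simp_all
  moreover have "inj_on (chains n) (index_box n l)"
    proof (rule inj_onI)
      fix x y assume xy: "x \<in> index_box n l" "y \<in> index_box n l" "chains n x = chains n y"
      have "x k = y k" if k: "k \<in> {1..n}" for k
      proof -
        have "r < x k \<longleftrightarrow> r < y k" for r
          using xy(3) k by (auto simp: chains_def set_eq_iff)
        from this[of "x k"] this[of "y k"] show ?thesis by auto
      qed
      then show "x = y"
        using xy(1,2) unfolding index_box_def by (intro PiE_ext) auto
    qed
  then have "(\<Sum>S\<in>chains n ` index_box n l. ?f S) = (\<Sum>y\<in>index_box n l. ?f (chains n y))"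
    by (rule sum.reindex[unfolded comp_def])
  ultimately have "(\<Sum>S\<in>Pow (chains n l). ?f S) = (\<Sum>y\<in>index_box n l. ?f (chains n y))"
    by metis
  also have "\<dots> = (\<Sum>y\<in>index_box n l. ?f {} * phi_term q n p l m z c b d y)"
    by (intro sum.cong refl summand_flip_chains[OF g s])
  finally show ?thesis
    unfolding signsum_def by (simp add: sum_distrib_left)
qed

section \<open>The term with all signs inverted\<close>

lemma q_power_ne:
  assumes "q \<noteq> 0" "\<And>i::nat. i > 0 \<Longrightarrow> q ^ i \<noteq> (1::complex)" "i \<noteq> j"
  shows "q ^ i \<noteq> q ^ j"
proof -
  have *: "q ^ i \<noteq> q ^ j" if "i < j" for i j
  proof -
    have "q ^ j = q ^ i * q ^ (j - i)" using that by (simp flip: power_add)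
    then show ?thesis using assms(1) assms(2)[of "j - i"] that by simp
  qed
  show ?thesis using *[of i j] *[of j i] assms(3) by (cases "i < j") auto
qed

text \<open>Nodes of one progression are separated because \<open>q\<close> is not a root of unity,
  nodes of different progressions by the conditions on \<open>w j / w k\<close>; products equal to 1
  are excluded by those on \<open>w j * w k\<close>.\<close>

lemma generic_points_node:
  assumes q: "q \<noteq> 0" "\<And>i::nat. i > 0 \<Longrightarrow> q ^ i \<noteq> 1"
    and w: "\<And>k. k \<in> {1..n} \<Longrightarrow> w k \<noteq> 0" "\<And>j k. j \<in> {1..n} \<Longrightarrow> k \<in> {1..n} \<Longrightarrow> q_free q (w j * w k)"
      "\<And>j k. j \<in> {1..n} \<Longrightarrow> k \<in> {1..n} \<Longrightarrow> j \<noteq> k \<Longrightarrow> q_free q (w j / w k)"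
  shows "generic_points (chains n l) (node q w)"
proof -
  have prod: "w j * q ^ r * (w k * q ^ t) \<noteq> 1" if "j \<in> {1..n}" "k \<in> {1..n}" for j k r t
    using q_free_ne1'(2)[OF q(1) w(2)[OF that], of "r + t"] by (simp add: power_add mult_ac)
  have diff: "w j * q ^ r \<noteq> w k * q ^ t" if "j \<in> {1..n}" "k \<in> {1..n}" "(j, r) \<noteq> (k, t)" for j k r t
  proof (cases "j = k")
    case True
    then show ?thesis using that q_power_ne[OF q, of r t] w(1) by auto
  next
    case False
    have "w j / w k * q ^ r / q ^ t \<noteq> 1" using q_free_ne1[OF q(1) w(3)[OF that(1,2) False]] .
    then show ?thesis using q(1) w(1)[OF that(2)] by (auto simp: field_simps)
  qed
  have "node q w i \<noteq> 0 \<and> (node q w i)\<^sup>2 \<noteq> 1" if "i \<in> chains n l" for i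
    using that prod[of "fst i" "fst i" "snd i" "snd i"] w(1)[of "fst i"] q(1)
    by (auto simp: chains_def power2_eq_square)
  moreover have "node q w i \<noteq> node q w j \<and> node q w i * node q w j \<noteq> 1"
    if "i \<in> chains n l" "j \<in> chains n l" "i \<noteq> j" for i j
    using that prod[of "fst i" "fst j" "snd i" "snd j"] diff[of "fst i" "fst j" "snd i" "snd j"]
    by (auto simp: chains_def)
  ultimately show ?thesis unfolding generic_points_def by blast
qed

lemma pairprod_const:
  assumes "finite I"
  shows "pairprod I (\<lambda>_ _. c) = c ^ (card I choose 2)"
  using assms
proof (induction I rule: finite_induct)
  case (insert i I)
  then show ?case by (simp add: pairprod_insert numeral_2_eq_2 power_add)
qed (simp add: numeral_2_eq_2)

lemma prod_powers: "(\<Prod>i<n. q ^ i) = (q::complex) ^ (n choose 2)"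
  by (induction n) (simp_all add: numeral_2_eq_2 power_add mult.commute)

text \<open>The part of the prefactor that involves one family of parameters only: it enters
  directly for \<open>c / s\<close> and \<open>m\<close>, and inverted for \<open>z\<close> and
  \<open>l\<close>.\<close>

definition chain_prod :: "complex \<Rightarrow> nat \<Rightarrow> (nat \<Rightarrow> complex) \<Rightarrow> (nat \<Rightarrow> nat) \<Rightarrow> complex" where
  "chain_prod q n z l = pairprod {1..n} (\<lambda>j k. qpoch q (q * z j * z k) (l j + l k))
     / (\<Prod>j\<in>{1..n}. \<Prod>k\<in>{1..n}. qpoch q (q * z j * z k) (l k))"

text \<open>Induction that appends a last node to one progression. The new pair factors telescope
  along every progression; along the own one they produce the numerator
  \<open>?U k (Suc (L + L))\<close>, which cancels the head factor of the new node.\<close>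

lemma chain_prod_eq:
  assumes q: "q \<noteq> 0" and free: "\<And>j k. j \<in> {1..n} \<Longrightarrow> k \<in> {1..n} \<Longrightarrow> q_free q (z j * z k)"
  shows "(\<Prod>(k, r)\<in>chains n l. 1 / (1 - q * (z k * q ^ r)\<^sup>2))
     * pairprod (chains n l) (\<lambda>i j. (1 - q * (node q z i * node q z j) * q) / (1 - q * (node q z i * node q z j)))
    = chain_prod q n z l"
proof (induction "tsum n l" arbitrary: l)
  case 0
  then have l: "l k = 0" if "k \<in> {1..n}" for k using that by simp
  then have "chains n l = {}" by (auto simp: chains_def)
  moreover have "chain_prod q n z l = 1"
  proof -
    have "pairprod {1..n} (\<lambda>j k. qpoch q (q * z j * z k) (l j + l k)) = pairprod {1..n} (\<lambda>_ _. 1)"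
      using l by (intro pairprod_cong) auto
    moreover have "(\<Prod>j\<in>{1..n}. \<Prod>k\<in>{1..n}. qpoch q (q * z j * z k) (l k)) = 1"
      using l by (intro prod.neutral ballI) auto
    ultimately show ?thesis by (simp add: chain_prod_def pairprod_const)
  qed
  ultimately show ?case by simp
next
  case (Suc N)
  have "tsum n l \<noteq> 0" using Suc.hyps(2) by linarith
  then obtain k where k: "k \<in> {1..n}" "l k \<noteq> 0" by (auto elim: sum.not_neutral_contains_not_neutral)
  define h where "h = l(k := l k - 1)"
  define L where "L = h k"
  have l: "l = h(k := Suc L)" using k(2) by (auto simp: h_def L_def)
  let ?G = "\<lambda>i j. (1 - q * (node q z i * node q z j) * q) / (1 - q * (node q z i * node q z j))"
  let ?I = "{1..n} - {k}"
  have I: "{1..n} = insert k ?I" "finite ?I" "k \<notin> ?I" using k by auto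
  have "tsum n l = Suc (tsum n h)"
  proof -
    have "sum l ?I = sum h ?I" unfolding h_def by (intro sum.cong) auto
    then show ?thesis using sum.remove[OF _ k(1), of h] sum.remove[OF _ k(1), of l] k(2) by (simp add: h_def)
  qed
  then have IH: "(\<Prod>(k, r)\<in>chains n h. 1 / (1 - q * (z k * q ^ r)\<^sup>2))
     * pairprod (chains n h) ?G
    = chain_prod q n z h"
    using Suc.hyps by simp
  have ch: "chains n l = insert (k, L) (chains n h)" "(k, L) \<notin> chains n h"
    using k(1) unfolding l L_def by (auto simp: chains_def split: if_splits)
  have ne: "1 - z k * z j * q ^ e \<noteq> 0" if "j \<in> {1..n}" for j e
    using q_free_ne1'(2)[OF q free[OF k(1) that], of e] by simp
  let ?U = "\<lambda>j e. 1 - z k * z j * q ^ e"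
  have "(\<Prod>i\<in>chains n h. (1 - q * (node q z (k, L) * node q z i) * q) / (1 - q * (node q z (k, L) * node q z i)))
    = (\<Prod>j\<in>{1..n}. ?U j (Suc (L + h j)) / ?U j (Suc L))"
    unfolding prod_chains
  proof (intro prod.cong refl)
    fix j assume j: "j \<in> {1..n}"
    have "(\<Prod>r<h j. (1 - q * (node q z (k, L) * node q z (j, r)) * q) / (1 - q * (node q z (k, L) * node q z (j, r))))
      = (\<Prod>r\<in>{0..<h j}. ?U j (Suc (L + Suc r)) / ?U j (Suc (L + r)))"
      by (intro prod.cong) (auto simp: power_add mult_ac)
    also have "\<dots> = ?U j (Suc (L + h j)) / ?U j (Suc (L + 0))"
      by (rule prod_telescope_ge[where f = "\<lambda>r. ?U j (Suc (L + r))"], rule le0, rule ne[OF j])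
    finally show "(\<Prod>r<h j. (1 - q * (node q z (k, L) * node q z (j, r)) * q) / (1 - q * (node q z (k, L) * node q z (j, r))))
      = ?U j (Suc (L + h j)) / ?U j (Suc L)" by simp
  qed
  also have "\<dots> = ?U k (Suc (L + L)) / ?U k (Suc L) * (\<Prod>j\<in>?I. ?U j (Suc (L + h j)) / ?U j (Suc L))"
    by (subst prod.remove[OF _ k(1)]) (simp_all add: L_def)
  finally have P: "(\<Prod>i\<in>chains n h. (1 - q * (node q z (k, L) * node q z i) * q) / (1 - q * (node q z (k, L) * node q z i)))
    = \<dots>" .
  have "(\<Prod>(k, r)\<in>chains n l. 1 / (1 - q * (z k * q ^ r)\<^sup>2))
     * pairprod (chains n l) ?G
    = 1 / ?U k (Suc (L + L)) * (?U k (Suc (L + L)) / ?U k (Suc L) * (\<Prod>j\<in>?I. ?U j (Suc (L + h j)) / ?U j (Suc L)))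
      * chain_prod q n z h"
  proof -
    have "1 / (1 - q * (z k * q ^ L)\<^sup>2) = 1 / ?U k (Suc (L + L))"
      by (simp add: power_add power2_eq_square mult_ac)
    moreover have "pairprod (insert (k, L) (chains n h)) ?G
      = (?U k (Suc (L + L)) / ?U k (Suc L) * (\<Prod>j\<in>?I. ?U j (Suc (L + h j)) / ?U j (Suc L)))
       * pairprod (chains n h) ?G"
      unfolding P[symmetric] by (rule pairprod_insert[OF finite_chains ch(2)]) (simp only: mult.commute)
    moreover have "(\<Prod>(k, r)\<in>insert (k, L) (chains n h). 1 / (1 - q * (z k * q ^ r)\<^sup>2))
      = 1 / (1 - q * (z k * q ^ L)\<^sup>2) * (\<Prod>(k, r)\<in>chains n h. 1 / (1 - q * (z k * q ^ r)\<^sup>2))"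
      using ch(2) by simp
    ultimately show ?thesis
      unfolding ch(1) IH[symmetric] by (simp only: mult_ac)
  qed
  also have "\<dots> = (\<Prod>j\<in>?I. ?U j (Suc (L + h j)) / ?U j (Suc L)) / ?U k (Suc L) * chain_prod q n z h"
    using ne[OF k(1), of "Suc (L + L)"] by (simp del: power_Suc)
  also have "\<dots> = chain_prod q n z l"
  proof -
    have num: "pairprod {1..n} (\<lambda>j k. qpoch q (q * z j * z k) (l j + l k))
      = (\<Prod>j\<in>?I. ?U j (Suc (L + h j))) * pairprod {1..n} (\<lambda>j k. qpoch q (q * z j * z k) (h j + h k))"
    proof -
      have ins: "pairprod (insert k ?I) (\<lambda>j k. qpoch q (q * z j * z k) (g j + g k))
        = (\<Prod>j\<in>?I. qpoch q (q * z k * z j) (g k + g j)) * pairprod ?I (\<lambda>j k. qpoch q (q * z j * z k) (g j + g k))" for g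
        by (rule pairprod_insert[OF I(2,3)]) (simp add: mult_ac add.commute)
      have "pairprod ?I (\<lambda>j k. qpoch q (q * z j * z k) (l j + l k)) = pairprod ?I (\<lambda>j k. qpoch q (q * z j * z k) (h j + h k))"
        unfolding l by (intro pairprod_cong) auto
      moreover have "(\<Prod>j\<in>?I. qpoch q (q * z k * z j) (l k + l j))
        = (\<Prod>j\<in>?I. ?U j (Suc (L + h j))) * (\<Prod>j\<in>?I. qpoch q (q * z k * z j) (h k + h j))"
        unfolding prod.distrib[symmetric] l
        by (intro prod.cong) (auto simp: qpoch_Suc L_def mult_ac)
      ultimately show ?thesis
        using ins[of l] ins[of h] unfolding I(1)[symmetric] by (simp add: mult.assoc)
    qed
    have den: "(\<Prod>j\<in>{1..n}. \<Prod>i\<in>{1..n}. qpoch q (q * z j * z i) (l i))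
      = (\<Prod>j\<in>{1..n}. \<Prod>i\<in>{1..n}. qpoch q (q * z j * z i) (h i)) * (\<Prod>j\<in>{1..n}. ?U j (Suc L))"
    proof -
      have "(\<Prod>i\<in>{1..n}. \<Prod>j\<in>{1..n}. qpoch q (q * z j * z i) ((h(k := Suc L)) i))
        = (\<Prod>i\<in>{1..n}. \<Prod>j\<in>{1..n}. qpoch q (q * z j * z i) (h i)) * (\<Prod>j\<in>{1..n}. ?U j (Suc L))"
        by (rule prod_update_factor[where f = "\<lambda>i e. \<Prod>j\<in>{1..n}. qpoch q (q * z j * z i) e", OF _ k(1)])
          (simp_all add: qpoch_Suc L_def prod.distrib mult_ac)
      then show ?thesis unfolding l by (subst (1 2) prod.swap)
    qed
    have "(\<Prod>j\<in>{1..n}. ?U j (Suc L)) = ?U k (Suc L) * (\<Prod>j\<in>?I. ?U j (Suc L))"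
      by (rule prod.remove[OF _ k(1)]) simp
    then show ?thesis
      unfolding chain_prod_def num den prod_dividef by (simp add: mult_ac)
  qed
  finally show ?case .
qed

text \<open>The interaction of the two families when all signs on \<open>I\<close> are inverted. It
  occurs on both sides of the duality with the families exchanged, so only the quotient of the two
  versions matters.\<close>

definition kernel :: "complex \<Rightarrow> complex \<Rightarrow> 'a set \<Rightarrow> ('a \<Rightarrow> complex) \<Rightarrow> 'b set \<Rightarrow> ('b \<Rightarrow> complex) \<Rightarrow> complex" where
  "kernel q s I a J C = (\<Prod>i\<in>I. \<Prod>j\<in>J. (1 - s * C j * inverse (a i)) * (1 - s * inverse (a i) / C j) / inverse (a i))"

lemma card_chains [simp]: "card (chains n l) = tsum n l"
  by (simp add: chains_def)

text \<open>No chosen node means the zero index, so this is the constant by which the sum over signs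
  exceeds the series. Each head contributes \<open>- (b * d / q)\<close>, and each pair contributes
  \<open>1 / q\<close> when its inverted argument is rewritten.\<close>

lemma summand_base:
  assumes g: "generic_params q n p z c b d" and s: "s\<^sup>2 = q"
  shows "summand s (b / s) (d / s) (chains n l) (chains p m) (node q c) (flip (node q (\<lambda>k. s * z k)) {})
    = (- (b * d / q)) ^ tsum n l * (1 / q) ^ (tsum n l choose 2)
      * (\<Prod>k\<in>{1..n}. qpoch q (q * z k / b) (l k) * qpoch q (q * z k / d) (l k))
      * chain_prod q n z l * kernel q s (chains n l) (node q (\<lambda>k. s * z k)) (chains p m) (node q c)"
proof -
  note D = generic_paramsD[OF g]
  have q: "q \<noteq> 0" by (rule D)
  have s0: "s \<noteq> 0" using s q by auto
  let ?a = "node q (\<lambda>k. s * z k)"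
  let ?K = "\<lambda>i. \<Prod>j\<in>chains p m. (1 - s * node q c j * inverse (?a i)) * (1 - s * inverse (?a i) / node q c j) / inverse (?a i)"
  have flip: "flip ?a {} i = inverse (?a i)" for i by (simp add: flip_def)
  have "(\<Prod>i\<in>chains n l. weight s (b / s) (d / s) (chains p m) (node q c) (inverse (?a i)))
    = (\<Prod>i\<in>chains n l. - (b * d / q) * (case i of (k, r) \<Rightarrow> (1 - q * z k / b * q ^ r) * (1 - q * z k / d * q ^ r))
        * (case i of (k, r) \<Rightarrow> 1 / (1 - q * (z k * q ^ r)\<^sup>2)) * ?K i)"
  proof (intro prod.cong refl)
    fix i assume "i \<in> chains n l"
    then obtain k r where i: "i = (k, r)" and k: "k \<in> {1..n}" by (auto simp: chains_def)
    have a: "?a i = s * (z k * q ^ r)" by (simp add: i)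
    have "q * (z k * q ^ r)\<^sup>2 \<noteq> 1"
      using q_free_ne1'(2)[OF q D(8)[OF k k], of "Suc (r + r)"] by (simp add: power_add power2_eq_square mult_ac)
    then have "(1 - b / s * inverse (?a i)) * (1 - d / s * inverse (?a i)) / (1 - (inverse (?a i))\<^sup>2)
      = - (b * d / q) * ((1 - q * (z k * q ^ r) / b) * (1 - q * (z k * q ^ r) / d)) * (1 / (1 - q * (z k * q ^ r)\<^sup>2))"
      unfolding a using D(3,4) D(6)[OF k] q by (intro weight_head_inverse s s0) auto
    then show "weight s (b / s) (d / s) (chains p m) (node q c) (inverse (?a i))
      = - (b * d / q) * (case i of (k, r) \<Rightarrow> (1 - q * z k / b * q ^ r) * (1 - q * z k / d * q ^ r))
        * (case i of (k, r) \<Rightarrow> 1 / (1 - q * (z k * q ^ r)\<^sup>2)) * ?K i"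
      unfolding weight_def by (simp only: i prod.case) (simp add: mult_ac)
  qed
  also have "\<dots> = (- (b * d / q)) ^ tsum n l
      * (\<Prod>k\<in>{1..n}. qpoch q (q * z k / b) (l k) * qpoch q (q * z k / d) (l k))
      * (\<Prod>(k, r)\<in>chains n l. 1 / (1 - q * (z k * q ^ r)\<^sup>2)) * kernel q s (chains n l) ?a (chains p m) (node q c)"
  proof -
    have "(\<Prod>i\<in>chains n l. case i of (k, r) \<Rightarrow> (1 - q * z k / b * q ^ r) * (1 - q * z k / d * q ^ r))
      = (\<Prod>k\<in>{1..n}. qpoch q (q * z k / b) (l k) * qpoch q (q * z k / d) (l k))"
      unfolding prod_chains by (simp add: qpoch_def prod.distrib)
    then show ?thesis
      unfolding kernel_def by (simp only: prod.distrib prod_constant card_chains)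
  qed
  finally have 1: "(\<Prod>i\<in>chains n l. weight s (b / s) (d / s) (chains p m) (node q c) (inverse (?a i))) = \<dots>" .
  have "pairprod (chains n l) (\<lambda>i j. hfac (s\<^sup>2) (inverse (?a i) * inverse (?a j)))
    = pairprod (chains n l) (\<lambda>i j. 1 / q * ((1 - q * (node q z i * node q z j) * q) / (1 - q * (node q z i * node q z j))))"
  proof (rule pairprod_cong)
    fix i j assume ij: "i \<in> chains n l" "j \<in> chains n l"
    obtain k r k' r' where e: "i = (k, r)" "j = (k', r')" by (metis surj_pair)
    then have k: "k \<in> {1..n}" "k' \<in> {1..n}" using ij by (auto simp: chains_def)
    define v where "v = q * (node q z i * node q z j)"
    have v: "?a i * ?a j = v" using s by (simp add: v_def e power2_eq_square mult_ac)
    have v1: "v \<noteq> 1"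
      using q_free_ne1'(2)[OF q D(8)[OF k], of "Suc (r + r')"] by (simp add: v_def e power_add mult_ac)
    have v0: "v \<noteq> 0" using D(6)[OF k(1)] D(6)[OF k(2)] q by (simp add: v_def e)
    have "hfac q (inverse v) = 1 / q * ((1 - v * q) / (1 - v))"
    proof -
      have "1 - v \<noteq> 0" "1 - inverse v \<noteq> 0" using v1 v0 by (auto simp: field_simps)
      then show ?thesis
        unfolding hfac_def using v0 q by (simp add: divide_simps) (simp add: algebra_simps)
    qed
    then show "hfac (s\<^sup>2) (inverse (?a i) * inverse (?a j))
      = 1 / q * ((1 - q * (node q z i * node q z j) * q) / (1 - q * (node q z i * node q z j)))"
      unfolding v_def[symmetric] by (simp only: s v flip: inverse_mult_distrib)
  qed
  then have 2: "pairprod (chains n l) (\<lambda>i j. hfac (s\<^sup>2) (inverse (?a i) * inverse (?a j)))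
    = (1 / q) ^ (tsum n l choose 2)
      * pairprod (chains n l) (\<lambda>i j. (1 - q * (node q z i * node q z j) * q) / (1 - q * (node q z i * node q z j)))"
    by (simp only: pairprod_mult pairprod_const finite_chains card_chains)
  have 3: "chain_prod q n z l = (\<Prod>(k, r)\<in>chains n l. 1 / (1 - q * (z k * q ^ r)\<^sup>2))
     * pairprod (chains n l) (\<lambda>i j. (1 - q * (node q z i * node q z j) * q) / (1 - q * (node q z i * node q z j)))"
    by (rule chain_prod_eq[OF q D(8), symmetric])
  show ?thesis
    unfolding summand_def flip 1 2 3 by (simp only: mult_ac)
qed

text \<open>In both versions one linear factor is \<open>1 - 1 / (A * B)\<close>, with
  \<open>A\<close> and \<open>B\<close> the two nodes. The quotient of the remaining factors is
  \<open>- s\<close> times a quotient of neighbouring values of \<open>f\<close>, which telescopes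
  along the progression of \<open>z\<close>.\<close>

lemma kernel_dual:
  assumes g: "generic_params q n p z c b d" and s: "s\<^sup>2 = q"
  shows "kernel q s (chains p m) (node q c) (chains n l) (node q (\<lambda>k. s * z k))
    = (- s) ^ (tsum p m * tsum n l)
      * (\<Prod>k\<in>{1..n}. \<Prod>j\<in>{1..p}. qpoch q (q powi (- int (l k)) * c j / z k) (m j) / qpoch q (c j / z k) (m j))
      * kernel q s (chains n l) (node q (\<lambda>k. s * z k)) (chains p m) (node q c)"
proof -
  note D = generic_paramsD[OF g]
  have q: "q \<noteq> 0" by (rule D)
  have s0: "s \<noteq> 0" using s q by auto
  have ss: "s * s = q" using s by (simp add: power2_eq_square)
  define f where "f = (\<lambda>k j t r. 1 - c j / z k * q ^ t / q ^ r)"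
  have f0: "f k j t r \<noteq> 0" if "k \<in> {1..n}" "j \<in> {1..p}" for k j t r
    using q_free_ne1[OF q D(13)[OF that], of t r] by (simp add: f_def)
  let ?F = "\<lambda>i j. (1 - s * node q c j * inverse (node q (\<lambda>k. s * z k) i))
      * (1 - s * inverse (node q (\<lambda>k. s * z k) i) / node q c j) / inverse (node q (\<lambda>k. s * z k) i)"
  have "kernel q s (chains p m) (node q c) (chains n l) (node q (\<lambda>k. s * z k))
    = (\<Prod>i\<in>chains n l. \<Prod>j\<in>chains p m. (1 - s * node q (\<lambda>k. s * z k) i * inverse (node q c j))
       * (1 - s * inverse (node q c j) / node q (\<lambda>k. s * z k) i) / inverse (node q c j))"
    unfolding kernel_def by (rule prod.swap)
  also have "\<dots> = (\<Prod>i\<in>chains n l. \<Prod>j\<in>chains p m. (- s) * (f (fst i) (fst j) (snd j) (Suc (snd i)) / f (fst i) (fst j) (snd j) (snd i)) * ?F i j)"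
  proof (intro prod.cong refl)
    fix i j assume ij: "i \<in> chains n l" "j \<in> chains p m"
    obtain k r j' t where e: "i = (k, r)" "j = (j', t)" by (metis surj_pair)
    then have k: "k \<in> {1..n}" "j' \<in> {1..p}" using ij by (auto simp: chains_def)
    define x where "x = c j' / z k * q ^ t / q ^ r"
    define A where "A = z k * q ^ r"
    define B where "B = c j' * q ^ t"
    have A0: "A \<noteq> 0" "B \<noteq> 0" using D(6)[OF k(1)] D(7)[OF k(2)] q by (simp_all add: A_def B_def)
    have x: "x = B / A" using q D(6)[OF k(1)] by (simp add: x_def A_def B_def field_simps)
    have x1: "1 - x \<noteq> 0" using f0[OF k, of t r] by (simp add: f_def x_def)
    have "f k j' t r = 1 - x" "f k j' t (Suc r) = 1 - x / q"
      using q by (simp_all add: f_def x_def)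
    then have fe: "f (fst i) (fst j) (snd j) (Suc (snd i)) / f (fst i) (fst j) (snd j) (snd i) = (1 - x / q) / (1 - x)"
      by (simp add: e)
    have n: "node q (\<lambda>k. s * z k) i = s * A" "node q c j = B"
      by (simp_all add: e A_def B_def)
    have 1: "1 - s * inverse B / (s * A) = 1 - s * inverse (s * A) / B"
      using s0 A0 by (simp add: field_simps)
    have 2: "1 - s * B * inverse (s * A) = 1 - x"
      using s0 A0 by (simp add: x field_simps)
    have 3: "(1 - s * (s * A) * inverse B) / inverse B = (- s) * (1 - x / q) * (s * A)"
      using s0 A0 by (simp add: x ss[symmetric] field_simps)
    have "(1 - s * (s * A) * inverse B) * w / inverse B = (- s) * ((1 - x / q) / (1 - x)) * ((1 - x) * w / inverse (s * A))" for w
    proof -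
      have "(1 - s * (s * A) * inverse B) * w / inverse B = (1 - s * (s * A) * inverse B) / inverse B * w"
        by simp
      also have "\<dots> = (- s) * ((1 - x / q) / (1 - x)) * ((1 - x) * w / inverse (s * A))"
        unfolding 3 using x1 by (simp add: divide_inverse mult_ac)
      finally show ?thesis .
    qed
    then show "(1 - s * node q (\<lambda>k. s * z k) i * inverse (node q c j))
       * (1 - s * inverse (node q c j) / node q (\<lambda>k. s * z k) i) / inverse (node q c j)
      = (- s) * (f (fst i) (fst j) (snd j) (Suc (snd i)) / f (fst i) (fst j) (snd j) (snd i)) * ?F i j"
      unfolding n fe 1 2 .
  qed
  also have "\<dots> = (- s) ^ (tsum p m * tsum n l)
      * (\<Prod>i\<in>chains n l. \<Prod>j\<in>chains p m. f (fst i) (fst j) (snd j) (Suc (snd i)) / f (fst i) (fst j) (snd j) (snd i))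
      * kernel q s (chains n l) (node q (\<lambda>k. s * z k)) (chains p m) (node q c)"
    unfolding kernel_def by (simp only: prod.distrib prod_constant card_chains power_mult)
  also have "(\<Prod>i\<in>chains n l. \<Prod>j\<in>chains p m. f (fst i) (fst j) (snd j) (Suc (snd i)) / f (fst i) (fst j) (snd j) (snd i))
    = (\<Prod>k\<in>{1..n}. \<Prod>j\<in>{1..p}. qpoch q (q powi (- int (l k)) * c j / z k) (m j) / qpoch q (c j / z k) (m j))"
  proof -
    have "(\<Prod>i\<in>chains n l. \<Prod>j\<in>chains p m. f (fst i) (fst j) (snd j) (Suc (snd i)) / f (fst i) (fst j) (snd j) (snd i))
      = (\<Prod>k\<in>{1..n}. \<Prod>j\<in>{1..p}. \<Prod>t<m j. \<Prod>r<l k. f k j t (Suc r) / f k j t r)"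
      unfolding prod_chains
      by (simp only: fst_conv snd_conv prod.swap[of _ "{..<l _}"])
    also have "\<dots> = (\<Prod>k\<in>{1..n}. \<Prod>j\<in>{1..p}. qpoch q (q powi (- int (l k)) * c j / z k) (m j) / qpoch q (c j / z k) (m j))"
    proof (intro prod.cong refl)
      fix k j assume k: "k \<in> {1..n}" "j \<in> {1..p}"
      have "(\<Prod>r<l k. f k j t (Suc r) / f k j t r) = f k j t (l k) / f k j t 0" for t
        using prod_telescope_ge[of 0 "l k" "f k j t"] f0[OF k] by (simp add: lessThan_atLeast0)
      moreover have "f k j t (l k) = 1 - q powi (- int (l k)) * c j / z k * q ^ t" "f k j t 0 = 1 - c j / z k * q ^ t" for t
        using q by (simp_all add: f_def power_int_minus field_simps)
      ultimately show "(\<Prod>t<m j. \<Prod>r<l k. f k j t (Suc r) / f k j t r)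
          = qpoch q (q powi (- int (l k)) * c j / z k) (m j) / qpoch q (c j / z k) (m j)"
        unfolding qpoch_def by (simp add: prod_dividef)
    qed
    finally show ?thesis .
  qed
  finally show ?thesis .
qed

section \<open>Reversal and reflection of shifted factorials\<close>

lemma qpoch_add: "qpoch q a (m + n) = qpoch q a m * qpoch q (a * q ^ m) n"
  by (induction n) (simp_all add: qpoch_Suc power_add mult_ac)

lemma descpoch_reverse: "q \<noteq> 0 \<Longrightarrow> descpoch q (x * q ^ N / q) N = qpoch q x N"
proof (induction N)
  case (Suc N)
  then have "descpoch q (x * q ^ Suc N / q) (Suc N) = (1 - x * q ^ N) * descpoch q (x * q ^ N / q) N"
    using descpoch_shift[of q "x * q ^ N / q" N] by (simp add: mult_ac)
  with Suc show ?case by (simp add: qpoch_Suc)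
qed simp

lemma descpoch_reflect:
  assumes "q \<noteq> 0" "x \<noteq> 0"
  shows "descpoch q (1 / x) M * (- x) ^ M * q ^ (M choose 2) = qpoch q x M"
proof -
  have "(1 - 1 / x / q ^ i) * (- x) * q ^ i = 1 - x * q ^ i" for i
    using assms by (simp add: field_simps)
  then have "(\<Prod>i<M. (1 - 1 / x / q ^ i) * (- x) * q ^ i) = qpoch q x M"
    by (simp add: qpoch_def)
  then show ?thesis
    by (simp only: prod.distrib prod_powers descpoch_def prod_constant card_lessThan)
qed

lemma qpoch_reflect:
  assumes "q \<noteq> 0" "x \<noteq> 0"
  shows "qpoch q (q / x) N * (- (x / q)) ^ N * (1 / q) ^ (N choose 2) = qpoch q (x / q ^ N) N"
proof -
  have "(1 - q / x * q ^ i) * (- (x / q)) * (1 / q) ^ i = 1 - x / q / q ^ i" for i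
    using assms by (simp add: field_simps)
  then have "(\<Prod>i<N. (1 - q / x * q ^ i) * (- (x / q)) * (1 / q) ^ i) = descpoch q (x / q) N"
    by (simp add: descpoch_def)
  also have "\<dots> = qpoch q (x / q ^ N) N"
    using descpoch_reverse[of q "x / q ^ N" N] assms by simp
  finally show ?thesis
    by (simp only: prod.distrib prod_powers qpoch_def prod_constant card_lessThan)
qed

text \<open>Applied with \<open>x = b * d\<close>. Reflection brings everything to the base
  \<open>q\<close>; what remains is that the shifted factorial of \<open>x / q ^ N\<close> of length
  \<open>M + N\<close> can be split after \<open>M\<close> or after \<open>N\<close>
  factors.\<close>

lemma scalar_prefactor:
  assumes "q \<noteq> 0" "q_free q x"
  shows "descpoch q (x / q * q ^ M) N * ((- (1 / x)) ^ M * (1 / q) ^ (M choose 2))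
    = qpoch q (q / x) N / qpoch q (q powi (- int N) * x) M
      * (descpoch q (1 / x) M * ((- (x / q)) ^ N * (1 / q) ^ (N choose 2)))"
proof -
  have x0: "x \<noteq> 0" using assms(2) by (rule q_free_nz)
  have ne: "qpoch q (x * q powi e) K \<noteq> 0" for e K
    using q_free_ne1'(2)[OF assms(1) q_free_mult_powi[OF assms]] by (simp add: qpoch_def)
  have A: "descpoch q (x / q * q ^ M) N = qpoch q (x * q ^ M / q ^ N) N"
    using descpoch_reverse[of q "x * q ^ M / q ^ N" N] assms(1) by (simp add: mult_ac)
  have B: "qpoch q (x / q ^ N) M * qpoch q (x * q ^ M / q ^ N) N = qpoch q (x / q ^ N) N * qpoch q x M"
    using qpoch_add[of q "x / q ^ N" M N] qpoch_add[of q "x / q ^ N" N M] assms(1)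
    by (simp add: add.commute mult_ac)
  have E: "q powi (- int N) * x = x / q ^ N" by (simp add: power_int_minus field_simps)
  have n1: "qpoch q x M \<noteq> 0" using ne[of 0 M] by simp
  have n2: "qpoch q (x / q ^ N) M \<noteq> 0" using ne[of "- int N" M] by (simp add: power_int_minus divide_inverse)
  have c: "(- (1 / x)) ^ M * (1 / q) ^ (M choose 2) * ((- x) ^ M * q ^ (M choose 2)) = 1"
  proof -
    have "(- (1 / x)) ^ M * (- x) ^ M = 1" "(1 / q) ^ (M choose 2) * q ^ (M choose 2) = 1"
      using x0 assms(1) by (simp_all flip: power_mult_distrib)
    then show ?thesis by (metis (no_types, lifting) mult.assoc mult.left_commute mult_1_right)
  qed
  have "descpoch q (x / q * q ^ M) N * ((- (1 / x)) ^ M * (1 / q) ^ (M choose 2)) * qpoch q (x / q ^ N) M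
    = qpoch q (q / x) N * (descpoch q (1 / x) M * ((- (x / q)) ^ N * (1 / q) ^ (N choose 2)))"
  proof -
    have "descpoch q (x / q * q ^ M) N * ((- (1 / x)) ^ M * (1 / q) ^ (M choose 2)) * qpoch q (x / q ^ N) M
      = (qpoch q (x / q ^ N) M * qpoch q (x * q ^ M / q ^ N) N) * ((- (1 / x)) ^ M * (1 / q) ^ (M choose 2))"
      unfolding A by (simp only: mult_ac)
    also have "\<dots> = (qpoch q (q / x) N * (- (x / q)) ^ N * (1 / q) ^ (N choose 2))
        * (descpoch q (1 / x) M * (- x) ^ M * q ^ (M choose 2)) * ((- (1 / x)) ^ M * (1 / q) ^ (M choose 2))"
      unfolding B qpoch_reflect[OF assms(1) x0] descpoch_reflect[OF assms(1) x0] ..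
    also have "\<dots> = qpoch q (q / x) N * (descpoch q (1 / x) M * ((- (x / q)) ^ N * (1 / q) ^ (N choose 2)))
        * ((- (1 / x)) ^ M * (1 / q) ^ (M choose 2) * ((- x) ^ M * q ^ (M choose 2)))"
      by (simp only: mult_ac)
    finally show ?thesis unfolding c by simp
  qed
  moreover have "u = v / k * w" if "u * k = v * w" "k \<noteq> 0" for u v w k :: complex
    using that by (simp add: field_simps)
  ultimately show ?thesis unfolding E using n2 by blast
qed

section \<open>The identity for generic parameters\<close>

definition dual_term :: "complex \<Rightarrow> complex \<Rightarrow> nat \<Rightarrow> nat \<Rightarrow> (nat \<Rightarrow> nat) \<Rightarrow> (nat \<Rightarrow> nat) \<Rightarrow> (nat \<Rightarrow> complex) \<Rightarrow> (nat \<Rightarrow> complex)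
    \<Rightarrow> complex \<Rightarrow> complex \<Rightarrow> (nat \<Rightarrow> nat) \<Rightarrow> complex" where
  "dual_term q s n p l m z c b d x =
        (W p (\<lambda>j. c j * q ^ x j / s) / W p (\<lambda>j. c j / s))
      * (\<Prod>k\<in>{1..n}. \<Prod>j\<in>{1..p}.
           (qpoch q (q ^ l k * c j * z k) (x j) * qpoch q (c j / z k) (x j))
         / (qpoch q (c j * z k) (x j) * qpoch q (q powi (- int (l k)) * c j / z k) (x j)))
      * (\<Prod>j\<in>{1..p}. \<Prod>k\<in>{1..p}.
           (qpoch q (c j * c k / q) (x j) * qpoch q (q powi (- int (m k)) * c j / c k) (x j))
         / (qpoch q (q * c j / c k) (x j) * qpoch q (q ^ m k * c j * c k) (x j)))
      * (\<Prod>j\<in>{1..p}.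
           (qpoch q (c j / b) (x j) * qpoch q (c j / d) (x j))
         / (qpoch q (c j * b) (x j) * qpoch q (c j * d) (x j)))
      * (q powi (int (tsum p m) - int (tsum n l)) * b * d) ^ tsum p x"

definition prefactor :: "complex \<Rightarrow> nat \<Rightarrow> nat \<Rightarrow> (nat \<Rightarrow> nat) \<Rightarrow> (nat \<Rightarrow> nat) \<Rightarrow> (nat \<Rightarrow> complex) \<Rightarrow> (nat \<Rightarrow> complex)
    \<Rightarrow> complex \<Rightarrow> complex \<Rightarrow> complex" where
  "prefactor q n p l m z c b d =
     (qpoch q (q / (b * d)) (tsum n l)
        / qpoch q (q powi (- int (tsum n l)) * b * d) (tsum p m))
   * ((\<Prod>j\<in>{1..p}. qpoch q (c j * b) (m j) * qpoch q (c j * d) (m j))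
        / (\<Prod>k\<in>{1..n}. qpoch q (q * z k / b) (l k) * qpoch q (q * z k / d) (l k)))
   * ((\<Prod>j\<in>{1..n}. \<Prod>k\<in>{1..n}. qpoch q (q * z j * z k) (l k))
        / (\<Prod>j\<in>{1..n}. \<Prod>k\<in>{j<..n}. qpoch q (q * z j * z k) (l j + l k)))
   * ((\<Prod>j\<in>{1..p}. \<Prod>k\<in>{j<..p}. qpoch q (c j * c k) (m j + m k))
        / (\<Prod>j\<in>{1..p}. \<Prod>k\<in>{1..p}. qpoch q (c j * c k) (m j)))
   * (\<Prod>k\<in>{1..n}. \<Prod>j\<in>{1..p}.
        qpoch q (q powi (- int (l k)) * c j / z k) (m j) / qpoch q (c j / z k) (m j))"

text \<open>The right-hand terms are left-hand terms for the exchanged data. The asymmetries between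
  the two series, such as \<open>c j * c k / q\<close> against \<open>z j * z k\<close> or
  \<open>- l k\<close> against \<open>1 - m j\<close> in an exponent, come from
  \<open>s * s = q\<close> alone.\<close>

lemma phi_term_dual:
  assumes "s\<^sup>2 = q" "s \<noteq> 0"
  shows "phi_term q p n m l (\<lambda>j. c j / s) (\<lambda>k. s * z k) (s / b) (s / d) x = dual_term q s n p l m z c b d x"
proof -
  have q: "q \<noteq> 0" using assms by auto
  have ss: "s * s = q" using assms(1) by (simp add: power2_eq_square)
  have 1: "W p (\<lambda>k. c k / s * q ^ x k) / W p (\<lambda>j. c j / s) = W p (\<lambda>j. c j * q ^ x j / s) / W p (\<lambda>j. c j / s)"
    by simp
  have 2: "(\<Prod>k\<in>{1..p}. \<Prod>j\<in>{1..n}.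
           (qpoch q (q ^ l j * (s * z j) * (c k / s)) (x k) * qpoch q (q * (c k / s) / (s * z j)) (x k))
         / (qpoch q (s * z j * (c k / s)) (x k) * qpoch q (q powi (1 - int (l j)) * (c k / s) / (s * z j)) (x k)))
    = (\<Prod>k\<in>{1..n}. \<Prod>j\<in>{1..p}.
           (qpoch q (q ^ l k * c j * z k) (x j) * qpoch q (c j / z k) (x j))
         / (qpoch q (c j * z k) (x j) * qpoch q (q powi (- int (l k)) * c j / z k) (x j)))"
  proof -
    have "q ^ e * (s * w) * (v / s) = q ^ e * v * w" "s * w * (v / s) = v * w"
      "q * (v / s) / (s * w) = v / w" "q powi (1 - int e) * (v / s) / (s * w) = q powi (- int e) * v / w" for e w v
      using assms(2) q by (simp_all add: ss[symmetric] power_int_diff power_int_minus field_simps)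
    then show ?thesis by (subst prod.swap) (simp only:)
  qed
  have 3: "(\<Prod>j\<in>{1..p}. \<Prod>k\<in>{1..p}.
           (qpoch q (c j / s * (c k / s)) (x k) * qpoch q (q powi (- int (m j)) * (c k / s) / (c j / s)) (x k))
         / (qpoch q (q * (c k / s) / (c j / s)) (x k) * qpoch q (q ^ (1 + m j) * (c j / s) * (c k / s)) (x k)))
    = (\<Prod>j\<in>{1..p}. \<Prod>k\<in>{1..p}.
           (qpoch q (c j * c k / q) (x j) * qpoch q (q powi (- int (m k)) * c j / c k) (x j))
         / (qpoch q (q * c j / c k) (x j) * qpoch q (q ^ m k * c j * c k) (x j)))"
  proof -
    have "w / s * (v / s) = v * w / q" "u * (v / s) / (w / s) = u * v / w"
      "q ^ (1 + e) * (w / s) * (v / s) = q ^ e * v * w" for u v w e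
      using assms(2) by (simp_all add: ss[symmetric] field_simps)
    then show ?thesis by (subst prod.swap) (simp only:)
  qed
  have 4: "s / b * (c k / s) = c k / b" "q * (c k / s) / (s / b) = c k * b" for b k
    using assms(2) by (simp_all add: ss[symmetric] field_simps)
  have 5: "q powi (1 - int (tsum n l) + int (tsum p m)) / (s / b * (s / d)) = q powi (int (tsum p m) - int (tsum n l)) * b * d"
  proof -
    have 1: "s / b * (s / d) = q / (b * d)" by (simp add: ss)
    have 2: "q powi (1 - N + M) = q powi (M - N) * q" for M N :: int
    proof -
      have e: "1 - N + M = (M - N) + 1" by simp
      show ?thesis unfolding e using q by (simp add: power_int_add_1)
    qed
    show ?thesis unfolding 1 2 using q by simp
  qed
  show ?thesis
    unfolding phi_term_def dual_term_def 1 2 3 4 5 ..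
qed

text \<open>On each side of the duality the sum over signs is its base term times a series, so the
  prefactor is a quotient of base terms and scalars. The kernel and the power of \<open>- s\<close>
  occur on both sides and cancel.\<close>

lemma phi_duality_generic:
  assumes g: "generic_params q n p z c b d" and s: "s\<^sup>2 = q"
  shows "(\<Sum>y\<in>index_box n l. phi_term q n p l m z c b d y)
    = prefactor q n p l m z c b d * (\<Sum>x\<in>index_box p m. dual_term q s n p l m z c b d x)"
proof -
  note D = generic_paramsD[OF g]
  have q: "q \<noteq> 0" by (rule D)
  have s0: "s \<noteq> 0" using s q by auto
  have ss: "s * s = q" using s by (simp add: power2_eq_square)
  note g' = generic_params_dual[OF g s]
  let ?I = "chains n l" and ?J = "chains p m"
  let ?a = "node q (\<lambda>k. s * z k)" and ?C = "node q c"
  let ?N = "tsum n l" and ?M = "tsum p m"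
  have C: "node q (\<lambda>j. s * (c j / s)) = ?C" using s0 by simp
  have ga: "generic_points ?I ?a"
  proof (rule generic_points_node[OF q D(2)])
    show "q_free q (s * z j * (s * z k))" if "j \<in> {1..n}" "k \<in> {1..n}" for j k
      using q_free_mult_q[OF q D(8)[OF that]] by (simp add: ss[symmetric] mult_ac)
    show "q_free q (s * z j / (s * z k))" if "j \<in> {1..n}" "k \<in> {1..n}" "j \<noteq> k" for j k
      using D(9)[OF that] s0 by simp
  qed (use D(6) s0 in auto)
  have gC: "generic_points ?J ?C"
    by (rule generic_points_node[OF q D(2) D(7) D(10) D(11)])
  have "(\<lambda>i. s * ?C i) = node q (\<lambda>j. s * c j)"
    by (auto simp: node_def)
  moreover have "generic_points ?J (node q (\<lambda>j. s * c j))"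
  proof (rule generic_points_node[OF q D(2)])
    show "q_free q (s * c j * (s * c k))" if "j \<in> {1..p}" "k \<in> {1..p}" for j k
      using q_free_mult_q[OF q D(10)[OF that]] by (simp add: ss[symmetric] mult_ac)
    show "q_free q (s * c j / (s * c k))" if "j \<in> {1..p}" "k \<in> {1..p}" "j \<noteq> k" for j k
      using D(11)[OF that] s0 by simp
  qed (use D(7) s0 in auto)
  ultimately have gsC: "generic_points ?J (\<lambda>i. s * ?C i)" by simp
  have cross: "s * ?C i \<noteq> ?a k \<and> s * ?C i * ?a k \<noteq> 1" if ik: "k \<in> ?I" "i \<in> ?J" for i k
  proof -
    obtain k' r j t where e: "k = (k', r)" "i = (j, t)" by (metis surj_pair)
    then have k: "k' \<in> {1..n}" "j \<in> {1..p}" using ik by (auto simp: chains_def)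
    have "c j / z k' * q ^ t / q ^ r \<noteq> 1" by (rule q_free_ne1[OF q D(13)[OF k]])
    then have "c j * q ^ t \<noteq> z k' * q ^ r" using q D(6)[OF k(1)] by (auto simp: field_simps)
    then have 1: "s * (c j * q ^ t) \<noteq> s * z k' * q ^ r" using s0 by (simp add: mult.assoc)
    have "s * (c j * q ^ t) * (s * z k' * q ^ r) = c j * z k' * q ^ Suc (t + r)"
      by (simp add: ss[symmetric] power_add mult_ac)
    then have 2: "s * (c j * q ^ t) * (s * z k' * q ^ r) \<noteq> 1"
      using q_free_ne1'(2)[OF q D(12)[OF k]] by metis
    show ?thesis unfolding e node_simp using 1 2 by blast
  qed
  have b: "b / s \<noteq> 0" "d / s \<noteq> 0" using D(3,4) s0 by auto
  have args: "1 / (q * (b / s) * (d / s)) = 1 / (b * d)" "b / s * (d / s) = b * d / q"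
    "1 / (s * (b / s)) = (s / b) / s" "1 / (s * (d / s)) = (s / d) / s"
    using s0 by (simp_all add: ss[symmetric])
  have dual: "descpoch q (1 / (b * d)) ?M * (- s) ^ (?M * ?N) * signsum s (b / s) (d / s) ?I ?a ?J ?C
    = descpoch q (b * d / q * q ^ ?M) ?N * signsum s ((s / b) / s) ((s / d) / s) ?J ?C ?I ?a"
    using signsum_duality[OF finite_chains finite_chains s0 b ga gC gsC cross]
    unfolding s args card_chains .
  define K where "K = kernel q s ?I ?a ?J ?C"
  define Q where "Q = (\<Prod>k\<in>{1..n}. \<Prod>j\<in>{1..p}. qpoch q (q powi (- int (l k)) * c j / z k) (m j) / qpoch q (c j / z k) (m j))"
  define Bz where "Bz = (\<Prod>k\<in>{1..n}. qpoch q (q * z k / b) (l k) * qpoch q (q * z k / d) (l k))"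
  define Bc where "Bc = (\<Prod>j\<in>{1..p}. qpoch q (c j * b) (m j) * qpoch q (c j * d) (m j))"
  define Rz where "Rz = (- (b * d / q)) ^ ?N * (1 / q) ^ (?N choose 2)"
  define Rc where "Rc = (- (1 / (b * d))) ^ ?M * (1 / q) ^ (?M choose 2)"
  define Tz where "Tz = chain_prod q n z l"
  define Tc where "Tc = chain_prod q p (\<lambda>j. c j / s) m"
  define Phi where "Phi = (\<Sum>y\<in>index_box n l. phi_term q n p l m z c b d y)"
  define Psi where "Psi = (\<Sum>x\<in>index_box p m. dual_term q s n p l m z c b d x)"
  have L: "signsum s (b / s) (d / s) ?I ?a ?J ?C = Rz * Bz * Tz * K * Phi"
    unfolding signsum_chains[OF g s] summand_base[OF g s] Rz_def Bz_def Tz_def K_def Phi_def ..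
  have R: "signsum s ((s / b) / s) ((s / d) / s) ?J ?C ?I ?a = Rc * Bc * Tc * ((- s) ^ (?M * ?N) * Q * K) * Psi"
  proof -
    have 1: "s / b * (s / d) / q = 1 / (b * d)" using q by (simp add: ss)
    have 2: "q * (c j / s) / (s / b) = c j * b" for b j using s0 by (simp add: ss[symmetric])
    show ?thesis
      using signsum_chains[OF g' s, of m l] summand_base[OF g' s, of m l]
      unfolding C 1 2 phi_term_dual[OF s s0] kernel_dual[OF g s]
      unfolding Rc_def Bc_def Tc_def Q_def K_def Psi_def by (simp only:)
  qed
  have free: "q_free q (b * d)" by (rule D)
  have qne: "qpoch q (x * q powi e) k \<noteq> 0" if "q_free q x" for x e k
    using q_free_ne1'(2)[OF q q_free_mult_powi[OF q that]] by (simp add: qpoch_def)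
  have "Rz \<noteq> 0" using D(3,4) q by (simp add: Rz_def)
  moreover have "Bz \<noteq> 0"
  proof -
    have "qpoch q (q * z k / b) (l k) \<noteq> 0" "qpoch q (q * z k / d) (l k) \<noteq> 0" if "k \<in> {1..n}" for k
      using qne[OF D(15)[OF that], of 1] qne[OF D(17)[OF that], of 1] by (simp_all add: mult_ac)
    then show ?thesis by (simp add: Bz_def)
  qed
  moreover have Tz: "Tz \<noteq> 0"
  proof -
    have n: "qpoch q (q * z j * z k) e \<noteq> 0" if "j \<in> {1..n}" "k \<in> {1..n}" for j k e
      using qne[OF D(8)[OF that], of 1 e] by (simp add: mult_ac)
    have "pairprod {1..n} (\<lambda>j k. qpoch q (q * z j * z k) (l j + l k)) \<noteq> 0"
      by (rule pairprod_ne0) (use n in auto)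
    then show ?thesis using n by (simp add: Tz_def chain_prod_def)
  qed
  moreover have "K \<noteq> 0"
  proof -
    have "(1 - s * ?C j * inverse (?a i)) * (1 - s * inverse (?a i) / ?C j) / inverse (?a i) \<noteq> 0"
      if ij: "i \<in> ?I" "j \<in> ?J" for i j
    proof -
      obtain k r j' t where e: "i = (k, r)" "j = (j', t)" by (metis surj_pair)
      then have k: "k \<in> {1..n}" "j' \<in> {1..p}" using ij by (auto simp: chains_def)
      have nz: "z k \<noteq> 0" "c j' \<noteq> 0" using D(6,7) k by auto
      have "s * ?C j * inverse (?a i) = c j' / z k * q ^ t / q ^ r"
        using s0 nz q by (simp add: e field_simps)
      moreover have "s * inverse (?a i) / ?C j = inverse (c j' * z k) / q ^ (t + r)"
        using s0 nz q by (simp add: e field_simps power_add)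
      moreover have "?a i \<noteq> 0" using s0 nz q by (simp add: e)
      ultimately show ?thesis
        using q_free_ne1[OF q D(13)[OF k], of t r] q_free_ne1'(3)[OF q q_free_inverse[OF D(12)[OF k]], of "t + r"]
        by simp
    qed
    then show ?thesis unfolding K_def kernel_def by (simp only: prod_zero_iff finite_chains) blast
  qed
  moreover have "descpoch q (1 / (b * d)) ?M \<noteq> 0"
  proof -
    have "1 / (b * d) / q ^ i \<noteq> 1" for i
      using q_free_ne1'(3)[OF q q_free_inverse[OF free]] unfolding inverse_eq_divide .
    then show ?thesis unfolding descpoch_def by (simp only: prod_zero_iff finite_lessThan) force
  qed
  ultimately have nz: "descpoch q (1 / (b * d)) ?M * Rz \<noteq> 0" "Bz \<noteq> 0" "Tz \<noteq> 0" "K \<noteq> 0" "(- s) ^ (?M * ?N) \<noteq> 0"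
    using s0 by simp_all
  define A where "A = qpoch q (q / (b * d)) ?N / qpoch q (q powi (- int ?N) * (b * d)) ?M"
  have sc: "descpoch q (b * d / q * q ^ ?M) ?N * Rc = A * (descpoch q (1 / (b * d)) ?M * Rz)"
    unfolding Rc_def Rz_def A_def by (rule scalar_prefactor[OF q free])
  have pre: "prefactor q n p l m z c b d = A * (Bc / Bz) * (1 / Tz) * Tc * Q"
  proof -
    have 1: "q * (c j / s) * (c k / s) = c j * c k" for j k using s0 by (simp add: ss[symmetric])
    have 2: "(\<Prod>j\<in>{1..p}. \<Prod>k\<in>{1..p}. qpoch q (c j * c k) (m k))
        = (\<Prod>j\<in>{1..p}. \<Prod>k\<in>{1..p}. qpoch q (c j * c k) (m j))"
      by (subst prod.swap) (intro prod.cong refl, simp add: mult.commute)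
    have "Tc = (\<Prod>j\<in>{1..p}. \<Prod>k\<in>{j<..p}. qpoch q (c j * c k) (m j + m k))
        / (\<Prod>j\<in>{1..p}. \<Prod>k\<in>{1..p}. qpoch q (c j * c k) (m j))"
      unfolding Tc_def chain_prod_def 1 2 pairprod_atLeastAtMost ..
    then show ?thesis
      unfolding prefactor_def Tz_def chain_prod_def A_def Bc_def Bz_def Q_def pairprod_atLeastAtMost
      by (simp add: mult.assoc)
  qed
  have "descpoch q (1 / (b * d)) ?M * (- s) ^ (?M * ?N) * (Rz * Bz * Tz * K * Phi)
    = (descpoch q (b * d / q * q ^ ?M) ?N * Rc) * Bc * Tc * ((- s) ^ (?M * ?N) * Q * K) * Psi"
    using dual unfolding L R by (simp only: mult.assoc)
  then have "(descpoch q (1 / (b * d)) ?M * Rz) * (Bz * Tz * K * (- s) ^ (?M * ?N)) * Phi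
    = (descpoch q (1 / (b * d)) ?M * Rz) * (Bz * Tz * K * (- s) ^ (?M * ?N)) * (A * (Bc / Bz) * (1 / Tz) * Tc * Q * Psi)"
    unfolding sc using nz by (simp add: field_simps)
  moreover have "(descpoch q (1 / (b * d)) ?M * Rz) * (Bz * Tz * K * (- s) ^ (?M * ?N)) \<noteq> 0"
    using nz by (simp only: mult_eq_0_iff simp_thms not_False_eq_True)
  ultimately have "Phi = A * (Bc / Bz) * (1 / Tz) * Tc * Q * Psi"
    by (rule mult_left_cancel[THEN iffD1, rotated])
  then show ?thesis unfolding pre Phi_def Psi_def .
qed

section \<open>Removal of the genericity assumptions\<close>

text \<open>A non-zero limit would keep \<open>f\<close> from vanishing on a whole interval next to
  0, which is uncountable.\<close>

lemma tendsto_zero_of_cocountable: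
  fixes f :: "real \<Rightarrow> complex"
  assumes f: "(f \<longlongrightarrow> L) (at 0)" and null: "countable {t. f t \<noteq> 0}"
  shows "L = 0"
proof (rule ccontr)
  assume "L \<noteq> 0"
  then have "eventually (\<lambda>t. f t \<noteq> 0) (at 0)"
    using tendsto_imp_eventually_ne[OF f] by simp
  then obtain e where e: "e > 0" "\<And>t. t \<noteq> 0 \<Longrightarrow> dist t 0 < e \<Longrightarrow> f t \<noteq> 0"
    unfolding eventually_at by auto
  then have "{0<..<e} \<subseteq> {t. f t \<noteq> 0}" by auto
  then show False
    using null e(1) countable_subset uncountable_open_interval by blast
qed

text \<open>For \<open>r \<noteq> 0\<close> the modulus is strictly monotone in \<open>t\<close>, so
  each of the countably many powers of \<open>q\<close> is met at most once.\<close>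

lemma countable_not_q_free:
  assumes "x \<noteq> 0" "r \<noteq> 0"
  shows "countable {t. \<not> q_free q (x * complex_of_real (exp (t * r)))}"
proof -
  have "countable {t. x * complex_of_real (exp (t * r)) = q powi e}" for e
  proof (cases "\<exists>u. x * complex_of_real (exp (u * r)) = q powi e")
    case True
    then obtain u where u: "x * complex_of_real (exp (u * r)) = q powi e" by blast
    have "t = u" if "x * complex_of_real (exp (t * r)) = q powi e" for t
      using that assms unfolding u[symmetric] by simp
    then have "{t. x * complex_of_real (exp (t * r)) = q powi e} \<subseteq> {u}"
      by blast
    then show ?thesis by (rule countable_subset) simp
  qed simp
  then have "countable (\<Union>e. {t. x * complex_of_real (exp (t * r)) = q powi e})" by blast
  then show ?thesis
    by (rule countable_subset[rotated]) (use assms in \<open>auto simp: q_free_def\<close>)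
qed

text \<open>This and the next two rules follow the syntax of \<open>generic_params\<close>, so that
  countability of the exceptional set reduces to its single conditions.\<close>

lemma countable_not_conj:
  assumes "countable {t. \<not> P t}" "countable {t. \<not> Q t}"
  shows "countable {t. \<not> (P t \<and> Q t)}"
proof -
  have "{t. \<not> (P t \<and> Q t)} = {t. \<not> P t} \<union> {t. \<not> Q t}" by auto
  then show ?thesis using assms by simp
qed

lemma countable_not_ball:
  assumes "finite I" "\<And>i. i \<in> I \<Longrightarrow> countable {t. \<not> P i t}"
  shows "countable {t. \<not> (\<forall>i\<in>I. P i t)}"
proof -
  have "{t. \<not> (\<forall>i\<in>I. P i t)} = (\<Union>i\<in>I. {t. \<not> P i t})" by auto
  then show ?thesis using assms by (simp add: countable_finite)
qed

lemma countable_not_imp: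
  "(P \<Longrightarrow> countable {t. \<not> Q t}) \<Longrightarrow> countable {t. \<not> (P \<longrightarrow> Q t)}"
  by (cases P) simp_all

lemma tendsto_qpoch [tendsto_intros]:
  "(f \<longlongrightarrow> a) F \<Longrightarrow> ((\<lambda>t. qpoch q (f t) k) \<longlongrightarrow> qpoch q a k) F"
  unfolding qpoch_def by (intro tendsto_intros)

lemma tendsto_W:
  "(\<And>k. k \<in> {1..n} \<Longrightarrow> ((\<lambda>t. u t k) \<longlongrightarrow> v k) F) \<Longrightarrow> ((\<lambda>t. W n (u t)) \<longlongrightarrow> W n v) F"
  unfolding W_def by (intro tendsto_intros) auto

lemma tendsto_phi_term:
  assumes z: "\<And>k. k \<in> {1..n} \<Longrightarrow> ((\<lambda>t. z' t k) \<longlongrightarrow> z k) F"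
    and c: "\<And>j. j \<in> {1..p} \<Longrightarrow> ((\<lambda>t. c' t j) \<longlongrightarrow> c j) F"
    and b: "(b' \<longlongrightarrow> b) F" and d: "(d' \<longlongrightarrow> d) F"
    and nz: "b \<noteq> 0" "d \<noteq> 0" "\<forall>j\<in>{1..p}. c j \<noteq> 0" "\<forall>k\<in>{1..n}. z k \<noteq> 0" "W n z \<noteq> 0"
      "\<forall>k\<in>{1..n}. \<forall>j\<in>{1..p}. \<forall>i\<le>l k.
         qpoch q (c j * z k) i \<noteq> 0 \<and> qpoch q (q powi (1 - int (m j)) * z k / c j) i \<noteq> 0"
      "\<forall>j\<in>{1..n}. \<forall>k\<in>{1..n}. \<forall>i\<le>l k.
         qpoch q (q * z k / z j) i \<noteq> 0 \<and> qpoch q (q ^ (1 + l j) * z j * z k) i \<noteq> 0"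
      "\<forall>k\<in>{1..n}. \<forall>i\<le>l k.
         qpoch q (q * z k / b) i \<noteq> 0 \<and> qpoch q (q * z k / d) i \<noteq> 0"
    and y: "y \<in> index_box n l"
  shows "((\<lambda>t. phi_term q n p l m (z' t) (c' t) (b' t) (d' t) y) \<longlongrightarrow> phi_term q n p l m z c b d y) F"
proof -
  have yl: "y k \<le> l k" if "k \<in> {1..n}" for k
    using y that by (auto simp: index_box_def PiE_def Pi_def)
  show ?thesis
    unfolding phi_term_def using nz yl
    by (intro tendsto_intros tendsto_W z c b d) auto
qed

lemma tendsto_dual_term:
  assumes z: "\<And>k. k \<in> {1..n} \<Longrightarrow> ((\<lambda>t. z' t k) \<longlongrightarrow> z k) F"
    and c: "\<And>j. j \<in> {1..p} \<Longrightarrow> ((\<lambda>t. c' t j) \<longlongrightarrow> c j) F"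
    and b: "(b' \<longlongrightarrow> b) F" and d: "(d' \<longlongrightarrow> d) F"
    and nz: "b \<noteq> 0" "d \<noteq> 0" "q \<noteq> 0" "s \<noteq> 0" "\<forall>j\<in>{1..p}. c j \<noteq> 0" "\<forall>k\<in>{1..n}. z k \<noteq> 0" "W p (\<lambda>j. c j / s) \<noteq> 0"
      "\<forall>k\<in>{1..n}. \<forall>j\<in>{1..p}. \<forall>i\<le>m j.
         qpoch q (c j * z k) i \<noteq> 0 \<and> qpoch q (q powi (- int (l k)) * c j / z k) i \<noteq> 0"
      "\<forall>j\<in>{1..p}. \<forall>k\<in>{1..p}. \<forall>i\<le>m j.
         qpoch q (q * c j / c k) i \<noteq> 0 \<and> qpoch q (q ^ m k * c j * c k) i \<noteq> 0"
      "\<forall>j\<in>{1..p}. \<forall>i\<le>m j. qpoch q (c j * b) i \<noteq> 0 \<and> qpoch q (c j * d) i \<noteq> 0"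
    and x: "x \<in> index_box p m"
  shows "((\<lambda>t. dual_term q s n p l m (z' t) (c' t) (b' t) (d' t) x) \<longlongrightarrow> dual_term q s n p l m z c b d x) F"
proof -
  have xm: "x k \<le> m k" if "k \<in> {1..p}" for k
    using x that by (auto simp: index_box_def PiE_def Pi_def)
  show ?thesis
    unfolding dual_term_def using nz xm
    by (intro tendsto_intros tendsto_W z c b d) auto
qed

lemma tendsto_prefactor:
  assumes z: "\<And>k. k \<in> {1..n} \<Longrightarrow> ((\<lambda>t. z' t k) \<longlongrightarrow> z k) F"
    and c: "\<And>j. j \<in> {1..p} \<Longrightarrow> ((\<lambda>t. c' t j) \<longlongrightarrow> c j) F"
    and b: "(b' \<longlongrightarrow> b) F" and d: "(d' \<longlongrightarrow> d) F"
    and nz: "b \<noteq> 0" "d \<noteq> 0" "\<forall>j\<in>{1..p}. c j \<noteq> 0" "\<forall>k\<in>{1..n}. z k \<noteq> 0"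
      "qpoch q (q powi (- int (tsum n l)) * b * d) (tsum p m) \<noteq> 0"
      "\<forall>k\<in>{1..n}. qpoch q (q * z k / b) (l k) \<noteq> 0 \<and> qpoch q (q * z k / d) (l k) \<noteq> 0"
      "\<forall>j\<in>{1..n}. \<forall>k\<in>{j<..n}. qpoch q (q * z j * z k) (l j + l k) \<noteq> 0"
      "\<forall>j\<in>{1..p}. \<forall>k\<in>{1..p}. qpoch q (c j * c k) (m j) \<noteq> 0"
      "\<forall>k\<in>{1..n}. \<forall>j\<in>{1..p}. qpoch q (c j / z k) (m j) \<noteq> 0"
  shows "((\<lambda>t. prefactor q n p l m (z' t) (c' t) (b' t) (d' t)) \<longlongrightarrow> prefactor q n p l m z c b d) F"
  unfolding prefactor_def using nz
  by (intro tendsto_intros z c b d) auto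

text \<open>The square root \<open>s\<close> of \<open>q\<close> enters the identity only through
  the quotient of two values of \<open>W p\<close>, which is the same for \<open>s\<close> and
  \<open>- s\<close>. The denominator hypotheses provide continuity at the given parameters.\<close>

theorem corollary4p4:
  fixes q s b d :: complex
    and n p :: nat
    and m l :: "nat \<Rightarrow> nat"
    and c z :: "nat \<Rightarrow> complex"
  assumes q: "0 < norm q" "norm q < 1"
    and s: "s ^ 2 = q"
    and np: "n \<ge> 1" "p \<ge> 1"
    and nonzero: "b \<noteq> 0" "d \<noteq> 0"
      "\<forall>j\<in>{1..p}. c j \<noteq> 0" "\<forall>k\<in>{1..n}. z k \<noteq> 0"
    and denominators_left:
      "W n z \<noteq> 0"
      "\<forall>k\<in>{1..n}. \<forall>j\<in>{1..p}. \<forall>i\<le>l k.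
         qpoch q (c j * z k) i \<noteq> 0 \<and> qpoch q (q powi (1 - int (m j)) * z k / c j) i \<noteq> 0"
      "\<forall>j\<in>{1..n}. \<forall>k\<in>{1..n}. \<forall>i\<le>l k.
         qpoch q (q * z k / z j) i \<noteq> 0 \<and> qpoch q (q ^ (1 + l j) * z j * z k) i \<noteq> 0"
      "\<forall>k\<in>{1..n}. \<forall>i\<le>l k.
         qpoch q (q * z k / b) i \<noteq> 0 \<and> qpoch q (q * z k / d) i \<noteq> 0"
    and denominators_prefactor:
      "qpoch q (q powi (- int (tsum n l)) * b * d) (tsum p m) \<noteq> 0"
      "\<forall>k\<in>{1..n}. qpoch q (q * z k / b) (l k) \<noteq> 0 \<and> qpoch q (q * z k / d) (l k) \<noteq> 0"
      "\<forall>j\<in>{1..n}. \<forall>k\<in>{j<..n}. qpoch q (q * z j * z k) (l j + l k) \<noteq> 0"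
      "\<forall>j\<in>{1..p}. \<forall>k\<in>{1..p}. qpoch q (c j * c k) (m j) \<noteq> 0"
      "\<forall>k\<in>{1..n}. \<forall>j\<in>{1..p}. qpoch q (c j / z k) (m j) \<noteq> 0"
    and denominators_right:
      "W p (\<lambda>j. c j / s) \<noteq> 0"
      "\<forall>k\<in>{1..n}. \<forall>j\<in>{1..p}. \<forall>i\<le>m j.
         qpoch q (c j * z k) i \<noteq> 0 \<and> qpoch q (q powi (- int (l k)) * c j / z k) i \<noteq> 0"
      "\<forall>j\<in>{1..p}. \<forall>k\<in>{1..p}. \<forall>i\<le>m j.
         qpoch q (q * c j / c k) i \<noteq> 0 \<and> qpoch q (q ^ m k * c j * c k) i \<noteq> 0"
      "\<forall>j\<in>{1..p}. \<forall>i\<le>m j. qpoch q (c j * b) i \<noteq> 0 \<and> qpoch q (c j * d) i \<noteq> 0"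
  shows
    "(\<Sum>y\<in>index_box n l.
        (W n (\<lambda>k. z k * q ^ y k) / W n z)
      * (\<Prod>k\<in>{1..n}. \<Prod>j\<in>{1..p}.
           (qpoch q (q ^ m j * c j * z k) (y k) * qpoch q (q * z k / c j) (y k))
         / (qpoch q (c j * z k) (y k) * qpoch q (q powi (1 - int (m j)) * z k / c j) (y k)))
      * (\<Prod>j\<in>{1..n}. \<Prod>k\<in>{1..n}.
           (qpoch q (z j * z k) (y k) * qpoch q (q powi (- int (l j)) * z k / z j) (y k))
         / (qpoch q (q * z k / z j) (y k) * qpoch q (q ^ (1 + l j) * z j * z k) (y k)))
      * (\<Prod>k\<in>{1..n}.
           (qpoch q (b * z k) (y k) * qpoch q (d * z k) (y k))
         / (qpoch q (q * z k / b) (y k) * qpoch q (q * z k / d) (y k)))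
      * (q powi (1 - int (tsum p m) + int (tsum n l)) / (b * d)) ^ tsum n y)
   = (qpoch q (q / (b * d)) (tsum n l)
        / qpoch q (q powi (- int (tsum n l)) * b * d) (tsum p m))
   * ((\<Prod>j\<in>{1..p}. qpoch q (c j * b) (m j) * qpoch q (c j * d) (m j))
        / (\<Prod>k\<in>{1..n}. qpoch q (q * z k / b) (l k) * qpoch q (q * z k / d) (l k)))
   * ((\<Prod>j\<in>{1..n}. \<Prod>k\<in>{1..n}. qpoch q (q * z j * z k) (l k))
        / (\<Prod>j\<in>{1..n}. \<Prod>k\<in>{j<..n}. qpoch q (q * z j * z k) (l j + l k)))
   * ((\<Prod>j\<in>{1..p}. \<Prod>k\<in>{j<..p}. qpoch q (c j * c k) (m j + m k))
        / (\<Prod>j\<in>{1..p}. \<Prod>k\<in>{1..p}. qpoch q (c j * c k) (m j)))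
   * (\<Prod>k\<in>{1..n}. \<Prod>j\<in>{1..p}.
        qpoch q (q powi (- int (l k)) * c j / z k) (m j) / qpoch q (c j / z k) (m j))
   * (\<Sum>x\<in>index_box p m.
        (W p (\<lambda>j. c j * q ^ x j / s) / W p (\<lambda>j. c j / s))
      * (\<Prod>k\<in>{1..n}. \<Prod>j\<in>{1..p}.
           (qpoch q (q ^ l k * c j * z k) (x j) * qpoch q (c j / z k) (x j))
         / (qpoch q (c j * z k) (x j) * qpoch q (q powi (- int (l k)) * c j / z k) (x j)))
      * (\<Prod>j\<in>{1..p}. \<Prod>k\<in>{1..p}.
           (qpoch q (c j * c k / q) (x j) * qpoch q (q powi (- int (m k)) * c j / c k) (x j))
         / (qpoch q (q * c j / c k) (x j) * qpoch q (q ^ m k * c j * c k) (x j)))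
      * (\<Prod>j\<in>{1..p}.
           (qpoch q (c j / b) (x j) * qpoch q (c j / d) (x j))
         / (qpoch q (c j * b) (x j) * qpoch q (c j * d) (x j)))
      * (q powi (int (tsum p m) - int (tsum n l)) * b * d) ^ tsum p x)"
proof -
  \<comment> \<open>The parameters receive distinct positive weights, so every product or quotient of two of them that has
    to avoid the powers of \<open>q\<close> moves with \<open>t\<close> and meets each power for at most one real \<open>t\<close>.\<close>
  define e where "e = (\<lambda>t r. complex_of_real (exp (t * real r)))"
  define z' where "z' = (\<lambda>t k. z k * e t (p + 2 + k))"
  define c' where "c' = (\<lambda>t j. c j * e t (2 + j))"
  define b' where "b' = (\<lambda>t. b * e t 1)"
  define d' where "d' = (\<lambda>t. d * e t 2)"
  have q0: "q \<noteq> 0" using q by auto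
  have s0: "s \<noteq> 0" using s q0 by auto
  have lim: "((\<lambda>t. x * e t r) \<longlongrightarrow> x) (at 0)" for x r
  proof -
    have "((\<lambda>t. x * e t r) \<longlongrightarrow> x * complex_of_real (exp (0 * real r))) (at 0)"
      unfolding e_def by (intro tendsto_intros)
    then show ?thesis by simp
  qed
  have lims: "((\<lambda>t. z' t k) \<longlongrightarrow> z k) (at 0)" "((\<lambda>t. c' t j) \<longlongrightarrow> c j) (at 0)"
    "(b' \<longlongrightarrow> b) (at 0)" "(d' \<longlongrightarrow> d) (at 0)" for j k
    unfolding z'_def c'_def b'_def d'_def by (rule lim)+
  let ?f = "\<lambda>t. (\<Sum>y\<in>index_box n l. phi_term q n p l m (z' t) (c' t) (b' t) (d' t) y)
    - prefactor q n p l m (z' t) (c' t) (b' t) (d' t)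
      * (\<Sum>x\<in>index_box p m. dual_term q s n p l m (z' t) (c' t) (b' t) (d' t) x)"
  have "(?f \<longlongrightarrow> (\<Sum>y\<in>index_box n l. phi_term q n p l m z c b d y)
    - prefactor q n p l m z c b d * (\<Sum>x\<in>index_box p m. dual_term q s n p l m z c b d x)) (at 0)"
    by (intro tendsto_diff tendsto_mult tendsto_sum tendsto_phi_term tendsto_prefactor tendsto_dual_term lims
        nonzero denominators_left denominators_prefactor denominators_right q0 s0)
  \<comment> \<open>The difference of the two sides vanishes wherever the parameters on the curve
    are generic, so its non-zero values are confined to the exceptional set.\<close>
  moreover have "countable {t. ?f t \<noteq> 0}"
  proof (rule countable_subset)
    show "{t. ?f t \<noteq> 0} \<subseteq> {t. \<not> generic_params q n p (z' t) (c' t) (b' t) (d' t)}"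
      using phi_duality_generic[OF _ s] by auto
    have e_mult: "e t r * e t r' = complex_of_real (exp (t * (real r + real r')))" for t r r'
      by (simp add: e_def exp_add ring_distribs)
    have e_div: "e t r / e t r' = complex_of_real (exp (t * (real r - real r')))" for t r r'
      by (simp add: e_def exp_diff right_diff_distrib)
    have qm: "countable {t. \<not> q_free q (x * e t r * (y * e t r'))}" if "x \<noteq> 0" "y \<noteq> 0" "r > 0" for x y r r'
    proof -
      have eqX: "x * e t r * (y * e t r') = x * y * complex_of_real (exp (t * (real r + real r')))" for t
        unfolding e_mult[symmetric] by simp
      show ?thesis unfolding eqX using countable_not_q_free[of "x * y" "real r + real r'" q] that by simp
    qed
    have qd: "countable {t. \<not> q_free q (x * e t r / (y * e t r'))}" if "x \<noteq> 0" "y \<noteq> 0" "r \<noteq> r'" for x y r r'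
    proof -
      have eqX: "x * e t r / (y * e t r') = x / y * complex_of_real (exp (t * (real r - real r')))" for t
        unfolding e_div[symmetric] by simp
      show ?thesis unfolding eqX using countable_not_q_free[of "x / y" "real r - real r'" q] that by simp
    qed
    have e0: "e t r \<noteq> 0" for t r by (simp add: e_def)
    have pow: "\<forall>i>0. q ^ i \<noteq> 1"
    proof (intro allI impI)
      fix i :: nat assume "i > 0"
      then have "norm (q ^ i) < 1" using q by (simp add: norm_power power_less_one_iff)
      then show "q ^ i \<noteq> 1" by auto
    qed
    show "countable {t. \<not> generic_params q n p (z' t) (c' t) (b' t) (d' t)}"
      unfolding generic_params_def z'_def c'_def b'_def d'_def
      by (intro countable_not_conj countable_not_ball countable_not_imp finite_atLeastAtMost;
          (rule qm qd)?; use pow q0 e0 nonzero in \<open>auto\<close>)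
  qed
  ultimately have "(\<Sum>y\<in>index_box n l. phi_term q n p l m z c b d y)
    - prefactor q n p l m z c b d * (\<Sum>x\<in>index_box p m. dual_term q s n p l m z c b d x) = 0"
    by (rule tendsto_zero_of_cocountable)
  then show ?thesis
    unfolding phi_term_def prefactor_def dual_term_def by simp
qed

end
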